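(* Let $f,g:\mathbb{C}\to\mathbb{C}$ be entire maps sharing an invariant bounded Fatou component $D$ (that is, $D$ is a bounded Fatou component of both $f$ and $g$, invariant under both). Assume that $D$ is an attracting component of $f$ and that $f$ and $g$ have the same set of preperiodic points. Then the semigroup $\langle f,g\rangle$ generated by $f$ and $g$ under composition contains neither free non-cyclic nor free abelian non-cyclic subsemigroups.
   Context: A Fatou component $D$ is invariant under $f$ if $f(D)\subseteq D$. A point is preperiodic for a map if its forward orbit is finite. "Free non-cyclic" means free on at least two generators; "free abelian non-cyclic" means a free abelian semigroup of rank at least two. *)

theory Defs
  imports "HOL-Complex_Analysis.Complex_Analysis" "HOL-Library.Multiset"
begin

(* Normality in the sense of Montel, for families of entire functions viewed as maps into the
   Riemann sphere: the limit may also be the constant infinity (the last disjunct).  On a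
   connected open set these are the only possible limits in the spherical metric. *)
definition normal_family :: "complex set \<Rightarrow> (complex \<Rightarrow> complex) set \<Rightarrow> bool" where
  "normal_family U \<F> \<longleftrightarrow>
     (\<forall>h :: nat \<Rightarrow> complex \<Rightarrow> complex. range h \<subseteq> \<F> \<longrightarrow>
        (\<exists>s :: nat \<Rightarrow> nat. strict_mono s \<and>
           ((\<exists>l. \<forall>K. compact K \<and> K \<subseteq> U \<longrightarrow> uniform_limit K (\<lambda>n. h (s n)) l sequentially) \<or>
            (\<forall>K. compact K \<and> K \<subseteq> U \<longrightarrow>
               (\<forall>B. \<forall>\<^sub>F n in sequentially. \<forall>z\<in>K. B < norm (h (s n) z))))))"

definition fatou_set :: "(complex \<Rightarrow> complex) \<Rightarrow> complex set" where
  "fatou_set f =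
     {z. \<exists>U. open U \<and> connected U \<and> z \<in> U \<and> normal_family U (range (\<lambda>n. f ^^ n))}"

definition invariant_fatou_component :: "(complex \<Rightarrow> complex) \<Rightarrow> complex set \<Rightarrow> bool" where
  "invariant_fatou_component f D \<longleftrightarrow> D \<in> components (fatou_set f) \<and> f ` D \<subseteq> D"

(* Attracting is understood as distinct from superattracting, i.e. the multiplier is nonzero.
   With multiplier 0 allowed, z^2 and z^3 on the unit disk would share all preperiodic points
   and generate a free abelian semigroup of rank two. *)
definition attracting_component :: "(complex \<Rightarrow> complex) \<Rightarrow> complex set \<Rightarrow> bool" where
  "attracting_component f D \<longleftrightarrow> invariant_fatou_component f D \<and>
     (\<exists>p\<in>D. f p = p \<and> 0 < norm (deriv f p) \<and> norm (deriv f p) < 1)"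

definition preperiodic :: "('a \<Rightarrow> 'a) \<Rightarrow> 'a \<Rightarrow> bool" where
  "preperiodic f z \<longleftrightarrow> finite (range (\<lambda>n. (f ^^ n) z))"

inductive_set comp_semigroup :: "('a \<Rightarrow> 'a) set \<Rightarrow> ('a \<Rightarrow> 'a) set"
  for A :: "('a \<Rightarrow> 'a) set" where
  gen: "h \<in> A \<Longrightarrow> h \<in> comp_semigroup A"
| comp: "h \<in> comp_semigroup A \<Longrightarrow> k \<in> comp_semigroup A \<Longrightarrow> h \<circ> k \<in> comp_semigroup A"

definition subsemigroup :: "('a \<Rightarrow> 'a) set \<Rightarrow> ('a \<Rightarrow> 'a) set \<Rightarrow> bool" where
  "subsemigroup S T \<longleftrightarrow> S \<noteq> {} \<and> S \<subseteq> T \<and> (\<forall>h\<in>S. \<forall>k\<in>S. h \<circ> k \<in> S)"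

(* The free semigroup on X consists of the nonempty words over X, the free abelian semigroup
   on X of the nonempty finite multisets over X; phi is an isomorphism onto S. *)
definition free_semigroup_on :: "('a \<Rightarrow> 'a) set \<Rightarrow> ('a \<Rightarrow> 'a) set \<Rightarrow> bool" where
  "free_semigroup_on X S \<longleftrightarrow>
     (\<exists>\<phi>. bij_betw \<phi> {w. w \<noteq> [] \<and> set w \<subseteq> X} S \<and>
          (\<forall>x\<in>X. \<phi> [x] = x) \<and>
          (\<forall>u v. u \<noteq> [] \<and> set u \<subseteq> X \<and> v \<noteq> [] \<and> set v \<subseteq> X \<longrightarrow> \<phi> (u @ v) = \<phi> u \<circ> \<phi> v))"

definition free_abelian_semigroup_on :: "('a \<Rightarrow> 'a) set \<Rightarrow> ('a \<Rightarrow> 'a) set \<Rightarrow> bool" where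
  "free_abelian_semigroup_on X S \<longleftrightarrow>
     (\<exists>\<phi>. bij_betw \<phi> {M. M \<noteq> {#} \<and> set_mset M \<subseteq> X} S \<and>
          (\<forall>x\<in>X. \<phi> {#x#} = x) \<and>
          (\<forall>M N. M \<noteq> {#} \<and> set_mset M \<subseteq> X \<and> N \<noteq> {#} \<and> set_mset N \<subseteq> X \<longrightarrow>
             \<phi> (M + N) = \<phi> M \<circ> \<phi> N))"

definition free_noncyclic :: "('a \<Rightarrow> 'a) set \<Rightarrow> bool" where
  "free_noncyclic S \<longleftrightarrow> (\<exists>X. (\<exists>x\<in>X. \<exists>y\<in>X. x \<noteq> y) \<and> free_semigroup_on X S)"

definition free_abelian_noncyclic :: "('a \<Rightarrow> 'a) set \<Rightarrow> bool" where
  "free_abelian_noncyclic S \<longleftrightarrow>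
     (\<exists>X. (\<exists>x\<in>X. \<exists>y\<in>X. x \<noteq> y) \<and> free_abelian_semigroup_on X S)"

end

theory Submission
  imports Defs
begin

text \<open>
  Let \<open>p\<close> be the attracting fixed point of \<open>f\<close> in \<open>D\<close>.  The maximum principle makes the bounded component
  \<open>D\<close> simply connected, and every word in \<open>f\<close> and \<open>g\<close> is a proper holomorphic self-map of \<open>D\<close>.  On the unit
  disc, with \<open>p\<close> moved to \<open>0\<close>, words become finite Blaschke products, hence extend across the circle;
  \<open>f\<close> becomes a map \<open>F\<close> with \<open>F 0 = 0\<close> and \<open>0 < |F' 0| < 1\<close>, which expands the circle.  A point of \<open>D\<close> is
  preperiodic for \<open>f\<close> exactly if it is eventually mapped to \<open>p\<close>, so all words map the set \<open>O\<close> of iterated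
  preimages of \<open>0\<close> under \<open>F\<close> into itself.  This is how the hypothesis on preperiodic points enters.
  
  The heart is a rigidity statement, \<open>finitely_many_germ_classes\<close>: among sufficiently many maps \<open>e\<close> that
  preserve \<open>O\<close>, two satisfy \<open>F\<^sup>n \<circ> e = F\<^sup>n' \<circ> e'\<close>.  Fix a point \<open>\<zeta>\<close> of a cycle of \<open>F\<close> on the circle and
  the inverse branch \<open>R\<close> of the return map there (\<open>repelling_cycle\<close>).  For \<open>l\<close> large the germ
  \<open>F\<^sup>n \<circ> e \<circ> R\<^sup>l\<close>, with \<open>n\<close> chosen so that its derivative has size about one, is nearly affine on a fixed
  ball about \<open>\<zeta>\<close> (\<open>renormalised_word\<close>).  It maps a sequence \<open>q k \<rightarrow> \<zeta>\<close> of points of \<open>O\<close> to points of \<open>O\<close>,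
  and the distance from the image of \<open>q k\<close> to the rest of \<open>O\<close> is at least \<open>const * C^(-k)\<close>.  If two such germs
  agree at \<open>N\<close> consecutive points \<open>q k\<close> lying very close to \<open>\<zeta>\<close>, then their difference has \<open>N\<close> zeros there
  and is at most \<open>const * \<omega>^N\<close> with \<open>\<omega>\<close> as small as desired (\<open>many_zeros_decay\<close>); taking \<open>\<omega> < 1/C\<close>
  forces agreement at the next point, and so on for ever.  A germ is therefore determined by its values at
  a fixed finite set of points, and those values range over finite sets since \<open>O\<close> is discrete.
  
  Applied to the powers of a word \<open>x\<close>, this gives \<open>f\<^sup>N \<circ> x\<^sup>m = f\<^sup>N\<^sup>+\<^sup>a\<close> with \<open>m > 0\<close>
  (\<open>iterate_relation\<close>).  For two words \<open>x\<close>, \<open>y\<close> one can choose exponents such that all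
  \<open>x^(\<alpha> i) \<circ> y^(\<beta> (K - i))\<close>, \<open>0 \<le> i \<le> K\<close>, are lifts of one and the same iterate of \<open>f\<close> through \<open>f\<^sup>N\<close>.  The
  number of such lifts is bounded by the cardinality of a fibre of \<open>f\<^sup>N\<close>, so two of these products coincide
  (\<open>power_coincidence\<close>), which is impossible for two free generators, abelian or not.
\<close>

section \<open>Schwarz-Pick estimates\<close>

lemma moebius_norm_identity:
  fixes a w :: complex
  shows "(norm (1 - cnj a * w))\<^sup>2 - (norm (w - a))\<^sup>2 = (1 - (norm a)\<^sup>2) * (1 - (norm w)\<^sup>2)"
  by (simp only: cmod_power2) (simp add: algebra_simps power2_eq_square)

lemma one_minus_cnj_mult_nonzero:
  fixes a w :: complex
  assumes "norm a * norm w < 1"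
  shows "1 - cnj a * w \<noteq> 0"
proof
  assume "1 - cnj a * w = 0"
  then have "norm (cnj a * w) = 1" by simp
  then show False using assms by (simp add: norm_mult)
qed

text \<open>
  The Schwarz lemma, applied after moving \<open>h z\<close> to the origin by a disc automorphism.  It is used in the
  form that a map with large derivative at \<open>z\<close> cannot send \<open>z\<close> too close to the circle.
\<close>

lemma schwarz_pick_deriv:
  assumes hol: "h holomorphic_on ball z t" and t: "t > 0"
    and lt: "\<And>w. w \<in> ball z t \<Longrightarrow> norm (h w) < 1"
  shows "t * norm (deriv h z) \<le> 2 * (1 - norm (h z))"
proof -
  define a where "a = h z"
  define k where "k \<xi> = (h (z + of_real t * \<xi>) - a) / (1 - cnj a * h (z + of_real t * \<xi>))" for \<xi>
  have a1: "norm a < 1" unfolding a_def using lt t by simp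
  have inball: "z + of_real t * \<xi> \<in> ball z t" if "norm \<xi> < 1" for \<xi>
    using that t by (simp add: dist_norm norm_mult)
  have nz: "1 - cnj a * h (z + of_real t * \<xi>) \<noteq> 0" if "norm \<xi> < 1" for \<xi>
  proof (rule one_minus_cnj_mult_nonzero)
    show "norm a * norm (h (z + of_real t * \<xi>)) < 1"
      using mult_strict_mono[OF a1 lt[OF inball[OF that]]] by simp
  qed
  have holk: "k holomorphic_on ball 0 1"
  proof -
    have "(h \<circ> (\<lambda>\<xi>. z + of_real t * \<xi>)) holomorphic_on ball 0 1"
      by (rule holomorphic_on_compose_gen[OF _ hol]) (auto intro!: holomorphic_intros inball)
    then have "(\<lambda>\<xi>. h (z + of_real t * \<xi>)) holomorphic_on ball 0 1"
      by (simp add: o_def)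
    then show ?thesis unfolding k_def using nz by (intro holomorphic_intros) auto
  qed
  have klt: "norm (k \<xi>) < 1" if "norm \<xi> < 1" for \<xi>
    using Moebius_function_norm_lt_1[OF a1 lt[OF inball[OF that]], of 0]
    by (simp add: k_def Moebius_function_simple)
  have k0: "k 0 = 0" by (simp add: k_def a_def)
  have D: "norm (deriv k 0) \<le> 1"
    using Schwarz_Lemma(2)[OF holk k0 klt, of 0] by simp
  have D2: "deriv k 0 = of_real t * deriv h z / (1 - cnj a * a)"
  proof (rule DERIV_imp_deriv)
    have "(h has_field_derivative deriv h z) (at (z + of_real t * 0))"
      using holomorphic_derivI[OF hol open_ball, of z UNIV] t by simp
    then have dh: "((\<lambda>\<xi>. h (z + of_real t * \<xi>)) has_field_derivative deriv h z * of_real t) (at 0)"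
      by (rule DERIV_chain2) (auto intro!: derivative_eq_intros)
    have n: "1 - cnj a * h (z + of_real t * 0) \<noteq> 0" using nz[of 0] by simp
    have "(k has_field_derivative
        ((deriv h z * of_real t - 0) * (1 - cnj a * h (z + of_real t * 0))
          - (h (z + of_real t * 0) - a) * (0 - cnj a * (deriv h z * of_real t)))
        / ((1 - cnj a * h (z + of_real t * 0)) * (1 - cnj a * h (z + of_real t * 0)))) (at 0)"
      unfolding k_def by (intro DERIV_divide DERIV_diff DERIV_const DERIV_cmult dh n)
    then show "(k has_field_derivative of_real t * deriv h z / (1 - cnj a * a)) (at 0)"
      using n by (auto simp: a_def mult.commute split: if_splits)
  qed
  have N: "norm (1 - cnj a * a) = 1 - (norm a)\<^sup>2"
  proof -
    have "1 - cnj a * a = of_real (1 - (norm a)\<^sup>2)"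
      by (simp add: mult.commute[of "cnj a"] complex_norm_square del: of_real_power)
    moreover have "(norm a)\<^sup>2 \<le> 1" using a1 by (simp add: power_le_one)
    ultimately show ?thesis by (metis abs_of_nonneg diff_ge_0_iff_ge norm_of_real)
  qed
  have pos: "1 - (norm a)\<^sup>2 > 0" using a1 by (simp add: power_less_one_iff abs_square_less_1)
  have "norm (deriv k 0) = t * norm (deriv h z) / (1 - (norm a)\<^sup>2)"
    unfolding D2 norm_divide N using t by (simp add: norm_mult)
  then have "t * norm (deriv h z) \<le> 1 - (norm a)\<^sup>2"
    using D pos by (simp add: divide_le_eq)
  also have "\<dots> = (1 + norm a) * (1 - norm a)" by (simp add: power2_eq_square algebra_simps)
  also have "\<dots> \<le> 2 * (1 - norm a)" using a1 by (intro mult_right_mono) auto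
  finally show ?thesis by (simp add: a_def)
qed

text \<open>
  A self-map of the disc decreases hyperbolic distance to the image of the origin, so it cannot push \<open>z\<close>
  to the circle much faster than linearly in \<open>1 - norm z\<close>.
\<close>

lemma disc_map_boundary_distance:
  assumes hol: "h holomorphic_on ball 0 1" and lt: "\<And>w. norm w < 1 \<Longrightarrow> norm (h w) < 1"
    and z: "norm z < 1"
  shows "(1 - norm (h 0)) / 4 * (1 - norm z) \<le> 1 - norm (h z)"
proof -
  define a where "a = h 0"
  define w where "w = h z"
  define r where "r = norm z"
  have a1: "norm a < 1" and w1: "norm w < 1" unfolding a_def w_def using lt z by simp_all
  have nz: "1 - cnj a * h x \<noteq> 0" if "norm x < 1" for x
    using mult_strict_mono[OF a1 lt[OF that]] by (intro one_minus_cnj_mult_nonzero) simp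
  define k where "k x = (h x - a) / (1 - cnj a * h x)" for x
  have "k holomorphic_on ball 0 1"
    unfolding k_def using nz hol by (intro holomorphic_intros) auto
  moreover have "norm (k x) < 1" if "norm x < 1" for x
    using Moebius_function_norm_lt_1[OF a1 lt[OF that], of 0]
    by (simp add: k_def Moebius_function_simple)
  ultimately have "norm (k z) \<le> norm z"
    using Schwarz_Lemma(1)[of k z] z by (simp add: k_def a_def)
  then have "norm (w - a) \<le> r * norm (1 - cnj a * w)"
    using nz[OF z] by (simp add: k_def w_def r_def norm_divide divide_le_eq)
  then have "(norm (w - a))\<^sup>2 \<le> (r * norm (1 - cnj a * w))\<^sup>2"
    by (intro power_mono) auto
  then have "(1 - r\<^sup>2) * (norm (1 - cnj a * w))\<^sup>2 \<le> (1 - (norm a)\<^sup>2) * (1 - (norm w)\<^sup>2)"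
    using moebius_norm_identity[of a w] by (simp add: algebra_simps power_mult_distrib)
  moreover have "(1 - r) * (1 - norm a)\<^sup>2 \<le> (1 - r\<^sup>2) * (norm (1 - cnj a * w))\<^sup>2"
  proof (rule mult_mono)
    have r01: "0 \<le> r" "r < 1" using z by (auto simp: r_def)
    show "1 - r \<le> 1 - r\<^sup>2" using r01 by (simp add: power2_eq_square mult_left_le_one_le)
    show "0 \<le> 1 - r\<^sup>2" using r01 by (simp add: power_le_one)
    have "norm (cnj a * w) \<le> norm a" using w1 by (simp add: norm_mult mult_left_le)
    then have "1 - norm a \<le> norm (1 - cnj a * w)"
      using norm_triangle_ineq2[of 1 "cnj a * w"] by simp
    then show "(1 - norm a)\<^sup>2 \<le> (norm (1 - cnj a * w))\<^sup>2"
      using a1 by (intro power_mono) auto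
  qed auto
  moreover have "(1 - (norm a)\<^sup>2) * (1 - (norm w)\<^sup>2) \<le> (2 * (1 - norm a)) * (2 * (1 - norm w))"
  proof -
    have *: "1 - x\<^sup>2 \<le> 2 * (1 - x)" "0 \<le> 1 - x\<^sup>2" if "0 \<le> x" "x < 1" for x :: real
    proof -
      have "0 \<le> (1 - x)\<^sup>2" by simp
      then show "1 - x\<^sup>2 \<le> 2 * (1 - x)" by (simp add: power2_eq_square algebra_simps)
      show "0 \<le> 1 - x\<^sup>2" using that by (simp add: power_le_one)
    qed
    show ?thesis using a1 w1 by (intro mult_mono *) auto
  qed
  ultimately have "(1 - norm a) * ((1 - norm a) * (1 - r)) \<le> (1 - norm a) * (4 * (1 - norm w))"
    by (simp add: algebra_simps power2_eq_square)
  then have "(1 - norm a) * (1 - r) \<le> 4 * (1 - norm w)"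
    using a1 by (simp only: mult_le_cancel_left_pos diff_gt_0_iff_gt)
  then show ?thesis by (simp add: a_def w_def r_def)
qed

section \<open>Extension of proper disc maps across the circle\<close>

text \<open>
  Behaviour of a finite Blaschke product, or a unimodular constant, on a neighbourhood of the closed disc
  free of poles.  Points outside the disc stay outside; this is how inverse branches will be seen to
  preserve the open disc.
\<close>

definition reflected_disc_map :: "real \<Rightarrow> (complex \<Rightarrow> complex) \<Rightarrow> bool" where
  "reflected_disc_map \<tau> H \<longleftrightarrow> 0 < \<tau> \<and> H holomorphic_on ball 0 (1 + \<tau>) \<and>
     (\<forall>z. norm z < 1 \<longrightarrow> norm (H z) \<le> 1) \<and> (\<forall>z. norm z = 1 \<longrightarrow> norm (H z) = 1) \<and>
     (\<forall>z. 1 < norm z \<and> norm z < 1 + \<tau> \<longrightarrow> 1 \<le> norm (H z))"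

lemma reflected_disc_map_mono:
  assumes "reflected_disc_map \<tau> H" "0 < \<tau>'" "\<tau>' \<le> \<tau>"
  shows "reflected_disc_map \<tau>' H"
proof -
  have "ball 0 (1 + \<tau>') \<subseteq> ball (0::complex) (1 + \<tau>)" using assms by (intro subset_ball) auto
  then show ?thesis using assms unfolding reflected_disc_map_def
    by (meson holomorphic_on_subset add_left_mono less_le_trans)
qed

lemma reflected_disc_map_moebius:
  assumes a: "norm a < 1"
  shows "reflected_disc_map (1 - norm a) (\<lambda>z. (z - a) / (1 - cnj a * z))"
proof -
  have nz: "1 - cnj a * z \<noteq> 0" if "norm z < 1 + (1 - norm a)" for z
  proof (rule one_minus_cnj_mult_nonzero)
    have "norm a * norm z \<le> norm a * (2 - norm a)" using that by (intro mult_left_mono) auto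
    also have "\<dots> = 1 - (1 - norm a)\<^sup>2" by (simp add: power2_eq_square algebra_simps)
    also have "\<dots> < 1" using a by simp
    finally show "norm a * norm z < 1" .
  qed
  have pos: "0 < 1 - (norm a)\<^sup>2" using a by (simp add: power_less_one_iff abs_square_less_1)
  have id: "(norm (1 - cnj a * z))\<^sup>2 - (norm (z - a))\<^sup>2 = (1 - (norm a)\<^sup>2) * (1 - (norm z)\<^sup>2)" for z
    by (rule moebius_norm_identity)
  show ?thesis unfolding reflected_disc_map_def
  proof (intro conjI allI impI)
    show "0 < 1 - norm a" using a by simp
    show "(\<lambda>z. (z - a) / (1 - cnj a * z)) holomorphic_on ball 0 (1 + (1 - norm a))"
      using nz by (intro holomorphic_intros) auto
  next
    fix z :: complex assume z: "norm z < 1"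
    then have "(norm z)\<^sup>2 \<le> 1" by (simp add: power_le_one)
    then have "0 \<le> (1 - (norm a)\<^sup>2) * (1 - (norm z)\<^sup>2)" using pos by (intro mult_nonneg_nonneg) auto
    then have "(norm (z - a))\<^sup>2 \<le> (norm (1 - cnj a * z))\<^sup>2" using id[of z] by linarith
    then have "norm (z - a) \<le> norm (1 - cnj a * z)" by (rule power2_le_imp_le) simp
    then show "norm ((z - a) / (1 - cnj a * z)) \<le> 1"
      by (simp add: norm_divide divide_le_eq)
  next
    fix z :: complex assume z: "norm z = 1"
    then have "(norm (z - a))\<^sup>2 = (norm (1 - cnj a * z))\<^sup>2" using id[of z] by simp
    then have "norm (z - a) = norm (1 - cnj a * z)" by simp
    then show "norm ((z - a) / (1 - cnj a * z)) = 1"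
      using nz[of z] z a by (simp add: norm_divide)
  next
    fix z :: complex assume z: "1 < norm z \<and> norm z < 1 + (1 - norm a)"
    then have "1 \<le> (norm z)\<^sup>2" by (simp add: one_le_power)
    then have "(1 - (norm a)\<^sup>2) * (1 - (norm z)\<^sup>2) \<le> 0" using pos by (intro mult_nonneg_nonpos) auto
    then have "(norm (1 - cnj a * z))\<^sup>2 \<le> (norm (z - a))\<^sup>2" using id[of z] by linarith
    then have "norm (1 - cnj a * z) \<le> norm (z - a)" by (rule power2_le_imp_le) simp
    then show "1 \<le> norm ((z - a) / (1 - cnj a * z))"
      using nz[of z] z by (simp add: norm_divide le_divide_eq)
  qed
qed

lemma reflected_disc_map_mult:
  assumes "reflected_disc_map \<tau> G" "reflected_disc_map \<tau> H"
  shows "reflected_disc_map \<tau> (\<lambda>z. G z * H z)"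
proof -
  have "1 \<le> norm (G z * H z)" if "1 \<le> norm (G z)" "1 \<le> norm (H z)" for z
    using mult_mono[of 1 "norm (G z)" 1 "norm (H z)"] that by (simp add: norm_mult)
  then show ?thesis
    using assms unfolding reflected_disc_map_def
    by (auto intro!: holomorphic_intros simp: norm_mult mult_le_one)
qed

text \<open>
  The maps in question need not extend continuously to the circle; bounds near it suffice.
\<close>

lemma maximum_modulus_inner_ball:
  assumes hol: "h holomorphic_on ball 0 1"
    and bd: "\<And>z. s < norm z \<Longrightarrow> norm z < 1 \<Longrightarrow> norm (h z) \<le> B" and s: "s < 1"
    and z: "norm z < 1"
  shows "norm (h z) \<le> B"
proof -
  define t where "t = (1 + max s (norm z)) / 2"
  have t: "s < t" "norm z < t" "t < 1" using s z by (auto simp: t_def max_def)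
  have t0: "0 < t" using t(2) norm_ge_zero[of z] by linarith
  have sub: "cball 0 t \<subseteq> ball (0::complex) 1" using t by (auto)
  show ?thesis
  proof (rule maximum_modulus_frontier[of h "cball 0 t"])
    show "h holomorphic_on interior (cball 0 t)"
      using hol sub by (meson holomorphic_on_subset interior_subset subset_trans)
    show "continuous_on (closure (cball 0 t)) h"
      using holomorphic_on_imp_continuous_on[OF hol] sub by (simp add: continuous_on_subset)
    show "\<And>w. w \<in> frontier (cball 0 t) \<Longrightarrow> norm (h w) \<le> B"
      using bd t t0 by (simp add: frontier_cball)
  qed (use t in auto)
qed

lemma reflected_disc_map_const:
  assumes "norm (c::complex) = 1" shows "reflected_disc_map 1 (\<lambda>z. c)"
  using assms by (auto simp: reflected_disc_map_def)

text \<open>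
  The modulus tends to \<open>1\<close> at the circle, so the maximum principle applies both to \<open>h\<close> and to \<open>1 / h\<close>.
\<close>

lemma reflected_disc_map_zero_free:
  assumes hol: "h holomorphic_on ball 0 1" and le: "\<And>z. norm z < 1 \<Longrightarrow> norm (h z) \<le> 1"
    and proper: "\<And>t. t < 1 \<Longrightarrow> \<exists>s<1. \<forall>z. s < norm z \<and> norm z < 1 \<longrightarrow> t < norm (h z)"
    and nz: "\<And>z. norm z < 1 \<Longrightarrow> h z \<noteq> 0"
  shows "\<exists>c. norm c = 1 \<and> (\<forall>z. norm z < 1 \<longrightarrow> h z = c)"
proof -
  have eq1: "norm (h z) = 1" if z: "norm z < 1" for z
  proof -
    have "t \<le> norm (h z)" if t: "0 < t" "t < 1" for t
    proof -
      obtain s where s: "s < 1" "\<And>z. s < norm z \<Longrightarrow> norm z < 1 \<Longrightarrow> t < norm (h z)"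
        using proper[OF t(2)] by blast
      have "norm (1 / h z) \<le> 1 / t"
      proof (rule maximum_modulus_inner_ball[of "\<lambda>z. 1 / h z" s "1 / t", OF _ _ s(1) z])
        show "(\<lambda>z. 1 / h z) holomorphic_on ball 0 1" using hol nz by (intro holomorphic_intros) auto
        show "\<And>z. s < norm z \<Longrightarrow> norm z < 1 \<Longrightarrow> norm (1 / h z) \<le> 1 / t"
          using s(2) t by (simp add: norm_divide frac_le less_imp_le)
      qed
      then show ?thesis using t nz[OF z] by (simp add: norm_divide field_simps)
    qed
    then have "1 \<le> norm (h z)" by (meson dense_le_bounded zero_less_one)
    then show ?thesis using le[OF z] by simp
  qed
  have "h constant_on ball 0 1"
    by (rule maximum_modulus_principle[OF hol, of "ball 0 1" 0]) (auto simp: eq1)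
  then obtain c where "\<And>z. norm z < 1 \<Longrightarrow> h z = c" by (auto simp: constant_on_def)
  with eq1[of 0] show ?thesis by auto
qed

lemma holomorphic_divide_zero:
  assumes hol: "h holomorphic_on S" and S: "open S" and z: "h a = 0"
  obtains k where "k holomorphic_on S" "\<And>z. z \<in> S \<Longrightarrow> h z = (z - a) * k z"
proof -
  define k where "k z = (if z = a then deriv h a else h z / (z - a))" for z
  have "k holomorphic_on S"
    by (rule pole_theorem_open_0[OF hol S, of a]) (auto simp: k_def z)
  moreover have "h z = (z - a) * k z" for z using z by (simp add: k_def)
  ultimately show ?thesis using that by blast
qed

text \<open>
  A proper self-map of the disc is a finite Blaschke product.  Zeros are divided out one at a time: every
  Blaschke factor that is removed multiplies the modulus at a fixed point \<open>z0\<close> by at least \<open>1 / q > 1\<close>, while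
  the quotients stay bounded by \<open>1\<close>, so the process stops.
\<close>

lemma proper_disc_map_extends:
  assumes hol: "h holomorphic_on ball 0 1" and lt: "\<And>z. norm z < 1 \<Longrightarrow> norm (h z) < 1"
    and proper: "\<And>t. t < 1 \<Longrightarrow> \<exists>s<1. \<forall>z. s < norm z \<and> norm z < 1 \<longrightarrow> t < norm (h z)"
  shows "\<exists>\<tau> H. reflected_disc_map \<tau> H \<and> (\<forall>z. norm z < 1 \<longrightarrow> H z = h z)"
proof -
  obtain s where s: "s < 1" "\<And>z. s < norm z \<Longrightarrow> norm z < 1 \<Longrightarrow> 1/2 < norm (h z)"
    using proper[of "1/2"] by auto
  obtain z0 where z0: "norm z0 < 1" "h z0 \<noteq> 0"
  proof -
    define r where "r = (1 + max s 0) / 2"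
    have "0 \<le> r" "s < r" "r < 1" using s(1) by (auto simp: r_def)
    then have "s < norm (of_real r :: complex)" "norm (of_real r :: complex) < 1"
      by simp_all
    from s(2)[OF this] this(2) show ?thesis using that[of "of_real r"] by fastforce
  qed
  \<comment> \<open>The modulus at \<open>z0\<close> of every Blaschke factor with zero in \<open>cball 0 s\<close> is at most \<open>q\<close>, by
    \<open>moebius_norm_identity\<close> and \<open>norm (1 - cnj a * z0) \<le> 2\<close>.\<close>
  define q where "q = sqrt (1 - (1 - (norm z0)\<^sup>2) * (1 - (max s 0)\<^sup>2) / 4)"
  have q1: "q < 1" and q0: "0 \<le> q"
  proof -
    have z: "0 < 1 - (norm z0)\<^sup>2" "1 - (norm z0)\<^sup>2 \<le> 1" using z0 by (auto simp: abs_square_less_1)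
    have m: "0 < 1 - (max s 0)\<^sup>2" "1 - (max s 0)\<^sup>2 \<le> 1" using s(1) by (auto simp: abs_square_less_1 max_def)
    have "0 < (1 - (norm z0)\<^sup>2) * (1 - (max s 0)\<^sup>2)" using z m by simp
    moreover have "(1 - (norm z0)\<^sup>2) * (1 - (max s 0)\<^sup>2) \<le> 1" using z m by (simp add: mult_le_one)
    ultimately show "q < 1" "0 \<le> q" by (auto simp: q_def)
  qed
  have qbound: "norm ((z0 - a) / (1 - cnj a * z0)) \<le> q" if a: "norm a \<le> s" for a
  proof -
    have s0: "0 \<le> s" using a norm_ge_zero[of a] by linarith
    have a1: "norm a < 1" using a s by linarith
    have nz: "1 - cnj a * z0 \<noteq> 0"
      using mult_strict_mono[OF a1 z0(1)] by (intro one_minus_cnj_mult_nonzero) simp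
    have n2: "norm (1 - cnj a * z0) \<le> 2"
    proof -
      have "norm a * norm z0 \<le> 1" using a1 z0 by (intro mult_le_one) auto
      then show ?thesis using norm_triangle_ineq4[of 1 "cnj a * z0"] by (simp add: norm_mult)
    qed
    define M where "M = (norm (1 - cnj a * z0))\<^sup>2"
    have M: "0 < M" "M \<le> 4"
      using nz power_mono[OF n2, of 2] by (auto simp: M_def)
    have ga: "1 - s\<^sup>2 \<le> 1 - (norm a)\<^sup>2" using a by (simp add: power_mono)
    have gz: "0 \<le> 1 - (norm z0)\<^sup>2" using z0 by (simp add: power_le_one)
    have gs: "0 \<le> 1 - s\<^sup>2" using s s0 by (simp add: power_le_one)
    have "(1 - (norm z0)\<^sup>2) * (1 - s\<^sup>2) / 4 \<le> (1 - (norm a)\<^sup>2) * (1 - (norm z0)\<^sup>2) / M"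
      using ga gz gs M by (intro frac_le) (auto simp: mult.commute intro!: mult_mono mult_nonneg_nonneg)
    also have "\<dots> = (M - (norm (z0 - a))\<^sup>2) / M"
      using moebius_norm_identity[of a z0] by (simp add: M_def)
    also have "\<dots> = 1 - (norm (z0 - a))\<^sup>2 / M" using M by (simp add: diff_divide_distrib)
    finally have "(norm (z0 - a))\<^sup>2 / M \<le> 1 - (1 - (norm z0)\<^sup>2) * (1 - (max s 0)\<^sup>2) / 4"
      using s0 by (simp add: max_def)
    then have "(norm ((z0 - a) / (1 - cnj a * z0)))\<^sup>2 \<le> 1 - (1 - (norm z0)\<^sup>2) * (1 - (max s 0)\<^sup>2) / 4"
      by (simp add: norm_divide power_divide M_def)
    then show ?thesis unfolding q_def by (rule real_le_rsqrt)
  qed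
  have main: "\<exists>\<tau> H. reflected_disc_map \<tau> H \<and> (\<forall>z. norm z < 1 \<longrightarrow> H z = h z)"
    if "h holomorphic_on ball 0 1" "\<And>z. norm z < 1 \<Longrightarrow> norm (h z) \<le> 1"
      "\<And>t. t < 1 \<Longrightarrow> \<exists>s<1. \<forall>z. s < norm z \<and> norm z < 1 \<longrightarrow> t < norm (h z)"
      "\<And>z. s < norm z \<Longrightarrow> norm z < 1 \<Longrightarrow> 1/2 < norm (h z)"
      "q ^ n < norm (h z0)" for n h
    using that
  proof (induction n arbitrary: h)
    case 0
    then show ?case using z0(1) by (metis less_le_not_le power_0)
  next
    case (Suc n)
    show ?case
    proof (cases "\<forall>z. norm z < 1 \<longrightarrow> h z \<noteq> 0")
      case True
      then obtain c where "norm c = 1" "\<And>z. norm z < 1 \<Longrightarrow> h z = c"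
        using reflected_disc_map_zero_free[OF Suc.prems(1-3)] by blast
      then show ?thesis using reflected_disc_map_const by metis
    next
      case False
      then obtain a where a: "norm a < 1" "h a = 0" by blast
      have as: "norm a \<le> s" using Suc.prems(4)[of a] a by force
      obtain k where k: "k holomorphic_on ball 0 1" "\<And>z. norm z < 1 \<Longrightarrow> h z = (z - a) * k z"
        using holomorphic_divide_zero[OF Suc.prems(1) open_ball a(2)] by auto
      define h1 where "h1 z = k z * (1 - cnj a * z)" for z
      define b where "b z = (z - a) / (1 - cnj a * z)" for z
      have nz: "1 - cnj a * z \<noteq> 0" if "norm z < 1" for z
        using mult_strict_mono[OF a(1) that] by (intro one_minus_cnj_mult_nonzero) simp
      have hb: "h z = b z * h1 z" if "norm z < 1" for z
        using nz[OF that] k(2)[OF that] by (simp add: b_def h1_def)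
      have b_refl: "reflected_disc_map (1 - norm a) b"
        unfolding b_def by (rule reflected_disc_map_moebius[OF a(1)])
      have b1: "norm (b z) \<le> 1" if "norm z < 1" for z
        using b_refl that by (simp add: reflected_disc_map_def)
      have ge: "norm (h z) \<le> norm (h1 z)" if "norm z < 1" for z
        using hb[OF that] b1[OF that] by (simp add: norm_mult mult_left_le_one_le)
      have hol1: "h1 holomorphic_on ball 0 1"
        unfolding h1_def using k(1) by (intro holomorphic_intros)
      have le1: "norm (h1 z) \<le> 1" if z: "norm z < 1" for z
      proof -
        \<comment> \<open>Near the circle the removed factor \<open>b\<close> has modulus above \<open>t\<close>, so \<open>h1 = h / b\<close> is at most \<open>1 / t\<close> there.\<close>
        have "norm (h1 z) \<le> 1 / t" if t: "0 < t" "t < 1" for t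
        proof -
          have "continuous_on (cball 0 1) b"
            using b_refl a(1) by (auto simp: reflected_disc_map_def
              intro!: continuous_on_subset[OF holomorphic_on_imp_continuous_on])
          then have "uniformly_continuous_on (cball 0 1) b"
            by (rule compact_uniformly_continuous) simp
          then obtain d where d: "d > 0"
            "\<And>x y. x \<in> cball 0 1 \<Longrightarrow> y \<in> cball 0 1 \<Longrightarrow> dist y x < d \<Longrightarrow> dist (b y) (b x) < 1 - t"
            using t unfolding uniformly_continuous_on_def by (metis diff_gt_0_iff_gt)
          have bt: "t < norm (b z)" if z: "1 - min d 1 < norm z" "norm z < 1" for z
          proof -
            have z0: "z \<noteq> 0" using z(1) by auto
            define y where "y = z / of_real (norm z)"
            have y: "norm y = 1" using z0 by (simp add: y_def norm_divide)
            have "z - y = y * of_real (norm z - 1)" using z0 by (simp add: y_def field_simps)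
            then have "norm (z - y) = 1 - norm z" using y z
              by (metis abs_minus_commute abs_of_pos diff_gt_0_iff_gt mult_1 norm_mult norm_of_real)
            then have "dist z y < d" using z by (simp add: dist_norm)
            then have "dist (b z) (b y) < 1 - t" using d(2)[of y z] y z by auto
            moreover have "norm (b y) = 1" using b_refl y by (simp add: reflected_disc_map_def)
            ultimately show ?thesis using norm_triangle_ineq2[of "b y" "b z"]
              by (simp add: dist_norm norm_minus_commute)
          qed
          show ?thesis
          proof (rule maximum_modulus_inner_ball[OF hol1 _ _ z])
            fix w :: complex assume w: "1 - min d 1 < norm w" "norm w < 1"
            have "t * norm (h1 w) \<le> norm (b w) * norm (h1 w)"
              using bt[OF w] by (intro mult_right_mono) auto
            also have "\<dots> \<le> 1" using Suc.prems(2)[OF w(2)] hb[OF w(2)] by (simp add: norm_mult)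
            finally show "norm (h1 w) \<le> 1 / t" using t by (simp add: field_simps)
          qed (use d in auto)
        qed
        note bd = this
        show ?thesis
        proof (cases "h1 z = 0")
          case False
          then have "t \<le> 1 / norm (h1 z)" if "0 < t" "t < 1" for t
            using bd[OF that] that by (simp add: field_simps)
          then have "1 \<le> 1 / norm (h1 z)" by (meson dense_le_bounded zero_less_one)
          then show ?thesis using False by (simp add: field_simps)
        qed simp
      qed
      have qn: "q ^ n < norm (h1 z0)"
      proof (rule ccontr)
        assume "\<not> q ^ n < norm (h1 z0)"
        then have "norm (b z0) * norm (h1 z0) \<le> q * q ^ n"
          using qbound[OF as] q0 by (intro mult_mono) (auto simp: b_def)
        then show False using Suc.prems(5) hb[OF z0(1)] by (simp add: norm_mult)
      qed
      have "\<exists>\<tau> H. reflected_disc_map \<tau> H \<and> (\<forall>z. norm z < 1 \<longrightarrow> H z = h1 z)"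
      proof (rule Suc.IH[OF hol1 le1 _ _ qn])
        show "\<exists>s<1. \<forall>z. s < norm z \<and> norm z < 1 \<longrightarrow> t < norm (h1 z)" if "t < 1" for t
          using Suc.prems(3)[OF that] ge by (meson less_le_trans)
        show "\<And>z. s < norm z \<Longrightarrow> norm z < 1 \<Longrightarrow> 1 / 2 < norm (h1 z)"
          using Suc.prems(4) ge by (meson less_le_trans)
      qed
      then obtain \<tau> H where H: "reflected_disc_map \<tau> H" "\<And>z. norm z < 1 \<Longrightarrow> H z = h1 z" by blast
      define \<sigma> where "\<sigma> = min \<tau> (1 - norm a)"
      have "reflected_disc_map \<sigma> (\<lambda>z. b z * H z)"
        using H(1) b_refl a(1)
        by (intro reflected_disc_map_mult; elim reflected_disc_map_mono)
           (auto simp: \<sigma>_def reflected_disc_map_def)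
      moreover have "b z * H z = h z" if "norm z < 1" for z
        using H(2)[OF that] hb[OF that] by simp
      ultimately show ?thesis by blast
    qed
  qed
  obtain n where "q ^ n < norm (h z0)"
    using real_arch_pow_inv[OF _ q1, of "norm (h z0)"] z0 by auto
  then show ?thesis using main[OF hol _ proper s(2)] lt less_imp_le by blast
qed

section \<open>Expansion on the circle and iterated preimages of the fixed point\<close>

text \<open>
  The derivative at a boundary point is a limit of difference quotients along the radius, and these are
  bounded below by the quotients of the distances to the circle.
\<close>

lemma boundary_derivative_lower_bound:
  assumes hol: "H holomorphic_on ball 0 (1 + \<tau>)" and \<tau>: "0 < \<tau>"
    and x: "norm x = 1" "norm (H x) = 1"
    and depth: "\<And>z. norm z < 1 \<Longrightarrow> (1 - norm z) * (a + b * norm z) \<le> 1 - norm (H z)"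
  shows "a + b \<le> norm (deriv H x)"
proof -
  define r where "r n = 1 - 1 / (real n + 2)" for n :: nat
  define y where "y n = of_real (r n) * x" for n
  have r: "0 < r n" "r n < 1" for n by (auto simp: r_def field_simps)
  have rlim: "r \<longlonglongrightarrow> 1" unfolding r_def by real_asymp
  have ny: "norm (y n) = r n" for n using r[of n] x by (simp add: y_def norm_mult)
  have dist: "norm (y n - x) = 1 - r n" for n
  proof -
    have "y n - x = of_real (r n - 1) * x" by (simp add: y_def algebra_simps)
    then show ?thesis using r[of n] x by (simp only: norm_mult norm_of_real) simp
  qed
  have D: "(H has_field_derivative deriv H x) (at x)"
    using holomorphic_derivI[OF hol open_ball, of x UNIV] x \<tau> by simp
  have "(\<lambda>z. (H z - H x) / (z - x)) \<midarrow>x\<rightarrow> deriv H x"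
    using D by (simp add: has_field_derivative_iff)
  moreover have "y \<longlonglongrightarrow> x"
  proof -
    have "y \<longlonglongrightarrow> of_real 1 * x" unfolding y_def by (intro tendsto_intros rlim)
    then show ?thesis by simp
  qed
  moreover have "y n \<noteq> x" for n using dist[of n] r[of n] by auto
  ultimately have "(\<lambda>n. (H (y n) - H x) / (y n - x)) \<longlonglongrightarrow> deriv H x"
    by (auto simp: LIMSEQ_SEQ_conv[symmetric])
  then have L: "(\<lambda>n. norm ((H (y n) - H x) / (y n - x))) \<longlonglongrightarrow> norm (deriv H x)"
    by (rule tendsto_norm)
  have "(\<lambda>n. a + b * r n) \<longlonglongrightarrow> a + b * 1" by (intro tendsto_intros rlim)
  moreover have "a + b * r n \<le> norm ((H (y n) - H x) / (y n - x))" for n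
  proof -
    have "(1 - r n) * (a + b * r n) \<le> 1 - norm (H (y n))"
      using depth[of "y n"] r[of n] by (simp add: ny)
    also have "\<dots> \<le> norm (H (y n) - H x)"
      using norm_triangle_ineq2[of "H x" "H (y n)"] x by (simp add: norm_minus_commute)
    finally show ?thesis using r[of n] by (simp add: norm_divide dist field_simps)
  qed
  ultimately show ?thesis using LIMSEQ_le[OF _ L] by auto
qed

lemma reflected_disc_map_deriv_nonzero:
  assumes "reflected_disc_map \<tau> H" and lt: "\<And>z. norm z < 1 \<Longrightarrow> norm (H z) < 1" and x: "norm x = 1"
  shows "deriv H x \<noteq> 0"
proof -
  have hol: "H holomorphic_on ball 0 (1 + \<tau>)" and \<tau>: "0 < \<tau>" and H1: "norm (H x) = 1"
    using assms by (auto simp: reflected_disc_map_def)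
  have "H holomorphic_on ball 0 1" using hol by (rule holomorphic_on_subset) (use \<tau> in auto)
  then have "(1 - norm (H 0)) / 4 + 0 \<le> norm (deriv H x)"
    using disc_map_boundary_distance[of H] lt
    by (intro boundary_derivative_lower_bound[OF hol \<tau> x H1]) (auto simp: mult.commute)
  then show ?thesis using lt[of 0] by auto
qed

text \<open>
  A disc map with an attracting but not superattracting fixed point at the origin.  Since the origin is
  a simple zero, there are further zeros of \<open>F\<close> away from it (\<open>nonzero_zero\<close>), and these start the backward
  orbits used below.
\<close>

locale expanding_disc_map =
  fixes F :: "complex \<Rightarrow> complex" and \<tau> :: real
  assumes reflected: "reflected_disc_map \<tau> F"
    and disc: "\<And>z. norm z < 1 \<Longrightarrow> norm (F z) < 1"
    and fix0: "F 0 = 0" and multiplier: "deriv F 0 \<noteq> 0" "norm (deriv F 0) < 1"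
begin

lemma \<tau>_pos: "0 < \<tau>" and holF: "F holomorphic_on ball 0 (1 + \<tau>)"
  and circle: "norm z = 1 \<Longrightarrow> norm (F z) = 1"
  and outside: "1 \<le> norm z \<Longrightarrow> norm z < 1 + \<tau> \<Longrightarrow> 1 \<le> norm (F z)"
  using reflected by (auto simp: reflected_disc_map_def order.order_iff_strict)

lemma holF_disc: "F holomorphic_on ball 0 1"
  using holF by (rule holomorphic_on_subset) (use \<tau>_pos in auto)

lemma iterate_disc: "norm z < 1 \<Longrightarrow> norm ((F ^^ n) z) < 1"
  by (induction n) (auto intro: disc)

lemma iterate_0: "(F ^^ n) 0 = 0"
  by (induction n) (auto simp: fix0)

lemma iterate_hol_disc: "(F ^^ n) holomorphic_on ball 0 1"
proof (induction n)
  case 0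
  then show ?case by (simp add: id_def)
next
  case (Suc n)
  have "F \<circ> (F ^^ n) holomorphic_on ball 0 1"
    by (rule holomorphic_on_compose_gen[OF Suc holF_disc]) (auto intro: iterate_disc)
  then show ?case by (simp add: o_def)
qed

text \<open>
  Write \<open>F z = z * B z\<close>.  Since \<open>B 0 = deriv F 0\<close> lies in the open disc, \<open>B\<close> is a self-map of the disc and
  \<open>disc_map_boundary_distance\<close> applies to it.
\<close>

lemma contraction_bound:
  obtains c where "0 < c" "c \<le> 1" "\<And>z. norm z < 1 \<Longrightarrow> norm (F z) \<le> norm z * (1 - c * (1 - norm z))"
proof -
  obtain B where B: "B holomorphic_on ball 0 1" "\<And>z. norm z < 1 \<Longrightarrow> F z = z * B z" "deriv F 0 = B 0"
    using Schwarz3[OF holF_disc fix0] by blast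
  have B1: "norm (B z) \<le> 1" if "norm z < 1" for z
  proof (cases "z = 0")
    case True
    then show ?thesis using multiplier B(3) by simp
  next
    case False
    then show ?thesis
      using Schwarz_Lemma(1)[OF holF_disc fix0 disc that] B(2)[OF that] by (simp add: norm_mult)
  qed
  have Blt: "norm (B z) < 1" if z: "norm z < 1" for z
  proof (rule ccontr)
    assume "\<not> norm (B z) < 1"
    then have eq: "norm (B z) = 1" using B1[OF z] by simp
    have "B constant_on ball 0 1"
      using maximum_modulus_principle[OF B(1) open_ball connected_ball open_ball order_refl, of z]
        z B1 eq by simp
    then obtain k where "\<And>x. norm x < 1 \<Longrightarrow> B x = k" by (auto simp: constant_on_def)
    then have "B z = B 0" using z by simp
    then show False using eq B(3) multiplier by simp
  qed
  define c where "c = (1 - norm (B 0)) / 4"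
  show ?thesis
  proof
    show "0 < c" "c \<le> 1" using Blt[of 0] norm_ge_zero[of "B 0"] by (auto simp: c_def field_simps)
    show "norm (F z) \<le> norm z * (1 - c * (1 - norm z))" if "norm z < 1" for z
    proof -
      have "norm (B z) \<le> 1 - c * (1 - norm z)"
        using disc_map_boundary_distance[OF B(1) Blt that] by (simp add: c_def)
      then show ?thesis using B(2)[OF that] by (simp add: norm_mult mult_left_mono)
    qed
  qed
qed

lemma norm_le: "norm z < 1 \<Longrightarrow> norm (F z) \<le> norm z"
  using Schwarz_Lemma(1)[OF holF_disc fix0 disc] by blast

lemma iterate_norm_le: "norm z < 1 \<Longrightarrow> norm ((F ^^ n) z) \<le> norm z"
  by (induction n) (auto intro: order_trans[OF norm_le] iterate_disc)

text \<open>
  Near the circle \<open>1 - norm (F z)\<close> exceeds \<open>1 - norm z\<close> by a definite factor, by \<open>contraction_bound\<close>.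
\<close>

lemma derivative_on_circle:
  obtains c where "0 < c" "\<And>x. norm x = 1 \<Longrightarrow> 1 + c \<le> norm (deriv F x)"
proof -
  obtain c where c: "0 < c" "c \<le> 1" "\<And>z. norm z < 1 \<Longrightarrow> norm (F z) \<le> norm z * (1 - c * (1 - norm z))"
    by (rule contraction_bound) blast
  have "1 + c \<le> norm (deriv F x)" if "norm x = 1" for x
  proof (rule boundary_derivative_lower_bound[OF holF \<tau>_pos that circle[OF that]])
    show "(1 - norm z) * (1 + c * norm z) \<le> 1 - norm (F z)" if "norm z < 1" for z :: complex
      using c(3)[OF that] by (simp add: algebra_simps)
  qed
  with c(1) show ?thesis using that by blast
qed

lemma lipschitz_disc:
  obtains \<Lambda> where "1 \<le> \<Lambda>" "\<And>u v. norm u \<le> 1 \<Longrightarrow> norm v \<le> 1 \<Longrightarrow> norm (F u - F v) \<le> \<Lambda> * norm (u - v)"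
    "\<And>x. norm x \<le> 1 \<Longrightarrow> norm (deriv F x) \<le> \<Lambda>"
proof -
  have sub: "cball 0 1 \<subseteq> ball (0::complex) (1 + \<tau>)" using \<tau>_pos by auto
  have "continuous_on (cball 0 1) (deriv F)"
    using holomorphic_deriv[OF holF open_ball] sub
    by (meson continuous_on_subset holomorphic_on_imp_continuous_on)
  then have "bounded (deriv F ` cball 0 1)"
    by (intro compact_imp_bounded compact_continuous_image) auto
  then obtain L where L: "\<And>x. norm x \<le> 1 \<Longrightarrow> norm (deriv F x) \<le> L"
    unfolding bounded_iff by (metis imageI mem_cball_0)
  show ?thesis
  proof
    show "1 \<le> max 1 L" by simp
    show "norm (deriv F x) \<le> max 1 L" if "norm x \<le> 1" for x using L[OF that] by simp
    show "norm (F u - F v) \<le> max 1 L * norm (u - v)" if "norm u \<le> 1" "norm v \<le> 1" for u v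
    proof (rule field_differentiable_bound[of "cball 0 1" F "deriv F"])
      show "(F has_field_derivative deriv F z) (at z within cball 0 1)" if "z \<in> cball 0 1" for z
        using holomorphic_derivI[OF holF open_ball] that sub by blast
      show "norm (deriv F z) \<le> max 1 L" if "z \<in> cball 0 1" for z
        using L[of z] that by simp
    qed (use that in auto)
  qed
qed

text \<open>
  Near the circle the derivative is nearly constant on small balls and larger than \<open>1\<close> in modulus, so \<open>F\<close>
  is there a small perturbation of an expanding affine map.  Inverse branches come from the contraction
  principle and preserve the open disc because \<open>F\<close> maps the outside of the disc to the outside.
\<close>

lemma inverse_branches:
  obtains \<rho> \<kappa> where "0 < \<rho>" "\<rho> < 1/4" "1 < \<kappa>"
    "\<And>x u v. 1 - \<rho> \<le> norm x \<Longrightarrow> norm x \<le> 1 \<Longrightarrow> u \<in> ball x \<rho> \<Longrightarrow> v \<in> ball x \<rho> \<Longrightarrow>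
       \<kappa> * norm (u - v) \<le> norm (F u - F v)"
    "\<And>x. 1 - \<rho> \<le> norm x \<Longrightarrow> norm x \<le> 1 \<Longrightarrow>
       \<exists>g. g holomorphic_on ball (F x) \<rho> \<and> g (F x) = x \<and>
         (\<forall>w\<in>ball (F x) \<rho>. g w \<in> ball x \<rho> \<and> F (g w) = w \<and> (norm w < 1 \<longrightarrow> norm (g w) < 1)) \<and>
         (\<forall>w\<in>ball (F x) \<rho>. \<forall>w'\<in>ball (F x) \<rho>. \<kappa> * norm (g w - g w') \<le> norm (w - w'))"
proof -
  obtain c where c: "0 < c" "\<And>x. norm x = 1 \<Longrightarrow> 1 + c \<le> norm (deriv F x)"
    by (rule derivative_on_circle) blast
  define S where "S = cball (0::complex) (1 + \<tau> / 2)"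
  have S: "S \<subseteq> ball 0 (1 + \<tau>)" using \<tau>_pos by (auto simp: S_def)
  have "continuous_on S (deriv F)"
    using holomorphic_deriv[OF holF open_ball] S
    by (meson continuous_on_subset holomorphic_on_imp_continuous_on)
  then have "uniformly_continuous_on S (deriv F)"
    by (rule compact_uniformly_continuous) (simp add: S_def)
  then obtain d where d: "d > 0"
    "\<And>x y. x \<in> S \<Longrightarrow> y \<in> S \<Longrightarrow> dist y x < d \<Longrightarrow> dist (deriv F y) (deriv F x) < c / 2"
    using c(1) unfolding uniformly_continuous_on_def by (metis half_gt_zero)
  define \<rho> where "\<rho> = min (d / 3) (min (\<tau> / 4) (1 / 5))"
  define \<kappa> where "\<kappa> = 1 + c / 2"
  have \<rho>: "0 < \<rho>" "3 * \<rho> \<le> d" "4 * \<rho> \<le> \<tau>" "5 * \<rho> \<le> 1" using d(1) \<tau>_pos by (auto simp: \<rho>_def)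
  have ballS: "ball x \<rho> \<subseteq> S" if "norm x \<le> 1" for x
  proof
    fix u assume "u \<in> ball x \<rho>"
    then have "norm u < norm x + \<rho>" using norm_triangle_ineq2[of u x] by (simp add: dist_norm norm_minus_commute)
    then show "u \<in> S" using that \<rho> by (simp add: S_def)
  qed
  have aff: "\<exists>a. 1 + c \<le> norm a \<and> (\<forall>u\<in>ball x \<rho>. \<forall>v\<in>ball x \<rho>.
      norm (F u - F v - a * (u - v)) \<le> c / 2 * norm (u - v))"
    if x: "1 - \<rho> \<le> norm x" "norm x \<le> 1" for x
  proof -
    have x0: "x \<noteq> 0" using x \<rho> by auto
    define y where "y = x / of_real (norm x)"
    have y: "norm y = 1" using x0 by (simp add: y_def norm_divide)
    have "y - x = y * of_real (1 - norm x)" using x0 by (simp add: y_def field_simps)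
    then have yx: "norm (y - x) = 1 - norm x" using y x by (simp add: norm_mult del: of_real_diff)
    define a where "a = deriv F y"
    have "norm (F u - F v - a * (u - v)) \<le> c / 2 * norm (u - v)" if uv: "u \<in> ball x \<rho>" "v \<in> ball x \<rho>" for u v
    proof -
      have "norm ((F u - a * u) - (F v - a * v)) \<le> c / 2 * norm (u - v)"
      proof (rule field_differentiable_bound[of "ball x \<rho>" _ "\<lambda>z. deriv F z - a"])
        fix z assume z: "z \<in> ball x \<rho>"
        have "(F has_field_derivative deriv F z) (at z within ball x \<rho>)"
          using holomorphic_derivI[OF holF open_ball] ballS[OF x(2)] S z by blast
        then show "((\<lambda>u. F u - a * u) has_field_derivative deriv F z - a) (at z within ball x \<rho>)"
          by (auto intro!: derivative_eq_intros)
        have "dist z y \<le> dist z x + dist x y" by (rule dist_triangle)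
        also have "\<dots> < d" using z yx x \<rho> by (simp add: dist_norm norm_minus_commute)
        finally have "dist (deriv F z) (deriv F y) < c / 2"
          using d(2)[of y z] ballS[OF x(2)] z y \<tau>_pos by (auto simp: S_def)
        then show "norm (deriv F z - a) \<le> c / 2" by (simp add: a_def dist_norm)
      qed (use uv in auto)
      then show ?thesis by (simp add: algebra_simps)
    qed
    then show ?thesis using c(2)[OF y] a_def by blast
  qed
  have exp: "\<kappa> * norm (u - v) \<le> norm (F u - F v)"
    if x: "1 - \<rho> \<le> norm x" "norm x \<le> 1" "u \<in> ball x \<rho>" "v \<in> ball x \<rho>" for x u v
  proof -
    obtain a where a: "1 + c \<le> norm a" "norm (F u - F v - a * (u - v)) \<le> c / 2 * norm (u - v)"
      using aff[OF x(1,2)] x(3,4) by blast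
    have "(1 + c) * norm (u - v) \<le> norm (a * (u - v))"
      using a(1) by (simp add: norm_mult mult_right_mono)
    also have "\<dots> \<le> norm (F u - F v) + norm (F u - F v - a * (u - v))"
      using norm_triangle_ineq4[of "F u - F v" "F u - F v - a * (u - v)"] by simp
    finally show ?thesis using a(2) by (simp add: \<kappa>_def algebra_simps)
  qed
  have \<kappa>1: "1 < \<kappa>" using c(1) by (simp add: \<kappa>_def)
  have inv: "\<exists>g. g holomorphic_on ball (F x) \<rho> \<and> g (F x) = x \<and>
         (\<forall>w\<in>ball (F x) \<rho>. g w \<in> ball x \<rho> \<and> F (g w) = w \<and> (norm w < 1 \<longrightarrow> norm (g w) < 1)) \<and>
         (\<forall>w\<in>ball (F x) \<rho>. \<forall>w'\<in>ball (F x) \<rho>. \<kappa> * norm (g w - g w') \<le> norm (w - w'))"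
    if x: "1 - \<rho> \<le> norm x" "norm x \<le> 1" for x
  proof -
    obtain a where a: "1 + c \<le> norm a"
      "\<And>u v. u \<in> ball x \<rho> \<Longrightarrow> v \<in> ball x \<rho> \<Longrightarrow> norm (F u - F v - a * (u - v)) \<le> c / 2 * norm (u - v)"
      using aff[OF x] by blast
    have a0: "a \<noteq> 0" using a(1) c(1) by auto
    have holb: "F holomorphic_on ball x \<rho>"
      using holF ballS[OF x(2)] S by (meson holomorphic_on_subset)
    have inj: "inj_on F (ball x \<rho>)"
    proof (rule inj_onI)
      fix u v assume uv: "u \<in> ball x \<rho>" "v \<in> ball x \<rho>" "F u = F v"
      then have "\<kappa> * norm (u - v) \<le> 0" using exp[OF x uv(1,2)] by simp
      then show "u = v" using \<kappa>1 by (simp add: mult_le_0_iff)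
    qed
    have surj: "\<exists>u\<in>ball x \<rho>. F u = w" if w: "w \<in> ball (F x) \<rho>" for w
    proof -
      define r where "r = norm (w - F x) / \<kappa>"
      have r: "0 \<le> r" "r < \<rho>" "norm (w - F x) = \<kappa> * r"
      proof -
        have "norm (w - F x) < \<rho>" using w by (simp add: dist_norm norm_minus_commute)
        also have "\<dots> \<le> \<rho> * \<kappa>" using \<rho>(1) \<kappa>1 by simp
        finally show "r < \<rho>" using \<kappa>1 by (simp add: r_def divide_less_eq)
      qed (use \<kappa>1 in \<open>auto simp: r_def\<close>)
      have sub: "cball x r \<subseteq> ball x \<rho>" using r by auto
      \<comment> \<open>Newton iteration with the frozen derivative \<open>a\<close>.\<close>
      define T where "T u = u - (F u - w) / a" for u
      have "\<exists>!u. u \<in> cball x r \<and> T u = u"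
      proof (rule Banach_fix[where c="(c / 2) / norm a"])
        show "complete (cball x r)" by (simp add: complete_eq_closed)
        show "cball x r \<noteq> {}" using r by simp
        show "0 \<le> (c / 2) / norm a" using c by simp
        show "(c / 2) / norm a < 1" using a(1) a0 c(1) by (simp add: divide_less_eq)
        show "T ` cball x r \<subseteq> cball x r"
        proof clarify
          fix u assume u: "u \<in> cball x r"
          have xin: "x \<in> ball x \<rho>" using \<rho> by simp
          have "a * (T u - x) = - (F u - F x - a * (u - x)) + (w - F x)"
            using a0 by (simp add: T_def field_simps)
          then have "norm a * norm (T u - x) \<le> norm (F u - F x - a * (u - x)) + norm (w - F x)"
            by (metis norm_minus_cancel norm_mult norm_triangle_ineq)
          also have "\<dots> \<le> c / 2 * norm (u - x) + \<kappa> * r"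
            using a(2)[of u x] u sub xin r(3) by (intro add_mono) auto
          also have "\<dots> \<le> c / 2 * r + \<kappa> * r"
            using u c(1) by (simp add: dist_norm norm_minus_commute mult_left_mono)
          also have "\<dots> = (1 + c) * r" by (simp add: \<kappa>_def field_simps)
          also have "\<dots> \<le> norm a * r" using a(1) r(1) by (rule mult_right_mono)
          finally have "norm (T u - x) \<le> r" using a0 by simp
          then show "T u \<in> cball x r" by (simp add: dist_norm norm_minus_commute)
        qed
        show "dist (T u) (T v) \<le> (c / 2) / norm a * dist u v"
          if "u \<in> cball x r" "v \<in> cball x r" for u v
        proof -
          have "a * (T u - T v) = - (F u - F v - a * (u - v))" using a0 by (simp add: T_def field_simps)
          then have "norm a * norm (T u - T v) = norm (F u - F v - a * (u - v))"
            by (metis norm_minus_cancel norm_mult)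
          also have "\<dots> \<le> c / 2 * norm (u - v)" using a(2) sub that by blast
          finally show ?thesis using a0 by (simp add: dist_norm field_simps)
        qed
      qed
      then obtain u where u: "u \<in> cball x r" "T u = u" by blast
      then have "F u = w" using a0 by (simp add: T_def)
      then show ?thesis using u sub by blast
    qed
    obtain g where g: "g holomorphic_on (F ` ball x \<rho>)" "\<And>z. z \<in> ball x \<rho> \<Longrightarrow> g (F z) = z"
      using holomorphic_has_inverse[OF holb open_ball inj] by metis
    have gw: "g w \<in> ball x \<rho>" "F (g w) = w" if "w \<in> ball (F x) \<rho>" for w
      using surj[OF that] g(2) by auto
    show ?thesis
    proof (intro exI[of _ g] conjI ballI)
      show "g holomorphic_on ball (F x) \<rho>"
        by (rule holomorphic_on_subset[OF g(1)]) (use surj in blast)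
      show "g (F x) = x" using g(2)[of x] \<rho> by simp
      fix w assume w: "w \<in> ball (F x) \<rho>"
      show "g w \<in> ball x \<rho>" "F (g w) = w" using gw[OF w] by auto
      show "norm w < 1 \<longrightarrow> norm (g w) < 1"
      proof
        assume "norm w < 1"
        moreover have "g w \<in> ball 0 (1 + \<tau>)" using gw(1)[OF w] ballS[OF x(2)] S by blast
        then have "norm (g w) < 1 + \<tau>" by simp
        ultimately show "norm (g w) < 1" using outside[of "g w"] gw(2)[OF w] by force
      qed
      fix w' assume w': "w' \<in> ball (F x) \<rho>"
      show "\<kappa> * norm (g w - g w') \<le> norm (w - w')"
        using exp[OF x gw(1)[OF w] gw(1)[OF w']] gw(2)[OF w] gw(2)[OF w'] by simp
    qed
  qed
  show ?thesis
  proof (rule that[of \<rho> \<kappa>])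
    show "0 < \<rho>" "\<rho> < 1/4" "1 < \<kappa>" using \<rho> \<kappa>1 by auto
  qed (fact exp, fact inv)
qed

text \<open>
  The image of the open disc is open, and closed in the disc because the circle is mapped to the circle.
\<close>

lemma surj_disc:
  assumes "norm w < 1" shows "\<exists>z. norm z < 1 \<and> F z = w"
proof -
  let ?D = "ball (0::complex) 1"
  have nc: "\<not> F constant_on ?D"
  proof
    assume "F constant_on ?D"
    then obtain k where "\<And>z. z \<in> ?D \<Longrightarrow> F z = k" by (auto simp: constant_on_def)
    then have "deriv F 0 = deriv (\<lambda>_. k) 0"
      by (intro complex_derivative_transform_within_open[OF holF_disc _ open_ball]) auto
    then show False using multiplier by simp
  qed
  have op: "open (F ` ?D)" by (rule open_mapping_thm[OF holF_disc open_ball _ open_ball _ nc]) auto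
  have eq: "F ` ?D = F ` cball 0 1 \<inter> ?D"
  proof (intro set_eqI iffI)
    fix w assume "w \<in> F ` cball 0 1 \<inter> ?D"
    then obtain z where "norm z \<le> 1" "w = F z" "norm (F z) < 1" by auto
    then show "w \<in> F ` ?D" using circle[of z] by (cases "norm z = 1") auto
  qed (auto intro: disc)
  have "compact (F ` cball 0 1)"
    by (intro compact_continuous_image continuous_on_subset[OF holomorphic_on_imp_continuous_on[OF holF]])
      (use \<tau>_pos in auto)
  then have cl: "closedin (top_of_set ?D) (F ` ?D)"
    unfolding eq by (subst Int_commute) (intro closedin_closed_Int compact_imp_closed)
  have "F ` ?D = {} \<or> F ` ?D = ?D"
  proof -
    have "openin (top_of_set ?D) (F ` ?D)"
      unfolding openin_open_eq[OF open_ball] using op disc by auto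
    then show ?thesis using connected_ball[of "0::complex" 1] cl unfolding connected_clopen by blast
  qed
  moreover have "F 0 \<in> F ` ?D" by (intro imageI) simp
  ultimately have im: "F ` ?D = ?D" by blast
  have "w \<in> F ` ?D" unfolding im using assms by simp
  then show ?thesis by auto
qed

text \<open>
  The iterated preimages of the fixed point: the set \<open>O\<close> of the introduction.
\<close>

definition prezeros :: "complex set" where
  "prezeros = {z. norm z < 1 \<and> (\<exists>n. (F ^^ n) z = 0)}"

lemma prezeros_forward: "z \<in> prezeros \<Longrightarrow> F z \<in> prezeros"
proof -
  assume "z \<in> prezeros"
  then obtain n where n: "norm z < 1" "(F ^^ n) z = 0" by (auto simp: prezeros_def)
  have "(F ^^ n) (F z) = F ((F ^^ n) z)" by (simp add: funpow_swap1)
  then show ?thesis using n disc fix0 by (auto simp: prezeros_def)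
qed

lemma iterate_prezeros_forward: "z \<in> prezeros \<Longrightarrow> (F ^^ n) z \<in> prezeros"
  by (induction n) (auto intro: prezeros_forward)

lemma prezeros_backward:
  assumes "norm z < 1" "(F ^^ n) z \<in> prezeros" shows "z \<in> prezeros"
proof -
  obtain m where "(F ^^ m) ((F ^^ n) z) = 0" using assms by (auto simp: prezeros_def)
  then have "(F ^^ (m + n)) z = 0" by (simp add: funpow_add)
  then show ?thesis using assms by (auto simp: prezeros_def)
qed

text \<open>
  \<open>F\<close> is injective near the fixed point and maps small balls about it into themselves.
\<close>

lemma prezeros_isolated_at_0:
  obtains \<epsilon> where "0 < \<epsilon>" "\<epsilon> \<le> 1" "\<And>z. z \<in> prezeros \<Longrightarrow> norm z < \<epsilon> \<Longrightarrow> z = 0"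
proof -
  have zero_in: "0 \<in> ball (0::complex) 1" by simp
  obtain e where e: "e > 0" "inj_on F (ball 0 e)"
    by (rule has_complex_derivative_locally_injective[OF holF_disc zero_in open_ball multiplier(1)])
  have "z = 0" if "norm z < min e 1" "(F ^^ n) z = 0" for z n
    using that
  proof (induction n arbitrary: z)
    case (Suc n)
    have "(F ^^ n) (F z) = 0" using Suc.prems(2) by (simp add: funpow_swap1)
    moreover have "norm (F z) < min e 1" using norm_le[of z] Suc.prems(1) by auto
    ultimately have "F z = F 0" using Suc.IH[of "F z"] fix0 by simp
    then show ?case using e Suc.prems(1) by (auto simp: inj_on_def)
  qed auto
  then show ?thesis using that[of "min e 1"] e(1) by (auto simp: prezeros_def)
qed

text \<open>
  On \<open>cball 0 t\<close> the orbits converge to \<open>0\<close> uniformly, and near \<open>0\<close> there is no other point of \<open>prezeros\<close>.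
\<close>

lemma prezeros_level:
  assumes t: "t < 1"
  obtains m where "\<And>z. z \<in> prezeros \<Longrightarrow> norm z \<le> t \<Longrightarrow> (F ^^ m) z = 0"
proof -
  obtain c where c: "0 < c" "c \<le> 1" "\<And>z. norm z < 1 \<Longrightarrow> norm (F z) \<le> norm z * (1 - c * (1 - norm z))"
    by (rule contraction_bound) blast
  obtain \<epsilon> where \<epsilon>: "0 < \<epsilon>" "\<epsilon> \<le> 1" "\<And>z. z \<in> prezeros \<Longrightarrow> norm z < \<epsilon> \<Longrightarrow> z = 0"
    by (rule prezeros_isolated_at_0) blast
  define q where "q = 1 - c * (1 - max t 0)"
  have q: "0 \<le> q" "q < 1" using c t by (auto simp: q_def mult_le_one max_def)
  obtain m where m: "q ^ m < \<epsilon>" using real_arch_pow_inv[OF \<epsilon>(1) q(2)] by blast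
  have "(F ^^ m) z = 0" if z: "z \<in> prezeros" "norm z \<le> t" for z
  proof -
    have z1: "norm z < 1" using z by (simp add: prezeros_def)
    have "norm ((F ^^ k) z) \<le> q ^ k" for k
    proof (induction k)
      case (Suc k)
      let ?w = "(F ^^ k) z"
      have w: "norm ?w \<le> t" using iterate_norm_le[OF z1, of k] z(2) by simp
      have cw: "c * (1 - norm ?w) \<le> 1 * 1" using c w t by (intro mult_mono) auto
      have "norm (F ?w) \<le> norm ?w * (1 - c * (1 - norm ?w))" using c(3) w t by simp
      also have "\<dots> \<le> q ^ k * q"
      proof (rule mult_mono[OF Suc])
        show "1 - c * (1 - norm ?w) \<le> q" using w c(1) by (simp add: q_def)
      qed (use q cw in auto)
      finally show ?case by (simp add: mult.commute)
    qed (use z1 in auto)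
    then have "norm ((F ^^ m) z) < \<epsilon>" using m by (meson le_less_trans)
    then show ?thesis using \<epsilon>(3) iterate_prezeros_forward[OF z(1)] by blast
  qed
  then show ?thesis using that by blast
qed

lemma iterate_surj_disc: "norm w < 1 \<Longrightarrow> \<exists>z. norm z < 1 \<and> (F ^^ n) z = w"
proof (induction n arbitrary: w)
  case (Suc n)
  then obtain y where y: "norm y < 1" "F y = w" using surj_disc by blast
  then obtain z where "norm z < 1" "(F ^^ n) z = y" using Suc.IH by blast
  then show ?case using y by auto
qed auto

lemma iterate_not_constant: "\<not> (F ^^ n) constant_on ball 0 1"
proof
  assume "(F ^^ n) constant_on ball 0 1"
  then obtain k where k: "\<And>z. norm z < 1 \<Longrightarrow> (F ^^ n) z = k" by (auto simp: constant_on_def)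
  have "k = 0" using k[of 0] by (simp add: iterate_0)
  moreover obtain z where "norm z < 1" "(F ^^ n) z = 1/2" using iterate_surj_disc[of "1/2" n] by auto
  ultimately show False using k by auto
qed

lemma prezeros_finite:
  assumes t: "t < 1" shows "finite {z \<in> prezeros. norm z \<le> t}"
proof -
  obtain m where m: "\<And>z. z \<in> prezeros \<Longrightarrow> norm z \<le> t \<Longrightarrow> (F ^^ m) z = 0"
    using prezeros_level[OF t] by blast
  have "finite {z \<in> cball 0 t. (F ^^ m) z = 0}"
    by (rule holomorphic_compact_finite_zeros[OF iterate_hol_disc open_ball _ _ _ iterate_not_constant])
       (use t in auto)
  then show ?thesis by (rule rev_finite_subset) (use m in auto)
qed

text \<open>
  \<open>F\<close> is Lipschitz on the disc.  If the orbits of \<open>x\<close> and \<open>y\<close> have not met after \<open>m\<close> steps, compare \<open>0\<close> with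
  another point of \<open>prezeros\<close>; if they meet earlier, compare two distinct points with the same image, which
  are a definite distance apart because \<open>F\<close> is uniformly injective near the circle and only finitely many
  points of \<open>prezeros\<close> are away from it.
\<close>

lemma prezeros_separated_by_level:
  obtains \<eta> \<Lambda> where "0 < \<eta>" "1 \<le> \<Lambda>"
    "\<And>m x y. x \<in> prezeros \<Longrightarrow> y \<in> prezeros \<Longrightarrow> x \<noteq> y \<Longrightarrow> (F ^^ m) x = 0 \<Longrightarrow> \<eta> \<le> \<Lambda> ^ m * norm (x - y)"
proof -
  obtain \<Lambda> where \<Lambda>: "1 \<le> \<Lambda>" "\<And>u v. norm u \<le> 1 \<Longrightarrow> norm v \<le> 1 \<Longrightarrow> norm (F u - F v) \<le> \<Lambda> * norm (u - v)"
    by (rule lipschitz_disc) blast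
  obtain \<epsilon> where \<epsilon>: "0 < \<epsilon>" "\<epsilon> \<le> 1" "\<And>z. z \<in> prezeros \<Longrightarrow> norm z < \<epsilon> \<Longrightarrow> z = 0"
    by (rule prezeros_isolated_at_0) blast
  obtain \<rho> \<kappa> where \<rho>: "0 < \<rho>" "1 < (\<kappa>::real)"
    "\<And>x u v. 1 - \<rho> \<le> norm x \<Longrightarrow> norm x \<le> 1 \<Longrightarrow> u \<in> ball x \<rho> \<Longrightarrow> v \<in> ball x \<rho> \<Longrightarrow>
       \<kappa> * norm (u - v) \<le> norm (F u - F v)"
    by (rule inverse_branches) blast
  define S where "S = {z \<in> prezeros. norm z \<le> 1 - \<rho>}"
  have finS: "finite S" unfolding S_def by (rule prezeros_finite) (use \<rho> in simp)
  obtain \<delta> where \<delta>: "0 < \<delta>" "\<And>x y. x \<in> S \<Longrightarrow> y \<in> S \<Longrightarrow> x \<noteq> y \<Longrightarrow> \<delta> \<le> norm (x - y)"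
  proof -
    define T where "T = insert 1 ((\<lambda>(x, y). norm (x - y)) ` {(x, y). x \<in> S \<and> y \<in> S \<and> x \<noteq> y})"
    have "finite {(x, y). x \<in> S \<and> y \<in> S \<and> x \<noteq> y}"
      by (rule finite_subset[of _ "S \<times> S"]) (use finS in auto)
    then have T: "finite T" "T \<noteq> {}" by (auto simp: T_def)
    have "0 < Min T" using T by (subst Min_gr_iff) (auto simp: T_def)
    moreover have "Min T \<le> norm (x - y)" if "x \<in> S" "y \<in> S" "x \<noteq> y" for x y
      by (rule Min_le) (use T that in \<open>auto simp: T_def\<close>)
    ultimately show ?thesis using that by blast
  qed
  define \<eta> where "\<eta> = min \<epsilon> (min \<rho> \<delta>)"
  have near: "\<eta> \<le> norm (x - y)"
    if "x \<in> prezeros" "y \<in> prezeros" "x \<noteq> y" "F x = F y" for x y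
  proof -
    have *: "\<rho> \<le> norm (x - y)" if "1 - \<rho> \<le> norm x" "norm x < 1" "x \<noteq> y" "F x = F y" for x y
    proof (rule ccontr)
      assume "\<not> \<rho> \<le> norm (x - y)"
      then have "y \<in> ball x \<rho>" by (simp add: dist_norm)
      then have "\<kappa> * norm (x - y) \<le> norm (F x - F y)" using \<rho>(1) that by (intro \<rho>(3)) auto
      then show False using that \<rho>(2) by (simp add: mult_le_0_iff)
    qed
    show ?thesis
    proof (cases "1 - \<rho> \<le> norm x \<or> 1 - \<rho> \<le> norm y")
      case True
      then show ?thesis using *[of x y] *[of y x] that
        by (auto simp: prezeros_def norm_minus_commute \<eta>_def)
    next
      case False
      then show ?thesis using \<delta>(2)[of x y] that by (auto simp: S_def \<eta>_def)
    qed
  qed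
  have "\<eta> \<le> \<Lambda> ^ m * norm (x - y)"
    if "x \<in> prezeros" "y \<in> prezeros" "x \<noteq> y" "(F ^^ m) x = 0" for m x y
    using that
  proof (induction m arbitrary: x y)
    case 0
    then have "\<not> norm y < \<epsilon>" using \<epsilon>(3)[of y] by auto
    then show ?case using 0 by (simp add: \<eta>_def)
  next
    case (Suc m)
    have x1: "norm x \<le> 1" "norm y \<le> 1" using Suc.prems by (auto simp: prezeros_def)
    show ?case
    proof (cases "F x = F y")
      case True
      have "\<eta> \<le> norm (x - y)" using near Suc.prems True by blast
      also have "\<dots> \<le> \<Lambda> ^ Suc m * norm (x - y)"
        using one_le_power[OF \<Lambda>(1), of "Suc m"] by (metis mult_1 mult_right_mono norm_ge_zero)
      finally show ?thesis .
    next
      case False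
      have "(F ^^ m) (F x) = 0" using Suc.prems(4) by (simp add: funpow_swap1)
      then have "\<eta> \<le> \<Lambda> ^ m * norm (F x - F y)"
        using Suc.IH[of "F x" "F y"] Suc.prems False prezeros_forward by blast
      also have "\<dots> \<le> \<Lambda> ^ m * (\<Lambda> * norm (x - y))"
        using \<Lambda> x1 by (intro mult_left_mono) auto
      finally show ?thesis by (simp add: mult.assoc mult.left_commute)
    qed
  qed
  moreover have "0 < \<eta>" using \<epsilon>(1) \<rho>(1) \<delta>(1) by (simp add: \<eta>_def)
  ultimately show ?thesis using that \<Lambda>(1) by blast
qed

lemma iterate_depth_growth:
  obtains \<nu> where "1 < \<nu>" "\<And>n z. norm z < 1 \<Longrightarrow> min (1/2) (\<nu> ^ n * (1 - norm z)) \<le> 1 - norm ((F ^^ n) z)"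
proof -
  obtain c where c: "0 < c" "c \<le> 1" "\<And>z. norm z < 1 \<Longrightarrow> norm (F z) \<le> norm z * (1 - c * (1 - norm z))"
    by (rule contraction_bound) blast
  define \<nu> where "\<nu> = 1 + c / 2"
  have \<nu>: "1 < \<nu>" using c by (simp add: \<nu>_def)
  have step: "min (1/2) (\<nu> * t) \<le> 1 - norm (F w)" if w: "norm w < 1" "t \<le> 1 - norm w" for w t
  proof (cases "norm w \<le> 1/2")
    case True
    then show ?thesis using norm_le[OF w(1)] by (auto simp: min_def)
  next
    case False
    have "\<nu> * t \<le> \<nu> * (1 - norm w)" using w \<nu> by (intro mult_left_mono) auto
    also have "\<dots> \<le> (1 + c * norm w) * (1 - norm w)"
      using False w c(1) by (intro mult_right_mono) (auto simp: \<nu>_def)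
    also have "\<dots> \<le> 1 - norm (F w)" using c(3)[OF w(1)] by (simp add: algebra_simps)
    finally show ?thesis by simp
  qed
  have "min (1/2) (\<nu> ^ n * (1 - norm z)) \<le> 1 - norm ((F ^^ n) z)" if z: "norm z < 1" for n z
  proof (induction n)
    case (Suc n)
    have 1: "min (1/2) (\<nu> * min (1/2) (\<nu> ^ n * (1 - norm z))) \<le> 1 - norm (F ((F ^^ n) z))"
      by (rule step[OF iterate_disc[OF z] Suc])
    have 2: "min (1/2) (\<nu> ^ Suc n * (1 - norm z)) \<le> min (1/2) (\<nu> * min (1/2) (\<nu> ^ n * (1 - norm z)))"
      using \<nu> by (auto simp: min_def mult.assoc)
    from order_trans[OF 2 1] show ?case by (simp only: funpow.simps o_apply)
  qed (auto simp: min_def)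
  with \<nu> show ?thesis using that by blast
qed

text \<open>
  A point of \<open>prezeros\<close> at distance \<open>t\<close> from the circle reaches \<open>0\<close> after \<open>O (log (1 / t))\<close> steps, so
  \<open>prezeros_separated_by_level\<close> gives a separation polynomial in \<open>t\<close>.  What matters later is that the base
  \<open>Q'\<close> depends on \<open>Q\<close> alone and not on the factor \<open>a\<close>.
\<close>

lemma prezeros_separated_by_depth:
  assumes Q: "1 \<le> Q"
  obtains Q' where "1 \<le> Q'"
    "\<And>a. 0 < a \<Longrightarrow> \<exists>\<eta>>0. \<forall>k x y. x \<in> prezeros \<longrightarrow> y \<in> prezeros \<longrightarrow> x \<noteq> y \<longrightarrow>
        a / Q ^ k \<le> 1 - norm x \<longrightarrow> \<eta> / Q' ^ k \<le> norm (x - y)"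
proof -
  obtain \<eta> \<Lambda> where \<Lambda>: "0 < \<eta>" "1 \<le> \<Lambda>"
    "\<And>m x y. x \<in> prezeros \<Longrightarrow> y \<in> prezeros \<Longrightarrow> x \<noteq> y \<Longrightarrow> (F ^^ m) x = 0 \<Longrightarrow> \<eta> \<le> \<Lambda> ^ m * norm (x - y)"
    by (rule prezeros_separated_by_level) blast
  obtain \<nu> where \<nu>: "1 < \<nu>"
    "\<And>n z. norm z < 1 \<Longrightarrow> min (1/2) (\<nu> ^ n * (1 - norm z)) \<le> 1 - norm ((F ^^ n) z)"
    by (rule iterate_depth_growth) blast
  obtain m0 where m0: "\<And>z. z \<in> prezeros \<Longrightarrow> norm z \<le> 1/2 \<Longrightarrow> (F ^^ m0) z = 0"
    using prezeros_level[of "1/2"] by auto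
  \<comment> \<open>After \<open>b * k + j\<close> steps a point at distance \<open>a / Q ^ k\<close> has distance at least \<open>1/2\<close> from the circle.\<close>
  obtain b where b: "Q < \<nu> ^ b" using real_arch_pow[OF \<nu>(1)] by blast
  have "\<exists>\<eta>'>0. \<forall>k x y. x \<in> prezeros \<longrightarrow> y \<in> prezeros \<longrightarrow> x \<noteq> y \<longrightarrow>
        a / Q ^ k \<le> 1 - norm x \<longrightarrow> \<eta>' / (\<Lambda> ^ b) ^ k \<le> norm (x - y)" if a: "0 < a" for a
  proof -
    obtain j where j: "1 / (2 * a) < \<nu> ^ j" using real_arch_pow[OF \<nu>(1)] by blast
    have "\<eta> / \<Lambda> ^ (j + m0) / (\<Lambda> ^ b) ^ k \<le> norm (x - y)"
      if xy: "x \<in> prezeros" "y \<in> prezeros" "x \<noteq> y" "a / Q ^ k \<le> 1 - norm x" for k x y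
    proof -
      let ?n = "b * k + j"
      have x1: "norm x < 1" using xy by (simp add: prezeros_def)
      have "1/2 \<le> \<nu> ^ j * a" using j a by (simp add: field_simps)
      also have "\<dots> \<le> (\<nu> ^ b / Q) ^ k * (\<nu> ^ j * a)"
      proof -
        have "1 \<le> (\<nu> ^ b / Q) ^ k" using b Q by (intro one_le_power) (simp add: le_divide_eq)
        moreover have "0 \<le> \<nu> ^ j * a" using a \<nu> by simp
        ultimately show ?thesis by (metis mult_1 mult_right_mono)
      qed
      also have "\<dots> = \<nu> ^ ?n * (a / Q ^ k)" by (simp add: power_add power_mult power_divide)
      also have "\<dots> \<le> \<nu> ^ ?n * (1 - norm x)" using xy \<nu> by (intro mult_left_mono) auto
      finally have "1/2 \<le> 1 - norm ((F ^^ ?n) x)" using \<nu>(2)[OF x1, of ?n] by simp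
      then have "(F ^^ m0) ((F ^^ ?n) x) = 0"
        using m0 iterate_prezeros_forward[OF xy(1)] by simp
      then have "(F ^^ (m0 + ?n)) x = 0" by (simp add: funpow_add)
      then have "\<eta> \<le> \<Lambda> ^ (m0 + ?n) * norm (x - y)" using \<Lambda>(3) xy by blast
      also have "\<dots> = (\<Lambda> ^ (j + m0) * (\<Lambda> ^ b) ^ k) * norm (x - y)"
        by (simp add: power_add power_mult algebra_simps)
      finally show ?thesis using \<Lambda>(2) by (simp add: divide_le_eq mult.commute mult.left_commute)
    qed
    moreover have "0 < \<eta> / \<Lambda> ^ (j + m0)" using \<Lambda> by simp
    ultimately show ?thesis by blast
  qed
  moreover have "1 \<le> \<Lambda> ^ b" using \<Lambda>(2) by simp
  ultimately show ?thesis using that by blast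
qed

end

section \<open>Compositions that are nearly affine\<close>

lemma quadratic_approximation:
  assumes hol: "h holomorphic_on U" and U: "open U" and S: "compact S" "convex S" "S \<subseteq> U"
  obtains K where "0 \<le> K"
    "\<And>u v. u \<in> S \<Longrightarrow> v \<in> S \<Longrightarrow> norm (h u - h v - deriv h v * (u - v)) \<le> K * (norm (u - v))\<^sup>2"
proof -
  have hd: "(deriv ^^ i) h holomorphic_on U" for i
    by (rule holomorphic_higher_deriv[OF hol U])
  have "compact ((deriv ^^ 2) h ` S)"
    using hd S by (meson compact_continuous_image continuous_on_subset holomorphic_on_imp_continuous_on)
  then obtain L where L: "\<forall>y\<in>(deriv ^^ 2) h ` S. norm y \<le> L"
    using compact_imp_bounded bounded_iff by metis
  have "norm (h u - h v - deriv h v * (u - v)) \<le> max 0 L * (norm (u - v))\<^sup>2"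
    if uv: "u \<in> S" "v \<in> S" for u v
  proof -
    have "norm ((deriv ^^ 0) h u - (\<Sum>i\<le>1. (deriv ^^ i) h v * (u - v) ^ i / (fact i)))
        \<le> max 0 L * norm (u - v) ^ Suc 1 / fact 1"
    proof (rule complex_Taylor[OF S(2)])
      show "((deriv ^^ i) h has_field_derivative (deriv ^^ Suc i) h x) (at x within S)" if "x \<in> S" for i x
        using holomorphic_derivI[OF hd U] that S by fastforce
      show "norm ((deriv ^^ Suc 1) h x) \<le> max 0 L" if "x \<in> S" for x
        using L that by (auto simp: numeral_2_eq_2 le_max_iff_disj)
    qed (use uv in auto)
    then show ?thesis by (simp add: numeral_2_eq_2 algebra_simps)
  qed
  then show ?thesis using that[of "max 0 L"] by auto
qed

text \<open>
  One step of the distortion estimate.  A map \<open>u\<close> close to \<open>x + D * w\<close> is followed by a map with derivative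
  \<open>a\<close> at \<open>x\<close> and quadratic error \<open>K\<close>.  Relative to the new linear part \<open>a * D\<close> the error grows by
  \<open>4 * K * r\<^sup>2 * norm D / norm a\<close>, which is summable as long as the derivatives \<open>D\<close> grow or decay
  geometrically.
\<close>

lemma near_affine_step:
  fixes u x D w a fu fx :: complex
  assumes u: "norm (u - x - D * w) \<le> \<epsilon> * norm D" and w: "norm w \<le> r" and \<epsilon>: "\<epsilon> \<le> r"
    and f: "norm (fu - fx - a * (u - x)) \<le> K * (norm (u - x))\<^sup>2" and K: "0 \<le> K"
  shows "norm (fu - fx - a * D * w) \<le> norm a * \<epsilon> * norm D + 4 * K * r\<^sup>2 * (norm D)\<^sup>2"
proof -
  have "norm (u - x) \<le> norm (u - x - D * w) + norm (D * w)"
    using norm_triangle_ineq[of "u - x - D * w" "D * w"] by simp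
  also have "\<dots> \<le> r * norm D + norm D * r"
    using u w \<epsilon> by (intro add_mono order_trans[OF u] mult_right_mono)
      (auto simp: norm_mult mult_left_mono)
  finally have "norm (u - x) \<le> 2 * r * norm D" by simp
  then have "(norm (u - x))\<^sup>2 \<le> (2 * r * norm D)\<^sup>2" by (intro power_mono) auto
  then have "K * (norm (u - x))\<^sup>2 \<le> 4 * K * r\<^sup>2 * (norm D)\<^sup>2"
    using mult_left_mono[OF _ K] by (fastforce simp: power_mult_distrib algebra_simps)
  moreover have "fu - fx - a * D * w = a * (u - x - D * w) + (fu - fx - a * (u - x))"
    by (simp add: algebra_simps)
  then have "norm (fu - fx - a * D * w) \<le> norm a * norm (u - x - D * w) + norm (fu - fx - a * (u - x))"
    by (metis norm_mult norm_triangle_ineq)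
  moreover have "norm a * norm (u - x - D * w) \<le> norm a * (\<epsilon> * norm D)"
    using u by (intro mult_left_mono) auto
  ultimately show ?thesis using f by (simp add: mult.assoc)
qed

lemma near_affine_norm:
  fixes u x D w :: complex
  assumes u: "norm (u - x - D * w) \<le> \<epsilon> * norm D" and w: "norm w \<le> r" and \<epsilon>: "\<epsilon> \<le> r"
  shows "norm (u - x) \<le> 2 * r * norm D"
proof -
  have "norm (u - x) \<le> norm (u - x - D * w) + norm (D * w)"
    using norm_triangle_ineq[of "u - x - D * w" "D * w"] by simp
  also have "\<dots> \<le> r * norm D + norm D * r"
    using u w \<epsilon> by (intro add_mono order_trans[OF u] mult_right_mono)
      (auto simp: norm_mult mult_left_mono)
  finally show ?thesis by simp
qed

text \<open>
  The iterates of a contracting germ stay close to the iterates of its linear part, uniformly in the number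
  of iterations.
\<close>

lemma attracting_iterates_near_affine:
  assumes hol: "R holomorphic_on ball \<zeta> r0" and r0: "0 < r0" and R\<zeta>: "R \<zeta> = \<zeta>" and \<theta>: "\<theta> < 1"
    and contr: "\<And>w. w \<in> ball \<zeta> r0 \<Longrightarrow> norm (R w - \<zeta>) \<le> \<theta> * norm (w - \<zeta>)"
    and nz: "deriv R \<zeta> \<noteq> 0"
  obtains r where "0 < r" "r \<le> r0" "r \<le> 1/4" "norm (deriv R \<zeta>) < 1"
    "\<And>l z. z \<in> ball \<zeta> r \<Longrightarrow> (R ^^ l) z \<in> ball \<zeta> r"
    "\<And>l z. z \<in> ball \<zeta> r \<Longrightarrow>
       norm ((R ^^ l) z - \<zeta> - (deriv R \<zeta>) ^ l * (z - \<zeta>)) \<le> r / 16 * norm ((deriv R \<zeta>) ^ l)"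
proof -
  define \<sigma> where "\<sigma> = deriv R \<zeta>"
  define s where "s = norm \<sigma>"
  have s0: "0 < s" using nz by (simp add: s_def \<sigma>_def)
  have s1: "s < 1"
  proof -
    have D: "((\<lambda>w. R w - \<zeta>) has_field_derivative \<sigma>) (at \<zeta>)"
      using holomorphic_derivI[OF hol open_ball, of \<zeta> UNIV] r0
      by (auto simp: \<sigma>_def intro!: derivative_eq_intros)
    have "norm ((deriv ^^ 1) (\<lambda>w. R w - \<zeta>) \<zeta>) \<le> fact 1 * (\<theta> * (r0 / 2)) / (r0 / 2) ^ 1"
    proof (rule Cauchy_inequality)
      have sub: "cball \<zeta> (r0 / 2) \<subseteq> ball \<zeta> r0" using r0 by auto
      show "(\<lambda>w. R w - \<zeta>) holomorphic_on ball \<zeta> (r0 / 2)"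
        using r0 by (intro holomorphic_intros holomorphic_on_subset[OF hol]) auto
      show "continuous_on (cball \<zeta> (r0 / 2)) (\<lambda>w. R w - \<zeta>)"
        using sub by (intro continuous_intros continuous_on_subset[OF holomorphic_on_imp_continuous_on[OF hol]])
      show "norm (R x - \<zeta>) \<le> \<theta> * (r0 / 2)" if "norm (\<zeta> - x) = r0 / 2" for x
        using contr[of x] that r0 by (simp add: dist_norm norm_minus_commute)
    qed (use r0 in auto)
    then have "norm \<sigma> \<le> \<theta>" using r0 DERIV_imp_deriv[OF D] by simp
    then show ?thesis using \<theta> by (simp add: s_def)
  qed
  obtain K where K: "0 \<le> K"
    "\<And>u v. u \<in> cball \<zeta> (r0 / 2) \<Longrightarrow> v \<in> cball \<zeta> (r0 / 2) \<Longrightarrow>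
       norm (R u - R v - deriv R v * (u - v)) \<le> K * (norm (u - v))\<^sup>2"
  proof -
    have "cball \<zeta> (r0 / 2) \<subseteq> ball \<zeta> r0" using r0 by auto
    then show ?thesis
      using quadratic_approximation[OF hol open_ball compact_cball convex_cball] that by metis
  qed
  define C where "C = 4 * K / (s * (1 - s))"
  have C: "0 \<le> C" "C * (s * (1 - s)) = 4 * K" using K s0 s1 by (auto simp: C_def)
  define r where "r = min (min (r0 / 2) (1/4)) (1 / (16 * (C + 1)))"
  have "C * r \<le> 1 / 16"
  proof -
    have "C * r \<le> C * (1 / (16 * (C + 1)))" using C by (intro mult_left_mono) (auto simp: r_def)
    also have "\<dots> \<le> 1 / 16" using C by (simp add: field_simps)
    finally show ?thesis .
  qed
  moreover have r: "0 < r" "r \<le> r0 / 2" "r \<le> 1/4" using r0 C by (auto simp: r_def)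
  ultimately have Cr: "C * r\<^sup>2 \<le> r / 16" by (simp add: power2_eq_square)
  have inv: "(R ^^ l) z \<in> ball \<zeta> r" if z: "z \<in> ball \<zeta> r" for l z
  proof (induction l)
    case (Suc l)
    have "(R ^^ l) z \<in> ball \<zeta> r0" using Suc r r0 by auto
    then have "norm (R ((R ^^ l) z) - \<zeta>) \<le> \<theta> * norm ((R ^^ l) z - \<zeta>)" by (rule contr)
    also have "\<dots> \<le> 1 * norm ((R ^^ l) z - \<zeta>)" using \<theta> by (intro mult_right_mono) auto
    also have "\<dots> < r" using Suc by (simp add: dist_norm norm_minus_commute)
    finally show ?case by (simp add: dist_norm norm_minus_commute)
  qed (use z in simp)
  \<comment> \<open>The constant \<open>C\<close> is chosen such that the error added by \<open>near_affine_step\<close> is exactly the increment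
    of \<open>C * r\<^sup>2 * (1 - s ^ l)\<close>.\<close>
  have claim: "norm ((R ^^ l) z - \<zeta> - \<sigma> ^ l * (z - \<zeta>)) \<le> C * r\<^sup>2 * (1 - s ^ l) * norm (\<sigma> ^ l)"
    if z: "z \<in> ball \<zeta> r" for l z
  proof (induction l)
    case (Suc l)
    let ?u = "(R ^^ l) z"
    have sl: "0 \<le> s ^ l" "s ^ l \<le> 1" using s0 s1 by (auto simp: power_le_one)
    have "C * r\<^sup>2 * (1 - s ^ l) \<le> C * r\<^sup>2" using C sl by (intro mult_left_le) auto
    then have eps: "C * r\<^sup>2 * (1 - s ^ l) \<le> r" using Cr r by linarith
    have uin: "?u \<in> cball \<zeta> (r0 / 2)" using inv[OF z, of l] r by auto
    have "norm (R ?u - R \<zeta> - \<sigma> * (?u - \<zeta>)) \<le> K * (norm (?u - \<zeta>))\<^sup>2"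
      using K(2)[OF uin, of \<zeta>] r0 by (simp add: \<sigma>_def)
    moreover have "norm (z - \<zeta>) \<le> r" using z by (simp add: dist_norm norm_minus_commute)
    ultimately have "norm (R ?u - R \<zeta> - \<sigma> * \<sigma> ^ l * (z - \<zeta>))
        \<le> norm \<sigma> * (C * r\<^sup>2 * (1 - s ^ l)) * norm (\<sigma> ^ l) + 4 * K * r\<^sup>2 * (norm (\<sigma> ^ l))\<^sup>2"
      using near_affine_step[OF Suc _ eps _ K(1)] by blast
    also have "\<dots> = C * r\<^sup>2 * (1 - s ^ Suc l) * norm (\<sigma> ^ Suc l)"
      unfolding C(2)[symmetric] by (simp add: norm_power norm_mult s_def[symmetric] power2_eq_square algebra_simps)
    finally show ?case by (simp add: R\<zeta>)
  qed simp
  show ?thesis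
  proof (rule that[of r])
    show "norm (deriv R \<zeta>) < 1" using s1 by (simp add: s_def \<sigma>_def)
    show "norm ((R ^^ l) z - \<zeta> - (deriv R \<zeta>) ^ l * (z - \<zeta>)) \<le> r / 16 * norm ((deriv R \<zeta>) ^ l)"
      if "z \<in> ball \<zeta> r" for l z
    proof -
      have "C * r\<^sup>2 * (1 - s ^ l) \<le> C * r\<^sup>2 * 1" using C s0 by (intro mult_left_mono) auto
      then have "C * r\<^sup>2 * (1 - s ^ l) \<le> r / 16" using Cr by simp
      then show ?thesis using order_trans[OF claim[OF that, of l] mult_right_mono[OF _ norm_ge_zero]]
        unfolding \<sigma>_def by blast
    qed
  qed (use r r0 inv in auto)
qed

section \<open>A repelling cycle on the circle\<close>

context expanding_disc_map
begin

lemma boundary_distance_lipschitz: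
  obtains \<Lambda> where "1 \<le> \<Lambda>" "\<And>z. norm z < 1 \<Longrightarrow> 1 - norm (F z) \<le> \<Lambda> * (1 - norm z)"
proof -
  obtain \<Lambda> where \<Lambda>: "1 \<le> \<Lambda>" "\<And>u v. norm u \<le> 1 \<Longrightarrow> norm v \<le> 1 \<Longrightarrow> norm (F u - F v) \<le> \<Lambda> * norm (u - v)"
    by (rule lipschitz_disc) blast
  have "1 - norm (F z) \<le> \<Lambda> * (1 - norm z)" if z: "norm z < 1" for z
  proof (cases "z = 0")
    case True
    then show ?thesis using \<Lambda>(1) fix0 by simp
  next
    case False
    define y where "y = z / of_real (norm z)"
    have y: "norm y = 1" using False by (simp add: y_def norm_divide)
    have "y - z = y * of_real (1 - norm z)" using False by (simp add: y_def field_simps)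
    then have yz: "norm (y - z) = 1 - norm z" using y z by (simp add: norm_mult del: of_real_diff)
    have "1 - norm (F z) \<le> norm (F y - F z)"
      using norm_triangle_ineq2[of "F y" "F z"] circle[OF y] by simp
    also have "\<dots> \<le> \<Lambda> * norm (y - z)" using \<Lambda>(2) y z by simp
    finally show ?thesis using yz by simp
  qed
  with \<Lambda>(1) show ?thesis using that by blast
qed

text \<open>
  Otherwise \<open>F z / z\<close> would be zero-free with modulus tending to \<open>1\<close> at the circle, hence a unimodular
  constant; but its value at \<open>0\<close> is the multiplier.
\<close>

lemma nonzero_zero:
  obtains z where "norm z < 1" "z \<noteq> 0" "F z = 0"
proof -
  have "\<exists>z. norm z < 1 \<and> z \<noteq> 0 \<and> F z = 0"
  proof (rule ccontr)
    assume "\<not> ?thesis"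
    then have nz: "F z \<noteq> 0" if "norm z < 1" "z \<noteq> 0" for z using that by blast
    obtain B where B: "B holomorphic_on ball 0 1" "\<And>z. norm z < 1 \<Longrightarrow> F z = z * B z" "deriv F 0 = B 0"
      using Schwarz3[OF holF_disc fix0] by blast
    obtain \<Lambda> where \<Lambda>: "1 \<le> \<Lambda>" "\<And>z. norm z < 1 \<Longrightarrow> 1 - norm (F z) \<le> \<Lambda> * (1 - norm z)"
      by (rule boundary_distance_lipschitz) blast
    have ge: "norm (F z) \<le> norm (B z)" if "norm z < 1" for z
      using B(2)[OF that] that by (simp add: norm_mult mult_left_le_one_le)
    have "\<exists>c. norm c = 1 \<and> (\<forall>z. norm z < 1 \<longrightarrow> B z = c)"
    proof (rule reflected_disc_map_zero_free[OF B(1)])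
      show "norm (B z) \<le> 1" if "norm z < 1" for z
      proof (cases "z = 0")
        case True
        then show ?thesis using multiplier B(3) by simp
      next
        case False
        then show ?thesis using norm_le[OF that] B(2)[OF that] by (simp add: norm_mult)
      qed
      show "B z \<noteq> 0" if "norm z < 1" for z
        using nz[OF that] B(2)[OF that] B(3) multiplier by (cases "z = 0") auto
      show "\<exists>s<1. \<forall>z. s < norm z \<and> norm z < 1 \<longrightarrow> t < norm (B z)" if t: "t < 1" for t
      proof (intro exI[of _ "1 - (1 - t) / \<Lambda>"] conjI allI impI)
        show "1 - (1 - t) / \<Lambda> < 1" using t \<Lambda> by simp
        fix z :: complex assume z: "1 - (1 - t) / \<Lambda> < norm z \<and> norm z < 1"
        then have "\<Lambda> * (1 - norm z) < 1 - t" using \<Lambda>(1) by (simp add: field_simps)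
        then show "t < norm (B z)" using \<Lambda>(2)[of z] ge[of z] z by linarith
      qed
    qed
    then show False using B(3) multiplier by fastforce
  qed
  then show ?thesis using that by blast
qed

text \<open>
  The point \<open>b k\<close> reaches \<open>0\<close> after exactly \<open>k + 1\<close> steps, so these points are distinct.
\<close>

lemma backward_orbit:
  obtains b where "\<And>k. b k \<in> prezeros" "\<And>k. F (b (Suc k)) = b k" "inj b" "\<And>k. (F ^^ Suc k) (b k) = 0"
proof -
  obtain z1 where z1: "norm z1 < 1" "z1 \<noteq> 0" "F z1 = 0" by (rule nonzero_zero)
  define pre where "pre w = (SOME z. norm z < 1 \<and> F z = w)" for w
  have pre: "norm (pre w) < 1 \<and> F (pre w) = w" if "norm w < 1" for w
    unfolding pre_def using someI_ex[OF surj_disc[OF that]] .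
  define b where "b k = (pre ^^ k) z1" for k
  have b1: "norm (b k) < 1" for k
    by (induction k) (use z1 pre in \<open>auto simp: b_def\<close>)
  have bF: "F (b (Suc k)) = b k" for k using pre[OF b1[of k]] by (simp add: b_def)
  have lev: "(F ^^ k) (b k) = z1" for k
  proof (induction k)
    case (Suc k)
    have "(F ^^ Suc k) (b (Suc k)) = (F ^^ k) (F (b (Suc k)))" by (simp add: funpow_swap1)
    then show ?case using Suc bF by simp
  qed (simp add: b_def)
  have lev0: "(F ^^ Suc k) (b k) = 0" for k using lev z1 by simp
  have neq: "b i \<noteq> b j" if "i < j" for i j
  proof
    assume "b i = b j"
    then have "(F ^^ (j - Suc i + Suc i)) (b i) = z1" using lev[of j] that by simp
    then have "(F ^^ (j - Suc i)) 0 = z1" using lev0[of i] by (simp only: funpow_add o_apply)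
    then show False using z1 iterate_0 by simp
  qed
  then have "inj b" by (metis injI linorder_neqE_nat)
  moreover have "b k \<in> prezeros" for k unfolding prezeros_def using b1 lev0 by blast
  ultimately show ?thesis using that bF lev0 by blast
qed

text \<open>
  A backward orbit in \<open>prezeros\<close> accumulates at the circle.  Two of its points \<open>b k\<close> and \<open>b (k + P)\<close> are very
  close to each other; the inverse branch of the \<open>P\<close>-th iterate that carries the first to the second then
  maps a ball into itself and contracts it.  Its fixed point \<open>\<zeta>\<close> is attracting for the branch, and points
  of \<open>prezeros\<close> lie in its basin.
\<close>

lemma repelling_cycle:
  obtains \<zeta> r R P \<theta> p where "norm \<zeta> = 1" "0 < r" "R holomorphic_on ball \<zeta> r" "R \<zeta> = \<zeta>" "0 \<le> \<theta>" "\<theta> < 1"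
    "\<And>w. w \<in> ball \<zeta> r \<Longrightarrow> norm (R w - \<zeta>) \<le> \<theta> * norm (w - \<zeta>)"
    "\<And>w. w \<in> ball \<zeta> r \<Longrightarrow> (F ^^ P) (R w) = w"
    "\<And>w. w \<in> ball \<zeta> r \<Longrightarrow> norm w < 1 \<Longrightarrow> norm (R w) < 1"
    "p \<in> prezeros" "p \<in> ball \<zeta> r"
proof -
  obtain \<rho> \<kappa> where \<rho>: "0 < \<rho>" "\<rho> < 1/4" "1 < \<kappa>"
    "\<And>x. 1 - \<rho> \<le> norm x \<Longrightarrow> norm x \<le> 1 \<Longrightarrow>
       \<exists>g. g holomorphic_on ball (F x) \<rho> \<and> g (F x) = x \<and>
         (\<forall>w\<in>ball (F x) \<rho>. g w \<in> ball x \<rho> \<and> F (g w) = w \<and> (norm w < 1 \<longrightarrow> norm (g w) < 1)) \<and>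
         (\<forall>w\<in>ball (F x) \<rho>. \<forall>w'\<in>ball (F x) \<rho>. \<kappa> * norm (g w - g w') \<le> norm (w - w'))"
    by (rule inverse_branches) blast
  obtain b where b: "\<And>k. b k \<in> prezeros" "\<And>k. F (b (Suc k)) = b k" "inj b"
    by (rule backward_orbit) blast
  have b1: "norm (b k) < 1" for k using b(1)[of k] by (simp add: prezeros_def)
  have "finite (b -` {z \<in> prezeros. norm z \<le> 1 - \<rho>})"
    by (rule finite_vimageI[OF prezeros_finite b(3)]) (use \<rho> in simp)
  then obtain K where K: "\<And>k. norm (b k) \<le> 1 - \<rho> \<Longrightarrow> k < K"
    using b(1) unfolding finite_nat_set_iff_bounded by auto
  have branch: "\<exists>g. g holomorphic_on ball (b k) \<rho> \<and> g (b k) = b (k + P) \<and>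
      (\<forall>w\<in>ball (b k) \<rho>. (F ^^ P) (g w) = w \<and> (norm w < 1 \<longrightarrow> norm (g w) < 1)) \<and>
      (\<forall>w\<in>ball (b k) \<rho>. \<forall>w'\<in>ball (b k) \<rho>. \<kappa> ^ P * norm (g w - g w') \<le> norm (w - w'))"
    if k: "K \<le> k" for k P
  proof (induction P)
    case 0
    show ?case by (rule exI[of _ "\<lambda>w. w"]) auto
  next
    case (Suc P)
    then obtain g where g: "g holomorphic_on ball (b k) \<rho>" "g (b k) = b (k + P)"
      "\<And>w. w \<in> ball (b k) \<rho> \<Longrightarrow> (F ^^ P) (g w) = w"
      "\<And>w. w \<in> ball (b k) \<rho> \<Longrightarrow> norm w < 1 \<Longrightarrow> norm (g w) < 1"
      "\<And>w w'. w \<in> ball (b k) \<rho> \<Longrightarrow> w' \<in> ball (b k) \<rho> \<Longrightarrow> \<kappa> ^ P * norm (g w - g w') \<le> norm (w - w')"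
      by blast
    let ?x = "b (Suc (k + P))"
    have Fx: "F ?x = b (k + P)" by (rule b(2))
    have "1 - \<rho> \<le> norm ?x" using K[of "Suc (k + P)"] k by force
    then obtain h where h: "h holomorphic_on ball (b (k + P)) \<rho>" "h (b (k + P)) = ?x"
      "\<And>w. w \<in> ball (b (k + P)) \<rho> \<Longrightarrow> F (h w) = w"
      "\<And>w. w \<in> ball (b (k + P)) \<rho> \<Longrightarrow> norm w < 1 \<Longrightarrow> norm (h w) < 1"
      "\<And>w w'. w \<in> ball (b (k + P)) \<rho> \<Longrightarrow> w' \<in> ball (b (k + P)) \<rho> \<Longrightarrow> \<kappa> * norm (h w - h w') \<le> norm (w - w')"
      using \<rho>(4)[of ?x] b1[of "Suc (k + P)"] Fx by (auto simp: less_imp_le)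
    have gin: "g w \<in> ball (b (k + P)) \<rho>" if w: "w \<in> ball (b k) \<rho>" for w
    proof -
      have "1 * norm (g w - b (k + P)) \<le> \<kappa> ^ P * norm (g w - b (k + P))"
        using \<rho>(3) by (intro mult_right_mono) auto
      also have "\<dots> \<le> norm (w - b k)" using g(5)[OF w, of "b k"] g(2) \<rho>(1) by simp
      also have "\<dots> < \<rho>" using w by (simp add: dist_norm norm_minus_commute)
      finally show ?thesis by (simp add: dist_norm norm_minus_commute)
    qed
    show ?case
    proof (intro exI[of _ "h \<circ> g"] conjI ballI impI)
      show "h \<circ> g holomorphic_on ball (b k) \<rho>"
        by (rule holomorphic_on_compose_gen[OF g(1) h(1)]) (use gin in auto)
      show "(h \<circ> g) (b k) = b (k + Suc P)" using g(2) h(2) by simp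
      fix w assume w: "w \<in> ball (b k) \<rho>"
      have "(F ^^ Suc P) ((h \<circ> g) w) = (F ^^ P) (F (h (g w)))" by (simp add: funpow_swap1)
      then show "(F ^^ Suc P) ((h \<circ> g) w) = w" using h(3)[OF gin[OF w]] g(3)[OF w] by simp
      show "norm w < 1 \<Longrightarrow> norm ((h \<circ> g) w) < 1" using h(4)[OF gin[OF w]] g(4)[OF w] by simp
      fix w' assume w': "w' \<in> ball (b k) \<rho>"
      have "\<kappa> ^ Suc P * norm ((h \<circ> g) w - (h \<circ> g) w') = \<kappa> ^ P * (\<kappa> * norm (h (g w) - h (g w')))"
        by simp
      also have "\<dots> \<le> \<kappa> ^ P * norm (g w - g w')"
        using h(5)[OF gin[OF w] gin[OF w']] \<rho>(3) by (intro mult_left_mono) auto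
      also have "\<dots> \<le> norm (w - w')" by (rule g(5)[OF w w'])
      finally show "\<kappa> ^ Suc P * norm ((h \<circ> g) w - (h \<circ> g) w') \<le> norm (w - w')" .
    qed
  qed
  define \<delta> where "\<delta> = \<rho> / 2 * (1 - 1 / \<kappa>)"
  have \<delta>: "0 < \<delta>" using \<rho> by (simp add: \<delta>_def)
  obtain k P where kP: "K \<le> k" "0 < P" "dist (b (k + P)) (b k) < \<delta>"
  proof -
    have "\<forall>k. b k \<in> cball 0 1" using b1 by (auto simp: less_imp_le)
    then obtain l s where ls: "strict_mono (s :: nat \<Rightarrow> nat)" "(b \<circ> s) \<longlonglongrightarrow> l"
      using compact_cball[of "0::complex" 1] unfolding compact_def by metis
    then have "Cauchy (b \<circ> s)" by (intro LIMSEQ_imp_Cauchy)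
    then obtain N where N: "\<And>m n. m \<ge> N \<Longrightarrow> n \<ge> N \<Longrightarrow> dist (b (s m)) (b (s n)) < \<delta>"
      using \<delta> unfolding Cauchy_def by force
    have lt: "s (N + K) < s (Suc (N + K))" using ls(1) by (simp add: strict_mono_def)
    have "K \<le> s (N + K)" using seq_suble[OF ls(1), of "N + K"] by simp
    then show ?thesis
      using that[of "s (N + K)" "s (Suc (N + K)) - s (N + K)"] lt N[of "Suc (N + K)" "N + K"] by simp
  qed
  obtain g where g: "g holomorphic_on ball (b k) \<rho>" "g (b k) = b (k + P)"
      "\<And>w. w \<in> ball (b k) \<rho> \<Longrightarrow> (F ^^ P) (g w) = w"
      "\<And>w. w \<in> ball (b k) \<rho> \<Longrightarrow> norm w < 1 \<Longrightarrow> norm (g w) < 1"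
      "\<And>w w'. w \<in> ball (b k) \<rho> \<Longrightarrow> w' \<in> ball (b k) \<rho> \<Longrightarrow> \<kappa> ^ P * norm (g w - g w') \<le> norm (w - w')"
    using branch[OF kP(1), of P] by blast
  have glip: "norm (g w - g w') \<le> 1 / \<kappa> * norm (w - w')" if "w \<in> ball (b k) \<rho>" "w' \<in> ball (b k) \<rho>" for w w'
  proof -
    have "\<kappa> ^ 1 \<le> \<kappa> ^ P" using \<rho>(3) kP(2) by (intro power_increasing) auto
    then have "\<kappa> * norm (g w - g w') \<le> \<kappa> ^ P * norm (g w - g w')" by (intro mult_right_mono) auto
    then have "\<kappa> * norm (g w - g w') \<le> norm (w - w')" using g(5)[OF that] by linarith
    then show ?thesis using \<rho>(3) by (simp add: field_simps)
  qed
  let ?C = "cball (b k) (\<rho> / 2)"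
  have subC: "?C \<subseteq> ball (b k) \<rho>" using \<rho> by auto
  have bk: "b k \<in> ?C" using \<rho> by simp
  have mapC: "g w \<in> ?C" if w: "w \<in> ?C" for w
  proof -
    have "norm (g w - g (b k)) \<le> 1 / \<kappa> * norm (w - b k)" using glip w bk subC by blast
    also have "\<dots> \<le> 1 / \<kappa> * (\<rho> / 2)"
      using w \<rho> by (intro mult_left_mono) (auto simp: dist_norm norm_minus_commute)
    finally have "dist (g w) (b (k + P)) \<le> 1 / \<kappa> * (\<rho> / 2)" by (simp add: dist_norm g(2))
    then have "dist (g w) (b k) \<le> 1 / \<kappa> * (\<rho> / 2) + \<delta>"
      using dist_triangle[of "g w" "b k" "b (k + P)"] kP(3) by linarith
    moreover have "1 / \<kappa> * (\<rho> / 2) + \<delta> = \<rho> / 2" using \<rho> by (simp add: \<delta>_def field_simps)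
    ultimately show ?thesis by (simp add: dist_commute)
  qed
  have "\<exists>!z. z \<in> ?C \<and> g z = z"
  proof (rule Banach_fix[where c="1 / \<kappa>"])
    show "dist (g x) (g y) \<le> 1 / \<kappa> * dist x y" if "x \<in> ?C" "y \<in> ?C" for x y
      using glip that subC unfolding dist_norm by blast
  qed (use \<rho> mapC bk in \<open>auto simp: complete_eq_closed\<close>)
  then obtain \<zeta> where \<zeta>: "\<zeta> \<in> ?C" "g \<zeta> = \<zeta>" by blast
  have gi: "(g ^^ i) (b k) \<in> ?C \<and> norm ((g ^^ i) (b k)) < 1 \<and>
      norm ((g ^^ i) (b k) - \<zeta>) \<le> (1 / \<kappa>) ^ i * norm (b k - \<zeta>)" for i
  proof (induction i)
    case (Suc i)
    let ?w = "(g ^^ i) (b k)"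
    have w: "?w \<in> ?C" "norm ?w < 1" "norm (?w - \<zeta>) \<le> (1 / \<kappa>) ^ i * norm (b k - \<zeta>)" using Suc by auto
    have "norm (g ?w - g \<zeta>) \<le> 1 / \<kappa> * norm (?w - \<zeta>)" using glip w(1) \<zeta>(1) subC by blast
    also have "\<dots> \<le> 1 / \<kappa> * ((1 / \<kappa>) ^ i * norm (b k - \<zeta>))" using w(3) \<rho> by (intro mult_left_mono) auto
    finally have "norm (g ?w - \<zeta>) \<le> (1 / \<kappa>) ^ Suc i * norm (b k - \<zeta>)" by (simp add: \<zeta>(2))
    moreover have "norm (g ?w) < 1" using g(4) w subC by blast
    ultimately show ?case using mapC[OF w(1)] by simp
  qed (use bk b1 in auto)
  have \<zeta>le: "norm \<zeta> \<le> 1"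
  proof -
    have "(\<lambda>i. (1 / \<kappa>) ^ i * norm (b k - \<zeta>)) \<longlonglongrightarrow> 0 * norm (b k - \<zeta>)"
      using \<rho> by (intro tendsto_mult LIMSEQ_power_zero tendsto_const) auto
    then have "(\<lambda>i. 1 + (1 / \<kappa>) ^ i * norm (b k - \<zeta>)) \<longlonglongrightarrow> 1 + 0"
      by (intro tendsto_add tendsto_const) simp
    moreover have "norm \<zeta> \<le> 1 + (1 / \<kappa>) ^ i * norm (b k - \<zeta>)" for i
      using gi[of i] norm_triangle_ineq2[of \<zeta> "(g ^^ i) (b k)"] by (simp add: norm_minus_commute)
    ultimately show ?thesis using LIMSEQ_le_const[of _ "1 + 0" "norm \<zeta>"] by auto
  qed
  have per: "(F ^^ P) \<zeta> = \<zeta>" using g(3)[of \<zeta>] \<zeta> subC by auto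
  \<comment> \<open>In the open disc the origin is the only periodic point, and \<open>\<zeta>\<close> is too far from it.\<close>
  have \<zeta>1: "norm \<zeta> = 1"
  proof (rule ccontr)
    assume "norm \<zeta> \<noteq> 1"
    then have lt: "norm \<zeta> < 1" using \<zeta>le by simp
    obtain c where c: "0 < c" "\<And>z. norm z < 1 \<Longrightarrow> norm (F z) \<le> norm z * (1 - c * (1 - norm z))"
      by (rule contraction_bound) blast
    have "1 - \<rho> \<le> norm (b k)" using K[of k] kP(1) by force
    moreover have "norm (b k) - norm \<zeta> \<le> \<rho> / 2"
      using \<zeta>(1) norm_triangle_ineq2[of "b k" \<zeta>] by (simp add: dist_norm)
    ultimately have pos: "0 < norm \<zeta>" using \<rho> by linarith
    obtain P' where P': "P = Suc P'" using kP(2) by (cases P) auto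
    have "norm \<zeta> = norm ((F ^^ P') (F \<zeta>))" using per P' by (simp add: funpow_swap1)
    also have "\<dots> \<le> norm (F \<zeta>)" using iterate_norm_le disc[OF lt] by blast
    also have "\<dots> \<le> norm \<zeta> * (1 - c * (1 - norm \<zeta>))" by (rule c(2)[OF lt])
    also have "\<dots> < norm \<zeta> * 1" using pos c(1) lt by (intro mult_strict_left_mono) auto
    finally show False by simp
  qed
  have sub: "ball \<zeta> (\<rho> / 2) \<subseteq> ball (b k) \<rho>"
  proof
    fix w assume "w \<in> ball \<zeta> (\<rho> / 2)"
    then show "w \<in> ball (b k) \<rho>" using \<zeta>(1) dist_triangle[of "b k" w \<zeta>] by simp
  qed
  show ?thesis
  proof (rule that[of \<zeta> "\<rho> / 2" g "1 / \<kappa>" P "g (b k)"])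
    show "g holomorphic_on ball \<zeta> (\<rho> / 2)" using g(1) sub holomorphic_on_subset by blast
    show "norm (g w - \<zeta>) \<le> 1 / \<kappa> * norm (w - \<zeta>)" if "w \<in> ball \<zeta> (\<rho> / 2)" for w
    proof -
      have "w \<in> ball (b k) \<rho>" "\<zeta> \<in> ball (b k) \<rho>" using that sub \<zeta>(1) subC by blast+
      then show ?thesis using glip[of w \<zeta>] \<zeta>(2) by simp
    qed
    show "g (b k) \<in> prezeros" using g(2) b(1) by simp
    have "norm (g (b k) - \<zeta>) \<le> 1 / \<kappa> * norm (b k - \<zeta>)" 
    proof -
      have "b k \<in> ball (b k) \<rho>" "\<zeta> \<in> ball (b k) \<rho>" using \<zeta>(1) bk subC by blast+
      then show ?thesis using glip[of "b k" \<zeta>] \<zeta>(2) by simp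
    qed
    also have "\<dots> \<le> 1 / \<kappa> * (\<rho> / 2)" using \<zeta>(1) \<rho> by (intro mult_left_mono) (auto simp: dist_norm)
    also have "\<dots> < \<rho> / 2" using \<rho>(1,3) by (simp add: divide_less_eq)
    finally show "g (b k) \<in> ball \<zeta> (\<rho> / 2)" by (simp add: dist_norm norm_minus_commute)
  qed (use \<rho> \<zeta>1 \<zeta>(2) g(3,4) sub in auto)
qed

text \<open>
  Germs that are nearly affine with small slope, based at a point of the circle, are carried by iterates of
  \<open>F\<close> to nearly affine germs of definite size.  The error \<open>r / 8\<close> is made up of \<open>r / 16\<close> for the branch
  \<open>R ^^ l\<close> and \<open>r / 16\<close> for the word \<open>e\<close> in \<open>renormalised_word\<close>; the iteration adds another \<open>r / 16\<close>.
\<close>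

definition magnifies :: "complex \<Rightarrow> real \<Rightarrow> real \<Rightarrow> real \<Rightarrow> bool" where
  "magnifies \<zeta> r c0 d \<longleftrightarrow> (\<forall>E x D0. norm x = 1 \<longrightarrow> E holomorphic_on ball \<zeta> r \<longrightarrow> D0 \<noteq> 0 \<longrightarrow>
     norm D0 \<le> c0 \<longrightarrow> (\<forall>z\<in>ball \<zeta> r. norm (E z - x - D0 * (z - \<zeta>)) \<le> r / 8 * norm D0) \<longrightarrow>
     (\<exists>n D. d \<le> norm D \<and> (\<lambda>z. (F ^^ n) (E z)) holomorphic_on ball \<zeta> r \<and>
       (\<forall>z\<in>ball \<zeta> r. norm ((F ^^ n) (E z)) \<le> 2 \<and>
          norm ((F ^^ n) (E z) - (F ^^ n) x - D * (z - \<zeta>)) \<le> 3 / 16 * r * norm D)))"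

text \<open>
  Along an orbit on the circle the derivatives grow geometrically.  Iterating until the derivative would
  exceed the small constant \<open>c0\<close> keeps the image inside the domain of \<open>F\<close> and the total error small, and
  leaves a derivative of modulus at least \<open>c0 / \<Lambda>\<close>, so a germ that was tiny is brought back to definite
  size.
\<close>

lemma forward_iterates_near_affine:
  assumes r: "0 < r" "r \<le> 1/4"
  obtains c0 d where "0 < c0" "0 < d" "magnifies \<zeta> r c0 d"
proof -
  obtain c where c: "0 < c" "\<And>x. norm x = 1 \<Longrightarrow> 1 + c \<le> norm (deriv F x)"
    by (rule derivative_on_circle) blast
  obtain \<Lambda> where \<Lambda>: "1 \<le> \<Lambda>" "\<And>x. norm x \<le> 1 \<Longrightarrow> norm (deriv F x) \<le> \<Lambda>"
    by (rule lipschitz_disc) blast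
  have "cball 0 (1 + \<tau> / 2) \<subseteq> ball (0::complex) (1 + \<tau>)" using \<tau>_pos by auto
  then obtain K where K: "0 \<le> K"
    "\<And>u v. u \<in> cball 0 (1 + \<tau> / 2) \<Longrightarrow> v \<in> cball 0 (1 + \<tau> / 2) \<Longrightarrow>
       norm (F u - F v - deriv F v * (u - v)) \<le> K * (norm (u - v))\<^sup>2"
    using quadratic_approximation[OF holF open_ball compact_cball convex_cball] by metis
  \<comment> \<open>With this value the error \<open>C * r\<^sup>2 * norm (D i)\<close> absorbs the contribution of \<open>near_affine_step\<close>.\<close>
  define C where "C = 4 * K / c"
  have C: "0 \<le> C" "C * c = 4 * K" using K c by (auto simp: C_def)
  define c0 where "c0 = min (min 1 \<tau>) (1 / (16 * (C + 1)))"
  have c0: "0 < c0" "c0 \<le> 1" "c0 \<le> \<tau>" using \<tau>_pos C by (auto simp: c0_def)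
  have Cc0: "C * c0 \<le> 1 / 16"
  proof -
    have "C * c0 \<le> C * (1 / (16 * (C + 1)))" using C by (intro mult_left_mono) (auto simp: c0_def)
    also have "\<dots> \<le> 1 / 16" using C by (simp add: field_simps)
    finally show ?thesis .
  qed
  have main: "\<exists>n D. c0 / \<Lambda> \<le> norm D \<and> (\<lambda>z. (F ^^ n) (E z)) holomorphic_on ball \<zeta> r \<and>
         (\<forall>z\<in>ball \<zeta> r. norm ((F ^^ n) (E z)) \<le> 2 \<and>
            norm ((F ^^ n) (E z) - (F ^^ n) x - D * (z - \<zeta>)) \<le> 3 / 16 * r * norm D)"
    if x: "norm x = 1" and hE: "E holomorphic_on ball \<zeta> r" and D0: "D0 \<noteq> 0" "norm D0 \<le> c0"
      and E: "\<And>z. z \<in> ball \<zeta> r \<Longrightarrow> norm (E z - x - D0 * (z - \<zeta>)) \<le> r / 8 * norm D0"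
    for E x D0
  proof -
    define y where "y i = (F ^^ i) x" for i
    have y: "norm (y i) = 1" for i
      by (induction i) (use x circle in \<open>auto simp: y_def\<close>)
    define D where "D i = D0 * (\<Prod>j<i. deriv F (y j))" for i
    have DS: "D (Suc i) = deriv F (y i) * D i" for i by (simp add: D_def)
    have Dgrow: "(1 + c) ^ i * norm D0 \<le> norm (D i)" for i
    proof (induction i)
      case (Suc i)
      have "(1 + c) * ((1 + c) ^ i * norm D0) \<le> norm (deriv F (y i)) * norm (D i)"
        using Suc c(1) c(2)[OF y] by (intro mult_mono) auto
      then show ?case by (simp add: DS norm_mult mult.assoc)
    qed (simp add: D_def)
    obtain m where "c0 / norm D0 < (1 + c) ^ m" using real_arch_pow[of "1 + c"] c(1) by auto
    then have "c0 < (1 + c) ^ m * norm D0" using D0 by (simp add: field_simps)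
    then have ex: "\<exists>m. c0 < norm (D m)" using Dgrow[of m] by (meson less_le_trans)
    \<comment> \<open>The iteration stops one step before the derivative exceeds \<open>c0\<close>.\<close>
    define M where "M = (LEAST m. c0 < norm (D m))"
    have M: "c0 < norm (D M)" "\<And>i. i < M \<Longrightarrow> norm (D i) \<le> c0"
      unfolding M_def using LeastI_ex[OF ex] not_less_Least by (auto simp: not_less[symmetric])
    have "M \<noteq> 0"
    proof
      assume "M = 0"
      then show False using M(1) D0 by (simp add: D_def)
    qed
    then obtain n where n: "M = Suc n" by (cases M) auto
    have Dle: "norm (D i) \<le> c0" if "i \<le> n" for i using M(2) n that by simp
    have claim: "(\<lambda>z. (F ^^ i) (E z)) holomorphic_on ball \<zeta> r \<and> (\<forall>z\<in>ball \<zeta> r.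
        norm ((F ^^ i) (E z) - y i - D i * (z - \<zeta>)) \<le> (r / 8 + C * r\<^sup>2 * norm (D i)) * norm (D i))"
      if "i \<le> n" for i
      using that
    proof (induction i)
      case 0
      have "norm (E z - x - D0 * (z - \<zeta>)) \<le> (r / 8 + C * r\<^sup>2 * norm D0) * norm D0" if "z \<in> ball \<zeta> r" for z
        by (rule order_trans[OF E[OF that] mult_right_mono]) (use C in auto)
      then show ?case using hE by (simp add: D_def y_def)
    next
      case (Suc i)
      then have IH: "(\<lambda>z. (F ^^ i) (E z)) holomorphic_on ball \<zeta> r"
        "\<And>z. z \<in> ball \<zeta> r \<Longrightarrow> norm ((F ^^ i) (E z) - y i - D i * (z - \<zeta>))
            \<le> (r / 8 + C * r\<^sup>2 * norm (D i)) * norm (D i)" by auto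
      have Di: "norm (D i) \<le> c0" using Dle Suc.prems by simp
      have eps: "r / 8 + C * r\<^sup>2 * norm (D i) \<le> r"
      proof -
        have "C * norm (D i) \<le> 1 / 16" using Di C Cc0 mult_left_mono[OF Di C(1)] by linarith
        then have "(C * norm (D i)) * r\<^sup>2 \<le> 1 / 16 * r\<^sup>2" by (intro mult_right_mono) auto
        also have "\<dots> \<le> r / 16" using r by (simp add: power2_eq_square)
        finally show ?thesis using r by (simp add: algebra_simps)
      qed
      have dom: "(F ^^ i) (E z) \<in> cball 0 (1 + \<tau> / 2)" if z: "z \<in> ball \<zeta> r" for z
      proof -
        have "norm ((F ^^ i) (E z) - y i) \<le> 2 * r * norm (D i)"
          using near_affine_norm[OF IH(2)[OF z] _ eps] z by (simp add: dist_norm norm_minus_commute)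
        also have "\<dots> \<le> 2 * (1/4) * \<tau>"
          using r Di c0 by (intro mult_mono) auto
        finally show ?thesis using norm_triangle_ineq2[of "(F ^^ i) (E z)" "y i"] y[of i] by simp
      qed
      have "F \<circ> (\<lambda>z. (F ^^ i) (E z)) holomorphic_on ball \<zeta> r"
        by (rule holomorphic_on_compose_gen[OF IH(1) holF]) (use dom \<tau>_pos in force)
      moreover have "norm (F ((F ^^ i) (E z)) - F (y i) - D (Suc i) * (z - \<zeta>))
          \<le> (r / 8 + C * r\<^sup>2 * norm (D (Suc i))) * norm (D (Suc i))" if z: "z \<in> ball \<zeta> r" for z
      proof -
        let ?a = "deriv F (y i)"
        have "norm (F ((F ^^ i) (E z)) - F (y i) - ?a * ((F ^^ i) (E z) - y i))
            \<le> K * (norm ((F ^^ i) (E z) - y i))\<^sup>2"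
          by (rule K(2)[OF dom[OF z]]) (use y \<tau>_pos in simp)
        then have "norm (F ((F ^^ i) (E z)) - F (y i) - ?a * D i * (z - \<zeta>))
          \<le> norm ?a * (r / 8 + C * r\<^sup>2 * norm (D i)) * norm (D i) + 4 * K * r\<^sup>2 * (norm (D i))\<^sup>2"
          using near_affine_step[OF IH(2)[OF z] _ eps _ K(1)] z by (simp add: dist_norm norm_minus_commute)
        also have "\<dots> = norm ?a * (r / 8) * norm (D i) + (C * norm ?a + C * c) * (r\<^sup>2 * (norm (D i))\<^sup>2)"
          unfolding C(2) by (simp add: algebra_simps power2_eq_square)
        also have "\<dots> \<le> norm ?a * (r / 8) * norm (D i) + (C * (norm ?a)\<^sup>2) * (r\<^sup>2 * (norm (D i))\<^sup>2)"
        proof -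
          have a: "1 + c \<le> norm ?a" by (rule c(2)[OF y])
          have "1 * c \<le> norm ?a * (norm ?a - 1)" using a c(1) by (intro mult_mono) auto
          then have "C * c \<le> C * (norm ?a * (norm ?a - 1))" using C(1) mult_left_mono by fastforce
          then have "C * norm ?a + C * c \<le> C * (norm ?a)\<^sup>2" by (simp add: power2_eq_square algebra_simps)
          then show ?thesis by (intro add_left_mono mult_right_mono) auto
        qed
        also have "\<dots> = (r / 8 + C * r\<^sup>2 * norm (D (Suc i))) * norm (D (Suc i))"
          by (simp add: DS norm_mult power2_eq_square algebra_simps)
        finally show ?thesis by (simp add: DS)
      qed
      ultimately show ?case by (simp add: o_def y_def)
    qed
    have D\<Lambda>: "c0 / \<Lambda> \<le> norm (D n)"
    proof -
      have "c0 \<le> norm (deriv F (y n)) * norm (D n)" using M(1) by (simp add: n DS norm_mult)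
      also have "\<dots> \<le> \<Lambda> * norm (D n)" using \<Lambda>(2)[of "y n"] y[of n] by (intro mult_right_mono) auto
      finally show ?thesis using \<Lambda>(1) by (simp add: field_simps)
    qed
    have Dn: "norm (D n) \<le> c0" using Dle by simp
    have eps: "r / 8 + C * r\<^sup>2 * norm (D n) \<le> 3 / 16 * r"
    proof -
      have "C * norm (D n) \<le> 1 / 16" using Dn C Cc0 mult_left_mono[OF Dn C(1)] by linarith
      then have "(C * norm (D n)) * r\<^sup>2 \<le> 1 / 16 * r\<^sup>2" by (intro mult_right_mono) auto
      also have "\<dots> \<le> r / 16" using r by (simp add: power2_eq_square)
      finally show ?thesis using r by (simp add: algebra_simps)
    qed
    have aff: "norm ((F ^^ n) (E z) - y n - D n * (z - \<zeta>)) \<le> 3 / 16 * r * norm (D n)"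
      if z: "z \<in> ball \<zeta> r" for z
    proof (rule order_trans)
      show "norm ((F ^^ n) (E z) - y n - D n * (z - \<zeta>)) \<le> (r / 8 + C * r\<^sup>2 * norm (D n)) * norm (D n)"
        using claim[of n] z by blast
      show "(r / 8 + C * r\<^sup>2 * norm (D n)) * norm (D n) \<le> 3 / 16 * r * norm (D n)"
        using eps by (rule mult_right_mono) simp
    qed
    have bd: "norm ((F ^^ n) (E z)) \<le> 2" if z: "z \<in> ball \<zeta> r" for z
    proof -
      have "norm ((F ^^ n) (E z) - y n) \<le> 2 * r * norm (D n)"
        using near_affine_norm[OF aff[OF z], of r] z r by (simp add: dist_norm norm_minus_commute)
      also have "\<dots> \<le> 2 * (1/4) * 1" using r Dn c0 by (intro mult_mono) auto
      finally show ?thesis using norm_triangle_ineq2[of "(F ^^ n) (E z)" "y n"] y[of n] by simp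
    qed
    show ?thesis using D\<Lambda> claim[of n] aff bd by (intro exI[of _ n] exI[of _ "D n"]) (auto simp: y_def)
  qed
  have "magnifies \<zeta> r c0 (c0 / \<Lambda>)"
    unfolding magnifies_def by (intro allI impI main) auto
  then show ?thesis using that[of c0 "c0 / \<Lambda>"] c0 \<Lambda>(1) by auto
qed

end

section \<open>Rigidity of renormalised germs\<close>

text \<open>
  Dividing out a zero \<open>a\<close> in \<open>ball \<zeta> s\<close> costs a factor \<open>1 / (r - s)\<close> in the bound on \<open>ball \<zeta> r\<close>, while
  \<open>norm (z - a) \<le> 2 * s\<close> on the small ball.
\<close>

lemma many_zeros_decay:
  assumes "finite A" "A \<subseteq> ball \<zeta> s" "0 < s" "s < r" "h holomorphic_on ball \<zeta> r"
    and "\<And>z. z \<in> ball \<zeta> r \<Longrightarrow> norm (h z) \<le> M" and "\<And>a. a \<in> A \<Longrightarrow> h a = 0"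
    and z: "z \<in> ball \<zeta> s"
  shows "norm (h z) \<le> M * (2 * s / (r - s)) ^ card A"
  using assms(1,2,5,6,7)
proof (induction A arbitrary: h M rule: finite_induct)
  case empty
  then show ?case using z \<open>s < r\<close> by auto
next
  case (insert a A)
  note sr = \<open>0 < s\<close> \<open>s < r\<close>
  obtain k where k: "k holomorphic_on ball \<zeta> r" "\<And>z. z \<in> ball \<zeta> r \<Longrightarrow> h z = (z - a) * k z"
    using holomorphic_divide_zero[OF insert.prems(2) open_ball] insert.prems(4) by (metis insertI1)
  have as: "dist \<zeta> a < s" using insert.prems(1) by simp
  have kM: "norm (k w) \<le> M / (r - s)" if w: "w \<in> ball \<zeta> r" for w
  proof -
    \<comment> \<open>Maximum principle on the ball of radius \<open>t\<close>; then \<open>t\<close> tends to \<open>r\<close>.\<close>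
    have "norm (k w) * (t - s) \<le> M" if t: "max s (dist \<zeta> w) < t" "t < r" for t
    proof -
      have "norm (k w) \<le> M / (t - s)"
      proof (rule maximum_modulus_frontier[of k "cball \<zeta> t"])
        have sub: "cball \<zeta> t \<subseteq> ball \<zeta> r" using t by auto
        show "k holomorphic_on interior (cball \<zeta> t)"
          using k(1) sub by (meson holomorphic_on_subset interior_subset subset_trans)
        show "continuous_on (closure (cball \<zeta> t)) k"
          using holomorphic_on_imp_continuous_on[OF k(1)] sub by (simp add: continuous_on_subset)
        fix x assume "x \<in> frontier (cball \<zeta> t)"
        then have x: "dist \<zeta> x = t" using t sr by (simp add: frontier_cball)
        then have xr: "x \<in> ball \<zeta> r" using t by simp
        have "t - s \<le> norm (x - a)"
          using x as dist_triangle[of \<zeta> x a] by (simp add: dist_norm norm_minus_commute)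
        then have "(t - s) * norm (k x) \<le> norm (x - a) * norm (k x)" by (rule mult_right_mono) simp
        also have "\<dots> \<le> M" using k(2)[OF xr] insert.prems(3)[OF xr] by (simp add: norm_mult)
        finally show "norm (k x) \<le> M / (t - s)" using t by (simp add: field_simps)
      qed (use t in auto)
      then show ?thesis using t by (simp add: field_simps)
    qed
    note bd = this
    have M0: "0 \<le> M" using insert.prems(3)[OF w] norm_ge_zero order_trans by blast
    show ?thesis
    proof (rule ccontr)
      assume "\<not> norm (k w) \<le> M / (r - s)"
      then have lt: "M / (r - s) < norm (k w)" by simp
      then have kp: "0 < norm (k w)" using M0 sr by (meson divide_nonneg_pos diff_gt_0_iff_gt le_less_trans)
      have "M / norm (k w) < r - s" using lt kp sr by (simp add: field_simps)
      then have "max (max s (dist \<zeta> w)) (s + M / norm (k w)) < r" using sr w by simp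
      then obtain t where t: "max (max s (dist \<zeta> w)) (s + M / norm (k w)) < t" "t < r"
        using dense by blast
      then have "M / norm (k w) < t - s" by simp
      then have "M < norm (k w) * (t - s)" using kp by (simp add: field_simps)
      then show False using bd[of t] t by simp
    qed
  qed
  have kz: "k b = 0" if "b \<in> A" for b
  proof -
    have "b \<in> ball \<zeta> r" using that insert.prems(1) sr by auto
    moreover have "b \<noteq> a" using that insert.hyps by blast
    ultimately show ?thesis using k(2)[of b] insert.prems(4)[of b] that by simp
  qed
  have "norm (k z) \<le> M / (r - s) * (2 * s / (r - s)) ^ card A"
    using insert.IH[OF _ k(1) kM kz] insert.prems(1) by simp
  moreover have "norm (z - a) \<le> 2 * s"
    using z as dist_triangle2[of z a \<zeta>] by (simp add: dist_norm norm_minus_commute)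
  ultimately have "norm (z - a) * norm (k z) \<le> 2 * s * (M / (r - s) * (2 * s / (r - s)) ^ card A)"
    using sr by (intro mult_mono) auto
  moreover have "h z = (z - a) * k z" using k(2) z sr by simp
  ultimately have "norm (h z) \<le> 2 * s * (M / (r - s) * (2 * s / (r - s)) ^ card A)"
    by (simp only: norm_mult)
  also have "\<dots> = M * (2 * s / (r - s)) ^ Suc (card A)"
    by (simp only: power_Suc) simp
  finally show ?case unfolding card_insert_disjoint[OF insert.hyps] .
qed

context expanding_disc_map
begin

definition unit_size_germ :: "complex \<Rightarrow> real \<Rightarrow> real \<Rightarrow> (complex \<Rightarrow> complex) \<Rightarrow> bool" where
  "unit_size_germ \<zeta> r d A \<longleftrightarrow> A holomorphic_on ball \<zeta> r \<and>
     (\<forall>z\<in>ball \<zeta> r. norm (A z) \<le> 2) \<and> (\<forall>z\<in>ball \<zeta> (r / 2). d \<le> norm (deriv A z))"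

text \<open>
  The branch \<open>R ^^ l\<close> shrinks the ball about \<open>\<zeta>\<close> so much that \<open>e\<close> is nearly affine on its image, and the
  iterates of \<open>F\<close> expand it to definite size again.  By Cauchy's estimate closeness to an affine map yields
  the lower bound for the derivative.
\<close>

lemma renormalised_word:
  assumes r: "0 < r" "r \<le> 1/4" and \<zeta>: "norm \<zeta> = 1"
    and R: "R holomorphic_on ball \<zeta> r" "\<sigma> \<noteq> 0" "norm \<sigma> < 1"
      "\<And>l z. z \<in> ball \<zeta> r \<Longrightarrow> (R ^^ l) z \<in> ball \<zeta> r"
      "\<And>l z. z \<in> ball \<zeta> r \<Longrightarrow> norm ((R ^^ l) z - \<zeta> - \<sigma> ^ l * (z - \<zeta>)) \<le> r / 16 * norm (\<sigma> ^ l)"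
    and Rhol: "\<And>l. (R ^^ l) holomorphic_on ball \<zeta> r"
    and c0: "0 < c0" and d: "0 < d"
    and forward: "magnifies \<zeta> r c0 d"
    and e: "reflected_disc_map \<tau>' e" "\<And>z. norm z < 1 \<Longrightarrow> norm (e z) < 1"
  shows "\<exists>l0. \<forall>l\<ge>l0. \<exists>n. unit_size_germ \<zeta> r (d / 4) (\<lambda>z. (F ^^ n) (e ((R ^^ l) z)))"
proof -
  have \<tau>': "0 < \<tau>'" and hole: "e holomorphic_on ball 0 (1 + \<tau>')" and e\<zeta>: "norm (e \<zeta>) = 1"
    using e(1) \<zeta> by (auto simp: reflected_disc_map_def)
  define a where "a = deriv e \<zeta>"
  have a: "a \<noteq> 0" unfolding a_def by (rule reflected_disc_map_deriv_nonzero[OF e \<zeta>])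
  have "cball 0 (1 + \<tau>' / 2) \<subseteq> ball (0::complex) (1 + \<tau>')" using \<tau>' by auto
  then obtain K where K: "0 \<le> K"
    "\<And>u v. u \<in> cball 0 (1 + \<tau>' / 2) \<Longrightarrow> v \<in> cball 0 (1 + \<tau>' / 2) \<Longrightarrow>
       norm (e u - e v - deriv e v * (u - v)) \<le> K * (norm (u - v))\<^sup>2"
    using quadratic_approximation[OF hole open_ball compact_cball convex_cball] by metis
  define \<delta> where "\<delta> = min (\<tau>' / (4 * r)) (min (norm a / (64 * (K + 1))) (c0 / norm a))"
  have \<delta>: "0 < \<delta>" using \<tau>' r a K c0 by (simp add: \<delta>_def)
  obtain l0 where l0: "norm \<sigma> ^ l0 < \<delta>" using real_arch_pow_inv[OF \<delta> R(3)] by blast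
  have "\<exists>n. unit_size_germ \<zeta> r (d / 4) (\<lambda>z. (F ^^ n) (e ((R ^^ l) z)))" if l: "l0 \<le> l" for l
  proof -
    have "norm \<sigma> ^ l \<le> norm \<sigma> ^ l0" using l R(3) by (intro power_decreasing) auto
    then have sl: "norm (\<sigma> ^ l) \<le> \<delta>" using l0 by (simp add: norm_power)
    have s0: "0 < norm (\<sigma> ^ l)" using R(2) by simp
    have s1: "norm (\<sigma> ^ l) \<le> \<tau>' / (4 * r)" and s2: "norm (\<sigma> ^ l) \<le> norm a / (64 * (K + 1))"
      and s3: "norm (\<sigma> ^ l) \<le> c0 / norm a"
      using sl by (auto simp: \<delta>_def)
    have r16: "r / 16 \<le> r" using r by simp
    have zr: "norm (z - \<zeta>) \<le> r" if "z \<in> ball \<zeta> r" for z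
      using that by (simp add: dist_norm norm_minus_commute)
    have dom: "(R ^^ l) z \<in> cball 0 (1 + \<tau>' / 2)" if z: "z \<in> ball \<zeta> r" for z
    proof -
      have "norm ((R ^^ l) z - \<zeta>) \<le> 2 * r * norm (\<sigma> ^ l)"
        using near_affine_norm[OF R(5)[OF z] zr[OF z]] r by simp
      also have "\<dots> \<le> 2 * r * (\<tau>' / (4 * r))" using s1 r by (intro mult_left_mono) auto
      also have "\<dots> = \<tau>' / 2" using r by simp
      finally show ?thesis using norm_triangle_ineq2[of "(R ^^ l) z" \<zeta>] \<zeta> by simp
    qed
    have "e \<circ> (R ^^ l) holomorphic_on ball \<zeta> r"
      by (rule holomorphic_on_compose_gen[OF Rhol hole]) (use dom \<tau>' in force)
    then have holE: "(\<lambda>z. e ((R ^^ l) z)) holomorphic_on ball \<zeta> r" by (simp add: o_def)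
    have E: "norm (e ((R ^^ l) z) - e \<zeta> - (a * \<sigma> ^ l) * (z - \<zeta>)) \<le> r / 8 * norm (a * \<sigma> ^ l)"
      if z: "z \<in> ball \<zeta> r" for z
    proof -
      have "norm (e ((R ^^ l) z) - e \<zeta> - a * ((R ^^ l) z - \<zeta>)) \<le> K * (norm ((R ^^ l) z - \<zeta>))\<^sup>2"
        unfolding a_def by (rule K(2)[OF dom[OF z]]) (use \<zeta> \<tau>' in simp)
      then have "norm (e ((R ^^ l) z) - e \<zeta> - a * \<sigma> ^ l * (z - \<zeta>))
          \<le> norm a * (r / 16) * norm (\<sigma> ^ l) + 4 * K * r\<^sup>2 * (norm (\<sigma> ^ l))\<^sup>2"
        by (rule near_affine_step[OF R(5)[OF z] zr[OF z] r16 _ K(1)])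
      also have "4 * K * r\<^sup>2 * (norm (\<sigma> ^ l))\<^sup>2 \<le> norm a * (r / 16) * norm (\<sigma> ^ l)"
      proof -
        have "4 * K * norm (\<sigma> ^ l) \<le> 4 * K * (norm a / (64 * (K + 1)))"
          using s2 K by (intro mult_left_mono) auto
        also have "\<dots> \<le> norm a / 16" using K by (simp add: field_simps)
        finally have "(4 * K * norm (\<sigma> ^ l)) * (r\<^sup>2 * norm (\<sigma> ^ l)) \<le> norm a / 16 * (r * norm (\<sigma> ^ l))"
          using r by (intro mult_mono) (auto simp: power2_eq_square)
        then show ?thesis by (simp add: power2_eq_square algebra_simps)
      qed
      finally show ?thesis by (simp add: norm_mult algebra_simps)
    qed
    have "norm (a * \<sigma> ^ l) \<le> c0" using s3 a by (simp add: norm_mult field_simps)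
    moreover have "a * \<sigma> ^ l \<noteq> 0" using a R(2) by simp
    ultimately obtain n D where nD: "d \<le> norm D"
      "(\<lambda>z. (F ^^ n) (e ((R ^^ l) z))) holomorphic_on ball \<zeta> r"
      "\<And>z. z \<in> ball \<zeta> r \<Longrightarrow> norm ((F ^^ n) (e ((R ^^ l) z))) \<le> 2"
      "\<And>z. z \<in> ball \<zeta> r \<Longrightarrow>
         norm ((F ^^ n) (e ((R ^^ l) z)) - (F ^^ n) (e \<zeta>) - D * (z - \<zeta>)) \<le> 3 / 16 * r * norm D"
      using forward[unfolded magnifies_def, rule_format, OF e\<zeta> holE _ _ E] by blast
    define A where "A z = (F ^^ n) (e ((R ^^ l) z))" for z
    have holA: "A holomorphic_on ball \<zeta> r" using nD(2) by (simp add: A_def[abs_def])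
    have "d / 4 \<le> norm (deriv A z)" if z: "z \<in> ball \<zeta> (r / 2)" for z
    proof -
      define g where "g z = A z - (F ^^ n) (e \<zeta>) - D * (z - \<zeta>)" for z
      have holg: "g holomorphic_on ball \<zeta> r" unfolding g_def by (intro holomorphic_intros holA)
      have sub: "cball z (r / 4) \<subseteq> ball \<zeta> r"
      proof
        fix w assume "w \<in> cball z (r / 4)"
        then show "w \<in> ball \<zeta> r" using z dist_triangle[of \<zeta> w z] r by simp
      qed
      have "norm ((deriv ^^ 1) g z) \<le> fact 1 * (3 / 16 * r * norm D) / (r / 4) ^ 1"
      proof (rule Cauchy_inequality)
        show "g holomorphic_on ball z (r / 4)"
          by (rule holomorphic_on_subset[OF holg]) (use sub ball_subset_cball in blast)
        show "continuous_on (cball z (r / 4)) g"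
          by (rule continuous_on_subset[OF holomorphic_on_imp_continuous_on[OF holg] sub])
        show "norm (g x) \<le> 3 / 16 * r * norm D" if "norm (z - x) = r / 4" for x
        proof -
          have "x \<in> ball \<zeta> r" using that sub by (auto simp: dist_norm)
          then show ?thesis using nD(4) by (simp add: g_def A_def)
        qed
      qed (use r in simp)
      then have g': "norm (deriv g z) \<le> 3 / 4 * norm D" using r by simp
      have zin: "z \<in> ball \<zeta> r" using z r by auto
      have "(A has_field_derivative deriv A z) (at z)"
        using holomorphic_derivI[OF holA open_ball zin] by blast
      then have "(g has_field_derivative (deriv A z - D)) (at z)"
        unfolding g_def by (auto intro!: derivative_eq_intros)
      then have "deriv g z = deriv A z - D" by (rule DERIV_imp_deriv)
      then have "norm D \<le> norm (deriv A z) + 3 / 4 * norm D"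
        using g' norm_triangle_ineq2[of D "D - deriv A z"] by (simp add: norm_minus_commute)
      then show ?thesis using nD(1) by simp
    qed
    then show ?thesis using nD(2,3) unfolding A_def unit_size_germ_def by blast
  qed
  then show ?thesis by blast
qed

text \<open>
  Here \<open>q k\<close> is the orbit under \<open>R\<close> of a point of \<open>prezeros\<close>, and \<open>fam\<close> collects the properties of
  renormalised words that are used.  Members of \<open>fam\<close> that agree on the finitely many points \<open>q k\<close>,
  \<open>k0 \<le> k < k0 + N0\<close>, are equal (\<open>rigid\<close>), and there are only finitely many possible values at these points
  (\<open>V\<close>).  The bound \<open>M\<close> is the number of admissible tuples of values.  A common depth \<open>l\<close> is used for all
  words, so that equality of two renormalised words is an equality of maps near a point of the disc and
  \<open>R ^^ l\<close> can be dropped.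
\<close>

theorem finitely_many_germ_classes:
  "\<exists>M::nat. \<forall>e. (\<forall>i\<le>M. (\<exists>\<tau>'. reflected_disc_map \<tau>' (e i)) \<and> (\<forall>z. norm z < 1 \<longrightarrow> norm (e i z) < 1) \<and>
       (\<forall>z\<in>prezeros. e i z \<in> prezeros)) \<longrightarrow>
     (\<exists>i j n n'. i < j \<and> j \<le> M \<and> (\<forall>z. norm z < 1 \<longrightarrow> (F ^^ n) (e i z) = (F ^^ n') (e j z)))"
proof -
  obtain \<zeta> r0 R P \<theta> p where cyc: "norm \<zeta> = 1" "0 < r0" "R holomorphic_on ball \<zeta> r0" "R \<zeta> = \<zeta>"
    "0 \<le> \<theta>" "\<theta> < 1"
    "\<And>w. w \<in> ball \<zeta> r0 \<Longrightarrow> norm (R w - \<zeta>) \<le> \<theta> * norm (w - \<zeta>)"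
    "\<And>w. w \<in> ball \<zeta> r0 \<Longrightarrow> (F ^^ P) (R w) = w"
    "\<And>w. w \<in> ball \<zeta> r0 \<Longrightarrow> norm w < 1 \<Longrightarrow> norm (R w) < 1"
    "p \<in> prezeros" "p \<in> ball \<zeta> r0"
    by (rule repelling_cycle) blast
  have injR: "inj_on R (ball \<zeta> r0)" using cyc(8) by (metis inj_onI)
  define \<sigma> where "\<sigma> = deriv R \<zeta>"
  have \<sigma>0: "\<sigma> \<noteq> 0" unfolding \<sigma>_def
    using holomorphic_injective_imp_regular[OF cyc(3) open_ball injR] cyc(2) by simp
  obtain r where r: "0 < r" "r \<le> r0" "r \<le> 1/4" "norm \<sigma> < 1"
    "\<And>l z. z \<in> ball \<zeta> r \<Longrightarrow> (R ^^ l) z \<in> ball \<zeta> r"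
    "\<And>l z. z \<in> ball \<zeta> r \<Longrightarrow> norm ((R ^^ l) z - \<zeta> - \<sigma> ^ l * (z - \<zeta>)) \<le> r / 16 * norm (\<sigma> ^ l)"
    unfolding \<sigma>_def
    by (rule attracting_iterates_near_affine[OF cyc(3,2,4,6,7) \<sigma>0[unfolded \<sigma>_def]]) blast+
  have subr: "ball \<zeta> r \<subseteq> ball \<zeta> r0" using r by auto
  have holRr: "R holomorphic_on ball \<zeta> r" by (rule holomorphic_on_subset[OF cyc(3) subr])
  have Rhol: "(R ^^ l) holomorphic_on ball \<zeta> r" for l
  proof (induction l)
    case (Suc l)
    have "R \<circ> (R ^^ l) holomorphic_on ball \<zeta> r"
      by (rule holomorphic_on_compose_gen[OF Suc holRr]) (use r(5) in blast)
    then show ?case by (simp add: o_def)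
  qed (simp add: id_def)
  have Rinj: "inj_on (R ^^ l) (ball \<zeta> r)" for l
  proof (induction l)
    case (Suc l)
    show ?case
    proof (rule inj_onI)
      fix u v assume uv: "u \<in> ball \<zeta> r" "v \<in> ball \<zeta> r" "(R ^^ Suc l) u = (R ^^ Suc l) v"
      have "(R ^^ l) u \<in> ball \<zeta> r0" "(R ^^ l) v \<in> ball \<zeta> r0"
        using r(5)[OF uv(1), of l] r(5)[OF uv(2), of l] subr by blast+
      then have "(R ^^ l) u = (R ^^ l) v" using injR uv(3) by (simp add: inj_on_def)
      then show "u = v" using Suc uv by (simp add: inj_on_def)
    qed
  qed simp
  have Rdisc: "norm ((R ^^ l) z) < 1" if z: "z \<in> ball \<zeta> r" "norm z < 1" for l z
  proof (induction l)
    case (Suc l)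
    have "(R ^^ l) z \<in> ball \<zeta> r0" using r(5)[OF z(1), of l] subr by blast
    then show ?case using cyc(9) Suc by simp
  qed (use z in simp)
  obtain c0 d where c0: "0 < c0" "0 < d" "magnifies \<zeta> r c0 d"
    by (rule forward_iterates_near_affine[OF r(1,3), of \<zeta>]) blast
  define q where "q k = (R ^^ k) p" for k
  have q: "q k \<in> ball \<zeta> r0 \<and> q k \<in> prezeros \<and> norm (q k - \<zeta>) \<le> \<theta> ^ k * r0" for k
  proof (induction k)
    case 0
    then show ?case using cyc(10,11) by (simp add: q_def dist_norm norm_minus_commute)
  next
    case (Suc k)
    have RS: "q (Suc k) = R (q k)" by (simp add: q_def)
    have 1: "norm (q (Suc k) - \<zeta>) \<le> \<theta> * norm (q k - \<zeta>)" unfolding RS using cyc(7) Suc by blast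
    also have "\<dots> \<le> \<theta> * (\<theta> ^ k * r0)" using Suc cyc(5) by (intro mult_left_mono) auto
    finally have 2: "norm (q (Suc k) - \<zeta>) \<le> \<theta> ^ Suc k * r0" by simp
    have "\<theta> * norm (q k - \<zeta>) \<le> 1 * norm (q k - \<zeta>)" using cyc(6) by (intro mult_right_mono) auto
    also have "\<dots> < r0" using Suc by (simp add: dist_norm norm_minus_commute)
    finally have "q (Suc k) \<in> ball \<zeta> r0" using 1 by (simp add: dist_norm norm_minus_commute)
    moreover have "norm (R (q k)) < 1" using cyc(9) Suc by (simp add: prezeros_def)
    then have "q (Suc k) \<in> prezeros"
      unfolding RS by (rule prezeros_backward[of _ P]) (use cyc(8) Suc in simp)
    ultimately show ?case using 2 by blast
  qed
  have q1: "norm (q k) < 1" for k using q[of k] by (simp add: prezeros_def)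
  have qinj: "inj q"
  proof -
    have dec: "norm (q (Suc k) - \<zeta>) < norm (q k - \<zeta>)" for k
    proof -
      have "q k \<noteq> \<zeta>" using q1[of k] cyc(1) by auto
      then have pos: "0 < norm (q k - \<zeta>)" by simp
      have "q (Suc k) = R (q k)" by (simp add: q_def)
      then have "norm (q (Suc k) - \<zeta>) \<le> \<theta> * norm (q k - \<zeta>)" using cyc(7) q by metis
      also have "\<dots> < 1 * norm (q k - \<zeta>)" using cyc(6) pos by (intro mult_strict_right_mono) auto
      finally show ?thesis by simp
    qed
    have "norm (q j - \<zeta>) < norm (q i - \<zeta>)" if "i < j" for i j
      using lift_Suc_mono_less[of "\<lambda>k. - norm (q k - \<zeta>)" i j] dec that by simp
    then show ?thesis by (metis injI less_irrefl linorder_neqE_nat)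
  qed
  obtain \<Lambda> where \<Lambda>: "1 \<le> \<Lambda>" "\<And>z. norm z < 1 \<Longrightarrow> 1 - norm (F z) \<le> \<Lambda> * (1 - norm z)"
    by (rule boundary_distance_lipschitz) blast
  define Q where "Q = \<Lambda> ^ P"
  have Q: "1 \<le> Q" using \<Lambda> by (simp add: Q_def)
  have \<Lambda>it: "1 - norm ((F ^^ m) z) \<le> \<Lambda> ^ m * (1 - norm z)" if "norm z < 1" for m z
  proof (induction m)
    case (Suc m)
    have "1 - norm (F ((F ^^ m) z)) \<le> \<Lambda> * (1 - norm ((F ^^ m) z))" using \<Lambda>(2) iterate_disc that by blast
    also have "\<dots> \<le> \<Lambda> * (\<Lambda> ^ m * (1 - norm z))" using Suc \<Lambda>(1) by (intro mult_left_mono) auto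
    finally show ?case by (simp add: mult.assoc)
  qed simp
  define a where "a = 1 - norm p"
  have a: "0 < a" using cyc(10) by (simp add: a_def prezeros_def)
  have depth: "a / Q ^ k \<le> 1 - norm (q k)" for k
  proof (induction k)
    case (Suc k)
    have "(F ^^ P) (q (Suc k)) = q k" using cyc(8) q[of k] by (simp add: q_def)
    then have "1 - norm (q k) \<le> Q * (1 - norm (q (Suc k)))"
      using \<Lambda>it[OF q1[of "Suc k"], of P] by (simp add: Q_def)
    then have "a / Q ^ k \<le> Q * (1 - norm (q (Suc k)))" using Suc by simp
    then show ?case using Q by (simp add: field_simps)
  qed (simp add: a_def q_def)
  obtain Q' where Q': "1 \<le> Q'"
    "\<And>a. 0 < a \<Longrightarrow> \<exists>\<eta>>0. \<forall>k x y. x \<in> prezeros \<longrightarrow> y \<in> prezeros \<longrightarrow> x \<noteq> y \<longrightarrow>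
        a / Q ^ k \<le> 1 - norm x \<longrightarrow> \<eta> / Q' ^ k \<le> norm (x - y)"
    by (rule prezeros_separated_by_depth[OF Q]) blast
  define a' where "a' = a * d / 8"
  have a': "0 < a'" using a c0 by (simp add: a'_def)
  then obtain \<eta> where \<eta>: "0 < \<eta>" "\<And>k x y. x \<in> prezeros \<Longrightarrow> y \<in> prezeros \<Longrightarrow> x \<noteq> y \<Longrightarrow>
        a' / Q ^ k \<le> 1 - norm x \<Longrightarrow> \<eta> / Q' ^ k \<le> norm (x - y)"
    using Q'(2) by blast
  \<comment> \<open>The zeros have to be confined to a ball so small that each of them gains a factor \<open>1 / (2 * Q')\<close>,
    which beats the loss \<open>1 / Q'\<close> in separation from one \<open>q k\<close> to the next.\<close>
  define s where "s = r / (8 * Q')"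
  have s: "0 < s" "s \<le> r / 8" using r(1) Q'(1) by (auto simp: s_def field_simps)
  define \<omega> where "\<omega> = 2 * s / (r - s)"
  have \<omega>: "0 \<le> \<omega>" "\<omega> * Q' \<le> 1 / 2"
  proof -
    show "0 \<le> \<omega>" using s by (simp add: \<omega>_def)
    have "\<omega> \<le> 2 * s / (r / 2)" unfolding \<omega>_def using s r(1) by (intro divide_left_mono) auto
    also have "\<dots> = 1 / (2 * Q')" using r(1) by (simp add: s_def)
    finally show "\<omega> * Q' \<le> 1 / 2" using Q'(1) by (simp add: field_simps)
  qed
  have srr: "ball \<zeta> s \<subseteq> ball \<zeta> (r / 2)" "ball \<zeta> s \<subseteq> ball \<zeta> r" using s r(1) by auto
  obtain k0 where k0: "\<And>k. k0 \<le> k \<Longrightarrow> q k \<in> ball \<zeta> s"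
  proof -
    obtain k0 where "\<theta> ^ k0 < s / r0" using real_arch_pow_inv[of "s / r0" \<theta>] cyc s by auto
    moreover have "\<theta> ^ k \<le> \<theta> ^ k0" if "k0 \<le> k" for k using that cyc by (intro power_decreasing) auto
    ultimately have "\<theta> ^ k * r0 < s" if "k0 \<le> k" for k
      using that cyc(2) by (metis less_divide_eq le_less_trans)
    then have "norm (q k - \<zeta>) < s" if "k0 \<le> k" for k using that q[of k] by force
    then show ?thesis using that[of k0] by (simp add: dist_norm norm_minus_commute)
  qed
  obtain N0 where N0: "(1 / 2) ^ N0 < \<eta> / (4 * Q' ^ k0)"
    using real_arch_pow_inv[of "\<eta> / (4 * Q' ^ k0)" "1 / 2"] \<eta>(1) Q'(1) by auto
  define fam where "fam A \<longleftrightarrow> unit_size_germ \<zeta> r (d / 4) A \<and>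
     (\<forall>z\<in>ball \<zeta> r. norm z < 1 \<longrightarrow> norm (A z) < 1) \<and> (\<forall>k\<ge>k0. A (q k) \<in> prezeros)" for A
  \<comment> \<open>The derivative bound keeps \<open>A (q k)\<close> away from the circle, by \<open>schwarz_pick_deriv\<close> on the largest
    ball about \<open>q k\<close> in the disc.\<close>
  have fam_depth: "a' / Q ^ k \<le> 1 - norm (A (q k))" if A: "fam A" and k: "k0 \<le> k" for A k
  proof -
    let ?t = "1 - norm (q k)"
    have qk: "q k \<in> ball \<zeta> (r / 2)" using k0[OF k] srr by blast
    have t: "0 < ?t" using q1 by simp
    have tle: "?t < r / 2"
      using qk norm_triangle_ineq2[of \<zeta> "q k"] cyc(1) by (simp add: dist_norm)
    have inr: "w \<in> ball \<zeta> r \<and> norm w < 1" if w: "w \<in> ball (q k) ?t" for w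
    proof
      show "w \<in> ball \<zeta> r" using w qk tle dist_triangle[of \<zeta> w "q k"] by simp
      show "norm w < 1" using w norm_triangle_ineq2[of w "q k"] by (simp add: dist_norm norm_minus_commute)
    qed
    have "?t * norm (deriv A (q k)) \<le> 2 * (1 - norm (A (q k)))"
    proof (rule schwarz_pick_deriv[OF _ t])
      show "A holomorphic_on ball (q k) ?t"
        using A inr unfolding fam_def unit_size_germ_def by (meson holomorphic_on_subset subsetI)
      show "norm (A w) < 1" if "w \<in> ball (q k) ?t" for w
        using A inr[OF that] unfolding fam_def unit_size_germ_def by blast
    qed
    moreover have "?t * (d / 4) \<le> ?t * norm (deriv A (q k))"
      using A qk t unfolding fam_def unit_size_germ_def by (intro mult_left_mono) auto
    moreover have "a / Q ^ k * (d / 4) \<le> ?t * (d / 4)"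
      using depth[of k] c0(2) by (intro mult_right_mono) auto
    ultimately have "a / Q ^ k * (d / 4) \<le> 2 * (1 - norm (A (q k)))" by linarith
    then show ?thesis by (simp add: a'_def)
  qed
  have rigid: "A z = B z"
    if A: "fam A" and B: "fam B" and eq: "\<And>k. k0 \<le> k \<Longrightarrow> k < k0 + N0 \<Longrightarrow> A (q k) = B (q k)"
      and z: "z \<in> ball \<zeta> r" for A B z
  proof -
    have hol: "(\<lambda>z. A z - B z) holomorphic_on ball \<zeta> r"
      using A B unfolding fam_def unit_size_germ_def by (intro holomorphic_intros) auto
    have bd: "norm (A z - B z) \<le> 4" if "z \<in> ball \<zeta> r" for z
      using A B that norm_triangle_ineq4[of "A z" "B z"] unfolding fam_def unit_size_germ_def by fastforce
    \<comment> \<open>If \<open>A\<close> and \<open>B\<close> agree at the first \<open>N \<ge> N0\<close> points, their values at the next one are closer to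
      each other than distinct points of \<open>prezeros\<close> can be.\<close>
    have all: "A (q (k0 + N)) = B (q (k0 + N))" for N
    proof (induction N rule: less_induct)
      case (less N)
      show ?case
      proof (cases "N < N0")
        case True
        then show ?thesis using eq by simp
      next
        case False
        let ?Z = "q ` {k0..<k0 + N}"
        have "card ?Z = N" using qinj by (subst card_image) (auto simp: inj_on_def)
        moreover have "norm (A (q (k0 + N)) - B (q (k0 + N))) \<le> 4 * (2 * s / (r - s)) ^ card ?Z"
        proof (rule many_zeros_decay[of ?Z \<zeta> s r "\<lambda>z. A z - B z"])
          show "A x - B x = 0" if x: "x \<in> ?Z" for x
          proof -
            obtain k where "k0 \<le> k" "k < k0 + N" "x = q k" using x by auto
            then show ?thesis using less.IH[of "k - k0"] by simp
          qed
        qed (use k0 s hol bd in auto)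
        ultimately have le: "norm (A (q (k0 + N)) - B (q (k0 + N))) \<le> 4 * \<omega> ^ N" by (simp add: \<omega>_def)
        show ?thesis
        proof (rule ccontr)
          assume "A (q (k0 + N)) \<noteq> B (q (k0 + N))"
          then have "\<eta> / Q' ^ (k0 + N) \<le> norm (A (q (k0 + N)) - B (q (k0 + N)))"
            using A B fam_depth[OF A, of "k0 + N"] unfolding fam_def unit_size_germ_def by (intro \<eta>(2)) auto
          also note le
          finally have "\<eta> \<le> 4 * \<omega> ^ N * Q' ^ (k0 + N)" using Q'(1) by (simp add: divide_le_eq)
          also have "\<dots> = 4 * Q' ^ k0 * (\<omega> * Q') ^ N" by (simp add: power_add power_mult_distrib)
          also have "\<dots> \<le> 4 * Q' ^ k0 * (1 / 2) ^ N"
            using \<omega> Q'(1) by (intro mult_left_mono power_mono) auto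
          also have "\<dots> \<le> 4 * Q' ^ k0 * (1 / 2) ^ N0"
            using False Q'(1) by (intro mult_left_mono power_decreasing) auto
          also have "\<dots> < \<eta>" using N0 Q'(1) by (simp add: field_simps)
          finally show False by simp
        qed
      qed
    qed
    have "A z - B z = 0"
    proof (rule analytic_continuation[OF hol open_ball connected_ball, of "q ` {k0..}" \<zeta>])
      show "q ` {k0..} \<subseteq> ball \<zeta> r" using k0 srr by auto
      show "\<zeta> \<in> ball \<zeta> r" using r by simp
      show "\<zeta> islimpt q ` {k0..}"
      proof -
        have "(\<lambda>k. \<theta> ^ k * r0) \<longlonglongrightarrow> 0 * r0"
          using cyc by (intro tendsto_mult LIMSEQ_power_zero tendsto_const) auto
        then have lim: "(\<lambda>k. \<theta> ^ k * r0) \<longlonglongrightarrow> 0" by simp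
        have "\<forall>k. norm (q k - \<zeta>) \<le> \<theta> ^ k * r0" using q by blast
        then have "(\<lambda>k. q k - \<zeta>) \<longlonglongrightarrow> 0"
          by (rule Lim_null_comparison[OF always_eventually lim])
        then have "q \<longlonglongrightarrow> \<zeta>" by (simp add: LIM_zero_iff)
        then have q_lim: "(\<lambda>k. q (k + k0)) \<longlonglongrightarrow> \<zeta>" by (rule LIMSEQ_ignore_initial_segment)
        have q_in: "q (k + k0) \<in> q ` {k0..} - {\<zeta>}" for k
        proof -
          have "q (k + k0) \<noteq> \<zeta>" using q1[of "k + k0"] cyc(1) by (metis less_irrefl)
          moreover have "q (k + k0) \<in> q ` {k0..}" by (intro imageI) simp
          ultimately show ?thesis by simp
        qed
        show ?thesis unfolding islimpt_sequential
          by (rule exI[of _ "\<lambda>k. q (k + k0)"]) (rule conjI[OF allI[OF q_in] q_lim])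
      qed
      show "A w - B w = 0" if w: "w \<in> q ` {k0..}" for w
      proof -
        obtain k where "k0 \<le> k" "w = q k" using w by auto
        then show ?thesis using all[of "k - k0"] by simp
      qed
    qed (use z in auto)
    then show ?thesis by simp
  qed
  define V where "V k = {z \<in> prezeros. norm z \<le> 1 - a' / Q ^ k}" for k
  define T where "T = {k0..<k0 + N0}"
  have finV: "finite (PiE T V)"
  proof (rule finite_PiE)
    show "finite (V k)" for k unfolding V_def by (rule prezeros_finite) (use a' Q in simp)
  qed (simp add: T_def)
  define M where "M = card (PiE T V)"
  show ?thesis
  proof (rule exI[of _ M], intro allI impI)
    fix e
    assume e: "\<forall>i\<le>M. (\<exists>\<tau>'. reflected_disc_map \<tau>' (e i)) \<and> (\<forall>z. norm z < 1 \<longrightarrow> norm (e i z) < 1) \<and>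
       (\<forall>z\<in>prezeros. e i z \<in> prezeros)"
    have "\<exists>l0. \<forall>l\<ge>l0. \<exists>n. unit_size_germ \<zeta> r (d / 4) (\<lambda>z. (F ^^ n) (e i ((R ^^ l) z)))"
      if i: "i \<le> M" for i
    proof -
      obtain \<tau>' where \<tau>': "reflected_disc_map \<tau>' (e i)" using e i by blast
      have ed: "\<And>z. norm z < 1 \<Longrightarrow> norm (e i z) < 1" using e i by blast
      show ?thesis
        by (rule renormalised_word[of r \<zeta> R \<sigma> c0 d \<tau>' "e i"])
          (fact r cyc holRr \<sigma>0 Rhol c0 \<tau>' ed)+
    qed
    then obtain l0 where l0: "\<And>i l. i \<le> M \<Longrightarrow> l0 i \<le> l \<Longrightarrow>
        \<exists>n. unit_size_germ \<zeta> r (d / 4) (\<lambda>z. (F ^^ n) (e i ((R ^^ l) z)))" by metis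
    define l where "l = (\<Sum>i\<le>M. l0 i)"
    have "l0 i \<le> l" if "i \<le> M" for i unfolding l_def using that by (intro member_le_sum) auto
    then obtain n where n: "\<And>i. i \<le> M \<Longrightarrow>
        unit_size_germ \<zeta> r (d / 4) (\<lambda>z. (F ^^ n i) (e i ((R ^^ l) z)))"
      using l0[of _ l] by metis
    define A where "A i z = (F ^^ n i) (e i ((R ^^ l) z))" for i z
    have famA: "fam (A i)" if i: "i \<le> M" for i
      unfolding fam_def
    proof (intro conjI allI impI ballI)
      show "unit_size_germ \<zeta> r (d / 4) (A i)" using n[OF i] unfolding A_def[abs_def] .
      show "norm (A i z) < 1" if "z \<in> ball \<zeta> r" "norm z < 1" for z
        unfolding A_def using Rdisc[OF that] e i iterate_disc by blast
      fix k assume "k0 \<le> k"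
      have "(R ^^ l) (q k) = q (l + k)" by (simp add: q_def funpow_add)
      then have "(R ^^ l) (q k) \<in> prezeros" using q by simp
      then show "A i (q k) \<in> prezeros" unfolding A_def using e i iterate_prezeros_forward by blast
    qed
    define \<Phi> where "\<Phi> i = restrict (\<lambda>k. A i (q k)) T" for i
    have "\<Phi> ` {..M} \<subseteq> PiE T V"
    proof
      fix x assume "x \<in> \<Phi> ` {..M}"
      then obtain i where i: "i \<le> M" "x = \<Phi> i" by auto
      have "A i (q k) \<in> V k" if "k \<in> T" for k
        using fam_depth[OF famA[OF i(1)], of k] famA[OF i(1)] that by (simp add: V_def T_def fam_def)
      then show "x \<in> PiE T V" unfolding i(2) \<Phi>_def by auto
    qed
    then have "card (\<Phi> ` {..M}) < card {..M}"
      using card_mono[OF finV] by (simp add: M_def less_Suc_eq_le)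
    then obtain i' j' where ij': "i' \<le> M" "j' \<le> M" "i' \<noteq> j'" "\<Phi> i' = \<Phi> j'"
      using pigeonhole[of \<Phi> "{..M}"] unfolding inj_on_def by auto
    define i where "i = min i' j'"
    define j where "j = max i' j'"
    have ij: "i \<le> M" "j \<le> M" "i < j" "\<Phi> i = \<Phi> j"
      using ij' by (auto simp: i_def j_def min_def max_def)
    have eqA: "A i z = A j z" if "z \<in> ball \<zeta> r" for z
    proof (rule rigid[OF famA[OF ij(1)] famA[OF ij(2)] _ that])
      fix k assume "k0 \<le> k" "k < k0 + N0"
      then have "k \<in> T" by (simp add: T_def)
      then show "A i (q k) = A j (q k)" using fun_cong[OF ij(4), of k] by (simp add: \<Phi>_def)
    qed
    have "(F ^^ n i) (e i z) = (F ^^ n j) (e j z)" if z: "norm z < 1" for z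
    proof (rule analytic_continuation_open[of "(R ^^ l) ` (ball \<zeta> r \<inter> ball 0 1)" "ball 0 1"
        "\<lambda>z. (F ^^ n i) (e i z)" "\<lambda>z. (F ^^ n j) (e j z)" z])
      have inj: "inj_on (R ^^ l) (ball \<zeta> r \<inter> ball 0 1)" by (rule inj_on_subset[OF Rinj]) auto
      have "(R ^^ l) holomorphic_on ball \<zeta> r \<inter> ball 0 1"
        by (rule holomorphic_on_subset[OF Rhol]) auto
      then show "open ((R ^^ l) ` (ball \<zeta> r \<inter> ball 0 1))"
        by (rule open_mapping_thm3[OF _ _ inj]) auto
      have "q k0 \<in> ball \<zeta> r \<inter> ball 0 1" using k0[of k0] srr q1 by auto
      then show "(R ^^ l) ` (ball \<zeta> r \<inter> ball 0 1) \<noteq> {}" by blast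
      show "(R ^^ l) ` (ball \<zeta> r \<inter> ball 0 1) \<subseteq> ball 0 1" using Rdisc by auto
      have hol: "(\<lambda>z. (F ^^ m) (e i z)) holomorphic_on ball 0 1" if i: "i \<le> M" for i m
      proof -
        obtain \<tau>' where "0 < \<tau>'" "e i holomorphic_on ball 0 (1 + \<tau>')"
          using e i by (auto simp: reflected_disc_map_def)
        then have "e i holomorphic_on ball 0 1" by (elim holomorphic_on_subset) auto
        then have "(F ^^ m) \<circ> e i holomorphic_on ball 0 1"
          by (rule holomorphic_on_compose_gen[OF _ iterate_hol_disc]) (use e i in auto)
        then show ?thesis by (simp add: o_def)
      qed
      show "(\<lambda>z. (F ^^ n i) (e i z)) holomorphic_on ball 0 1"
        "(\<lambda>z. (F ^^ n j) (e j z)) holomorphic_on ball 0 1" using hol ij by auto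
      show "(F ^^ n i) (e i w) = (F ^^ n j) (e j w)" if "w \<in> (R ^^ l) ` (ball \<zeta> r \<inter> ball 0 1)" for w
        using that eqA by (auto simp: A_def)
    qed (use z in auto)
    then show "\<exists>i j n n'. i < j \<and> j \<le> M \<and> (\<forall>z. norm z < 1 \<longrightarrow> (F ^^ n) (e i z) = (F ^^ n') (e j z))"
      using ij by blast
  qed
qed

end

section \<open>Bounded invariant Fatou components\<close>

lemma holomorphic_funpow:
  fixes f :: "complex \<Rightarrow> complex"
  assumes "f holomorphic_on UNIV" shows "(f ^^ n) holomorphic_on UNIV"
proof (induction n)
  case (Suc n)
  have "f \<circ> (f ^^ n) holomorphic_on UNIV"
    by (rule holomorphic_on_compose_gen[OF Suc assms]) auto
  then show ?case by (simp add: o_def)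
qed (simp add: id_def)

lemma funpow_image_subset: "f ` D \<subseteq> D \<Longrightarrow> (f ^^ n) ` D \<subseteq> D"
  by (induction n) auto

text \<open>
  Montel's theorem.
\<close>

lemma bounded_iterates_normal:
  assumes f: "f holomorphic_on UNIV" and U: "open U"
    and bd: "\<And>n z. z \<in> U \<Longrightarrow> norm ((f ^^ n) z) \<le> M"
  shows "normal_family U (range (\<lambda>n. f ^^ n))"
  unfolding normal_family_def
proof (intro allI impI)
  fix h :: "nat \<Rightarrow> complex \<Rightarrow> complex" assume h: "range h \<subseteq> range (\<lambda>n. f ^^ n)"
  obtain l s where "l holomorphic_on U" "strict_mono (s :: nat \<Rightarrow> nat)"
      "\<And>K. \<lbrakk>compact K; K \<subseteq> U\<rbrakk> \<Longrightarrow> uniform_limit K (h \<circ> s) l sequentially"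
  proof (rule Montel[OF U _ _ h])
    show "k holomorphic_on U" if "k \<in> range (\<lambda>n. f ^^ n)" for k
      using that holomorphic_funpow[OF f] holomorphic_on_subset by blast
    show "\<exists>B. \<forall>k\<in>range (\<lambda>n. f ^^ n). \<forall>z\<in>K. norm (k z) \<le> B" if "compact K" "K \<subseteq> U" for K
      using bd that by blast
  qed blast
  then show "\<exists>s. strict_mono s \<and>
           ((\<exists>l. \<forall>K. compact K \<and> K \<subseteq> U \<longrightarrow> uniform_limit K (\<lambda>n. h (s n)) l sequentially) \<or>
            (\<forall>K. compact K \<and> K \<subseteq> U \<longrightarrow>
               (\<forall>B. \<forall>\<^sub>F n in sequentially. \<forall>z\<in>K. B < norm (h (s n) z))))"
    unfolding o_def by blast
qed

lemma open_fatou_set: "open (fatou_set f)"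
proof -
  have "\<exists>T. open T \<and> z \<in> T \<and> T \<subseteq> fatou_set f" if "z \<in> fatou_set f" for z
    using that unfolding fatou_set_def by blast
  then show ?thesis by (subst open_subopen) blast
qed

text \<open>
  This will show that boundary points cannot be mapped into \<open>D\<close> and that loops in \<open>D\<close> enclose no other
  points.
\<close>

lemma component_absorbs_bounded_orbits:
  assumes f: "f holomorphic_on UNIV" and D: "D \<in> components (fatou_set f)"
    and U: "open U" "connected U" "D \<inter> U \<noteq> {}"
    and bd: "\<And>n z. z \<in> U \<Longrightarrow> norm ((f ^^ n) z) \<le> M"
  shows "U \<subseteq> D"
proof (rule components_maximal[OF D U(2) _ U(3)])
  show "U \<subseteq> fatou_set f"
    unfolding fatou_set_def using bounded_iterates_normal[OF f U(1) bd] U by blast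
qed

definition proper_self_map :: "complex set \<Rightarrow> (complex \<Rightarrow> complex) \<Rightarrow> bool" where
  "proper_self_map D h \<longleftrightarrow> h holomorphic_on UNIV \<and> h ` D \<subseteq> D \<and>
     (\<forall>K. compact K \<and> K \<subseteq> D \<longrightarrow> compact (D \<inter> h -` K))"

lemma proper_self_map_comp:
  assumes "proper_self_map D h" "proper_self_map D k" shows "proper_self_map D (h \<circ> k)"
  unfolding proper_self_map_def
proof (intro conjI allI impI)
  show "h \<circ> k holomorphic_on UNIV"
    using assms unfolding proper_self_map_def by (intro holomorphic_on_compose_gen[of _ UNIV _ UNIV]) auto
  show "(h \<circ> k) ` D \<subseteq> D" using assms unfolding proper_self_map_def by (auto simp: image_subset_iff)
  fix K assume K: "compact K \<and> K \<subseteq> D"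
  then have "compact (D \<inter> h -` K)" using assms(1) unfolding proper_self_map_def by blast
  then have "compact (D \<inter> k -` (D \<inter> h -` K))" using assms(2) unfolding proper_self_map_def by blast
  moreover have "D \<inter> k -` (D \<inter> h -` K) = D \<inter> (h \<circ> k) -` K"
    using assms(2) unfolding proper_self_map_def by (auto simp: image_subset_iff)
  ultimately show "compact (D \<inter> (h \<circ> k) -` K)" by simp
qed

lemma proper_self_map_funpow:
  assumes "proper_self_map D h" shows "proper_self_map D (h ^^ n)"
proof (induction n)
  case 0
  have "D \<inter> (h ^^ 0) -` K = K" if "K \<subseteq> D" for K using that by auto
  then show ?case unfolding proper_self_map_def by (simp add: id_def image_subset_iff)
next
  case (Suc n)
  show ?case unfolding funpow.simps by (rule proper_self_map_comp[OF assms Suc])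
qed

text \<open>
  If a boundary point \<open>z\<close> were mapped into \<open>D\<close>, a ball about \<open>z\<close> would be mapped into the bounded invariant
  set \<open>D\<close>, all orbits of the ball would be bounded, and the ball would belong to \<open>D\<close>.
\<close>

lemma invariant_component_proper:
  assumes f: "f holomorphic_on UNIV" and D: "D \<in> components (fatou_set f)"
    and inv: "f ` D \<subseteq> D" and bd: "bounded D"
  shows "proper_self_map D f"
  unfolding proper_self_map_def
proof (intro conjI allI impI)
  fix K assume K: "compact K \<and> K \<subseteq> D"
  have oD: "open D" using open_components[OF open_fatou_set D] .
  have contf: "continuous_on UNIV f" using f holomorphic_on_imp_continuous_on by blast
  obtain M where M: "\<And>z. z \<in> D \<Longrightarrow> norm z \<le> M" using bd unfolding bounded_iff by blast
  have "D \<inter> f -` K = closure D \<inter> f -` K"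
  proof
    show "closure D \<inter> f -` K \<subseteq> D \<inter> f -` K"
    proof
      fix z assume z: "z \<in> closure D \<inter> f -` K"
      have "open (f -` D)" using contf oD by (simp add: continuous_on_open_vimage)
      moreover have "z \<in> f -` D" using z K by auto
      ultimately obtain r where r: "r > 0" "ball z r \<subseteq> f -` D" by (meson openE)
      have "ball z r \<subseteq> D"
      proof (rule component_absorbs_bounded_orbits[OF f D open_ball connected_ball])
        obtain y where "y \<in> D" "dist y z < r" using z r(1) by (auto simp: closure_approachable)
        then have "y \<in> D \<inter> ball z r" by (simp add: dist_commute)
        then show "D \<inter> ball z r \<noteq> {}" by blast
        show "norm ((f ^^ n) w) \<le> max M (norm z + r)" if w: "w \<in> ball z r" for n w
        proof (cases n)
          case 0
          have "norm w \<le> norm z + r"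
            using w norm_triangle_ineq2[of w z] by (simp add: dist_norm norm_minus_commute)
          then show ?thesis using 0 by simp
        next
          case (Suc m)
          have "(f ^^ n) w = (f ^^ m) (f w)" by (simp add: Suc funpow_swap1)
          moreover have "(f ^^ m) (f w) \<in> D"
          proof -
            have "f w \<in> D" using w r(2) by blast
            then show ?thesis using funpow_image_subset[OF inv, of m] by blast
          qed
          ultimately show ?thesis using M by (simp add: le_max_iff_disj)
        qed
      qed
      then show "z \<in> D \<inter> f -` K" using z r(1) by auto
    qed
  qed (use closure_subset in auto)
  moreover have "compact (closure D \<inter> f -` K)"
  proof (rule compact_Int_closed)
    show "compact (closure D)" using bd by simp
    show "closed (f -` K)" using contf K by (simp add: compact_imp_closed continuous_on_closed_vimage)
  qed
  ultimately show "compact (D \<inter> f -` K)" by simp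
qed (use f inv in auto)

text \<open>
  The iterates are bounded on a loop in \<open>D\<close>, so by the maximum principle they are bounded inside the loop;
  hence the inside belongs to \<open>D\<close> as well.
\<close>

lemma bounded_component_simply_connected:
  assumes f: "f holomorphic_on UNIV" and D: "D \<in> components (fatou_set f)"
    and inv: "f ` D \<subseteq> D" and bd: "bounded D"
  shows "simply_connected D"
proof -
  have oD: "open D" using open_components[OF open_fatou_set D] .
  obtain M where M: "\<And>z. z \<in> D \<Longrightarrow> norm z \<le> M" using bd unfolding bounded_iff by blast
  have "winding_number \<gamma> z = 0"
    if \<gamma>: "path \<gamma>" "path_image \<gamma> \<subseteq> D" "pathfinish \<gamma> = pathstart \<gamma>" and z: "z \<notin> D" for \<gamma> z
  proof (rule ccontr)
    assume "winding_number \<gamma> z \<noteq> 0"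
    then have "z \<notin> outside (path_image \<gamma>)" using winding_number_zero_in_outside[OF \<gamma>(1,3)] by blast
    moreover have "z \<notin> path_image \<gamma>" using \<gamma> z by blast
    ultimately have zin: "z \<in> inside (path_image \<gamma>)" using inside_Un_outside[of "path_image \<gamma>"] by blast
    let ?I = "inside (path_image \<gamma>)"
    have cl: "closed (path_image \<gamma>)" using \<gamma>(1) by (simp add: closed_path_image)
    have bI: "bounded ?I" using \<gamma>(1) by (simp add: bounded_inside bounded_path_image)
    have bound: "norm ((f ^^ n) w) \<le> M" if w: "w \<in> ?I" for n w
    proof (rule maximum_modulus_frontier[of "f ^^ n" ?I, OF _ _ bI _ w])
      show "f ^^ n holomorphic_on interior ?I" using holomorphic_funpow[OF f] holomorphic_on_subset by blast
      show "continuous_on (closure ?I) (f ^^ n)"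
        using holomorphic_funpow[OF f] holomorphic_on_subset holomorphic_on_imp_continuous_on by blast
      fix x assume "x \<in> frontier ?I"
      then have "x \<in> D" using frontier_inside_subset[OF cl] \<gamma>(2) by blast
      then show "norm ((f ^^ n) x) \<le> M" using M funpow_image_subset[OF inv, of n] by blast
    qed
    define C where "C = connected_component_set ?I z"
    have C: "C \<in> components ?I" using zin by (simp add: C_def componentsI)
    have zC: "z \<in> C" using zin by (simp add: C_def)
    have oC: "open C" using open_components[OF open_inside[OF cl] C] .
    have CI: "C \<subseteq> ?I" using C by (rule in_components_subset)
    have "C \<noteq> UNIV" using bI CI bounded_subset not_bounded_UNIV by metis
    then have "frontier C \<noteq> {}" using frontier_not_empty zC by blast
    then obtain x where x: "x \<in> frontier C" by blast
    then have "x \<in> D"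
      using frontier_of_components_subset[OF C] frontier_inside_subset[OF cl] \<gamma>(2) by blast
    moreover have "x \<in> closure C" using x by (simp add: frontier_def)
    ultimately have "D \<inter> C \<noteq> {}" using oD open_Int_closure_eq_empty[of D C] by blast
    then have "C \<subseteq> D"
      using component_absorbs_bounded_orbits[OF f D oC in_components_connected[OF C], of M] bound CI by blast
    then show False using zC z by blast
  qed
  then show ?thesis
    using simply_connected_eq_winding_number_zero[OF oD] in_components_connected[OF D] by blast
qed

lemma proper_self_map_not_constant:
  assumes h: "proper_self_map D h" and D: "open D" "D \<noteq> {}" and U: "D \<subseteq> U"
  shows "\<not> h constant_on U"
proof
  assume "h constant_on U"
  then obtain c where c: "\<And>z. z \<in> D \<Longrightarrow> h z = c" using U by (auto simp: constant_on_def)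
  have "{c} \<subseteq> D" using h c D(2) unfolding proper_self_map_def by blast
  then have "compact (D \<inter> h -` {c})" using h unfolding proper_self_map_def by (meson finite.emptyI finite_imp_compact finite_insert)
  moreover have "D \<inter> h -` {c} = D" using c by auto
  ultimately show False using D compact_open[of D] by simp
qed

lemma proper_self_map_surj:
  assumes h: "proper_self_map D h" and D: "open D" "connected D" "D \<noteq> {}"
  shows "h ` D = D"
proof -
  have hol: "h holomorphic_on D" using h unfolding proper_self_map_def by (meson holomorphic_on_subset subset_UNIV)
  have sub: "h ` D \<subseteq> D" using h unfolding proper_self_map_def by blast
  have op: "open (h ` D)"
    by (rule open_mapping_thm[OF hol D(1,2,1) order_refl proper_self_map_not_constant[OF h D(1,3) order_refl]])
  have cl: "w \<in> h ` D" if w: "w \<in> D" "w \<in> closure (h ` D)" for w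
  proof -
    obtain r where r: "r > 0" "cball w r \<subseteq> D" using w(1) D(1) unfolding open_contains_cball by blast
    define L where "L = D \<inter> h -` cball w r"
    have "compact L" using h r(2) compact_cball[of w r] unfolding proper_self_map_def L_def by blast
    then have cL: "closed (h ` L)"
      by (intro compact_imp_closed compact_continuous_image)
         (auto simp: L_def intro: continuous_on_subset[OF holomorphic_on_imp_continuous_on[OF hol]])
    have "w \<in> closure (h ` L)"
      unfolding closure_approachable
    proof (intro allI impI)
      fix e :: real assume "e > 0"
      then obtain y where y: "y \<in> h ` D" "dist y w < min e r"
        using w(2) r(1) unfolding closure_approachable by (meson min_less_iff_conj)
      then have "y \<in> h ` L" by (auto simp: L_def dist_commute)
      then show "\<exists>y\<in>h ` L. dist y w < e" using y by auto
    qed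
    then show ?thesis using cL by (auto simp: L_def)
  qed
  have "openin (top_of_set D) (h ` D)" unfolding openin_open_eq[OF D(1)] using op sub by blast
  moreover have "closedin (top_of_set D) (h ` D)"
  proof -
    have eq: "h ` D = D \<inter> closure (h ` D)"
    proof
      show "h ` D \<subseteq> D \<inter> closure (h ` D)" by (intro Int_greatest sub closure_subset)
      show "D \<inter> closure (h ` D) \<subseteq> h ` D" using cl by (intro subsetI) (elim IntE)
    qed
    show ?thesis by (subst eq) (rule closedin_closed_Int[OF closed_closure])
  qed
  ultimately show ?thesis using D(2,3) unfolding connected_clopen by blast
qed

lemma compose_right_cancel:
  fixes a b u :: "complex \<Rightarrow> complex"
  assumes "a holomorphic_on UNIV" "b holomorphic_on UNIV" "u holomorphic_on UNIV"
    and nc: "\<not> u constant_on UNIV" and eq: "a \<circ> u = b \<circ> u"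
  shows "a = b"
proof (rule holomorphic_countable_equal_UNIV[OF assms(1,2)])
  have "open (range u)" by (rule open_mapping_thm[OF assms(3) open_UNIV connected_UNIV open_UNIV order_refl nc])
  then obtain r where "r > 0" "ball (u 0) r \<subseteq> range u" by (meson openE rangeI)
  then have "uncountable (range u)" using uncountable_ball countable_subset by blast
  moreover have "range u \<subseteq> {z. a z = b z}" using eq by (auto simp: fun_eq_iff)
  ultimately show "uncountable {z. a z = b z}" using countable_subset by blast
qed

lemma preperiodic_funpow: "preperiodic f w \<Longrightarrow> preperiodic f ((f ^^ m) w)"
  unfolding preperiodic_def
proof (erule rev_finite_subset)
  have "(f ^^ n) ((f ^^ m) w) = (f ^^ (n + m)) w" for n by (simp add: funpow_add)
  then show "range (\<lambda>n. (f ^^ n) ((f ^^ m) w)) \<subseteq> range (\<lambda>n. (f ^^ n) w)" by auto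
qed

text \<open>
  The situation of the theorem, as far as it concerns \<open>f\<close> alone.
\<close>

locale bounded_attracting_component =
  fixes f :: "complex \<Rightarrow> complex" and D :: "complex set" and p :: complex
  assumes hol: "f holomorphic_on UNIV" and component: "D \<in> components (fatou_set f)"
    and invariant: "f ` D \<subseteq> D" and bounded: "bounded D"
    and p: "p \<in> D" "f p = p" "deriv f p \<noteq> 0" "norm (deriv f p) < 1"
begin

lemma open_D: "open D" and connected_D: "connected D" and nonempty_D: "D \<noteq> {}"
  using open_components[OF open_fatou_set component] in_components_connected[OF component] p(1) by auto

lemma proper_f: "proper_self_map D f"
  by (rule invariant_component_proper[OF hol component invariant bounded])

lemma finite_fibre:
  assumes w: "w \<in> D" shows "finite {z \<in> D. (f ^^ k) z = w}"
proof -
  have pk: "proper_self_map D (f ^^ k)" by (rule proper_self_map_funpow[OF proper_f])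
  have "{w} \<subseteq> D" "compact {w}" using w by auto
  then have c: "compact (D \<inter> (f ^^ k) -` {w})" using pk unfolding proper_self_map_def by blast
  have hf: "(\<lambda>z. (f ^^ k) z - w) holomorphic_on D"
    using holomorphic_on_subset[OF holomorphic_funpow[OF hol] subset_UNIV] by (intro holomorphic_intros)
  have nc: "\<not> (\<lambda>z. (f ^^ k) z - w) constant_on D"
    using proper_self_map_not_constant[OF pk open_D nonempty_D order_refl]
    unfolding constant_on_def by (metis diff_add_cancel)
  have "finite {z \<in> D \<inter> (f ^^ k) -` {w}. (f ^^ k) z - w = 0}"
    by (rule holomorphic_compact_finite_zeros[OF hf open_D connected_D c _ nc]) auto
  then show ?thesis by (rule rev_finite_subset) auto
qed

lemma riemann_map:
  obtains \<psi> \<theta> where "\<psi> holomorphic_on D" "\<theta> holomorphic_on ball 0 1"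
    "\<And>z. z \<in> D \<Longrightarrow> norm (\<psi> z) < 1 \<and> \<theta> (\<psi> z) = z"
    "\<And>z. norm z < 1 \<Longrightarrow> \<theta> z \<in> D \<and> \<psi> (\<theta> z) = z" "\<psi> p = 0"
proof -
  have "D \<noteq> UNIV" using bounded not_bounded_UNIV by metis
  then have "\<exists>\<psi> \<theta>. \<psi> holomorphic_on D \<and> \<theta> holomorphic_on ball 0 1 \<and>
      (\<forall>z\<in>D. \<psi> z \<in> ball 0 1 \<and> \<theta> (\<psi> z) = z) \<and> (\<forall>z\<in>ball 0 1. \<theta> z \<in> D \<and> \<psi> (\<theta> z) = z)"
    using iffD1[OF Riemann_mapping_theorem conjI[OF open_D
      bounded_component_simply_connected[OF hol component invariant bounded]]] nonempty_D by simp
  then obtain \<psi> \<theta> where m0: "\<psi> holomorphic_on D" "\<theta> holomorphic_on ball 0 1"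
    "\<forall>z\<in>D. \<psi> z \<in> ball 0 1 \<and> \<theta> (\<psi> z) = z" "\<forall>z\<in>ball 0 1. \<theta> z \<in> D \<and> \<psi> (\<theta> z) = z"
    by blast
  have m: "\<psi> holomorphic_on D" "\<theta> holomorphic_on ball 0 1"
    "\<And>z. z \<in> D \<Longrightarrow> norm (\<psi> z) < 1 \<and> \<theta> (\<psi> z) = z"
    "\<And>z. norm z < 1 \<Longrightarrow> \<theta> z \<in> D \<and> \<psi> (\<theta> z) = z"
    using m0 by auto
  define a where "a = \<psi> p"
  have a: "norm a < 1" using m(3) p(1) by (simp add: a_def)
  let ?m = "Moebius_function 0 a" and ?i = "Moebius_function 0 (- a)"
  have hm: "?m holomorphic_on ball 0 1" "?i holomorphic_on ball 0 1"
    using a by (auto intro: Moebius_function_holomorphic)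
  have lt: "norm (?m z) < 1" "norm (?i z) < 1" if "norm z < 1" for z
    using a that by (auto intro: Moebius_function_norm_lt_1)
  have inv: "?m (?i z) = z" "?i (?m z) = z" if "norm z < 1" for z
    using a that by (auto intro: Moebius_function_compose)
  have "?m \<circ> \<psi> holomorphic_on D"
    by (rule holomorphic_on_compose_gen[OF m(1) hm(1)]) (use m(3) in auto)
  moreover have "\<theta> \<circ> ?i holomorphic_on ball 0 1"
    by (rule holomorphic_on_compose_gen[OF hm(2) m(2)]) (use lt in auto)
  moreover have "(?m \<circ> \<psi>) p = 0" by (simp add: a_def Moebius_function_eq_zero)
  ultimately show ?thesis using that[of "?m \<circ> \<psi>" "\<theta> \<circ> ?i"] m(3,4) lt inv by simp
qed

text \<open>
  Compact subsets of \<open>D\<close> correspond to compact subsets of the disc, so a proper self-map of \<open>D\<close> becomes a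
  proper self-map of the disc and \<open>proper_disc_map_extends\<close> applies.
\<close>

lemma transported_map:
  assumes m: "\<psi> holomorphic_on D" "\<theta> holomorphic_on ball 0 1"
    "\<And>z. z \<in> D \<Longrightarrow> norm (\<psi> z) < 1 \<and> \<theta> (\<psi> z) = z"
    "\<And>z. norm z < 1 \<Longrightarrow> \<theta> z \<in> D \<and> \<psi> (\<theta> z) = z"
    and h: "proper_self_map D h"
  shows "\<exists>\<tau> H. reflected_disc_map \<tau> H \<and> (\<forall>z. norm z < 1 \<longrightarrow> H z = \<psi> (h (\<theta> z)) \<and> norm (H z) < 1)"
proof -
  have hD: "h z \<in> D" if "z \<in> D" for z using h that unfolding proper_self_map_def by blast
  have holh: "h holomorphic_on D" using h unfolding proper_self_map_def by (meson holomorphic_on_subset subset_UNIV)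
  have "\<psi> \<circ> (h \<circ> \<theta>) holomorphic_on ball 0 1"
    by (rule holomorphic_on_compose_gen[OF holomorphic_on_compose_gen[OF m(2) holh] m(1)])
       (use m(4) hD in auto)
  then have "(\<lambda>z. \<psi> (h (\<theta> z))) holomorphic_on ball 0 1" by (simp add: o_def)
  moreover have lt: "norm (\<psi> (h (\<theta> z))) < 1" if "norm z < 1" for z using m that hD by blast
  moreover have "\<exists>s<1. \<forall>z. s < norm z \<and> norm z < 1 \<longrightarrow> t < norm (\<psi> (h (\<theta> z)))" if t: "t < 1" for t
  proof -
    define K where "K = \<theta> ` cball 0 t"
    have "compact K" unfolding K_def
      by (intro compact_continuous_image continuous_on_subset[OF holomorphic_on_imp_continuous_on[OF m(2)]])
         (use t in auto)
    moreover have "K \<subseteq> D" using m(4) t by (auto simp: K_def)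
    ultimately have L: "compact (D \<inter> h -` K)" using h unfolding proper_self_map_def by blast
    have "compact (\<psi> ` (D \<inter> h -` K))"
      by (intro compact_continuous_image continuous_on_subset[OF holomorphic_on_imp_continuous_on[OF m(1)]] L) auto
    moreover have "\<psi> ` (D \<inter> h -` K) \<subseteq> ball 0 1" using m(3) by auto
    ultimately obtain s where s: "s < 1" "\<psi> ` (D \<inter> h -` K) \<subseteq> cball 0 s"
    proof (cases "D \<inter> h -` K = {}")
      case True
      then show ?thesis using that[of 0] by simp
    next
      case False
      assume c: "compact (\<psi> ` (D \<inter> h -` K))" and b: "\<psi> ` (D \<inter> h -` K) \<subseteq> ball 0 1"
      have "compact (norm ` \<psi> ` (D \<inter> h -` K))" by (intro compact_continuous_image continuous_intros c)
      moreover have "norm ` \<psi> ` (D \<inter> h -` K) \<noteq> {}" using False by simp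
      ultimately obtain s where s: "s \<in> norm ` \<psi> ` (D \<inter> h -` K)" "\<And>x. x \<in> norm ` \<psi> ` (D \<inter> h -` K) \<Longrightarrow> x \<le> s"
        using compact_attains_sup by meson
      obtain y where y: "y \<in> \<psi> ` (D \<inter> h -` K)" "s = norm y" using s(1) by blast
      then have "y \<in> ball 0 1" using b by blast
      then have "s < 1" using y(2) by simp
      moreover have "\<psi> ` (D \<inter> h -` K) \<subseteq> cball 0 s" using s(2) by auto
      ultimately show ?thesis using that by blast
    qed
    have "t < norm (\<psi> (h (\<theta> z)))" if z: "s < norm z" "norm z < 1" for z
    proof (rule ccontr)
      assume "\<not> t < norm (\<psi> (h (\<theta> z)))"
      then have "\<psi> (h (\<theta> z)) \<in> cball 0 t" by simp
      then have "\<theta> (\<psi> (h (\<theta> z))) \<in> K" unfolding K_def by blast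
      then have "\<theta> z \<in> D \<inter> h -` K" using m z hD by simp
      then have "\<psi> (\<theta> z) \<in> cball 0 s" using s by blast
      then show False using m(4)[OF z(2)] z(1) by simp
    qed
    then show ?thesis using s(1) by blast
  qed
  ultimately have "\<exists>\<tau> H. reflected_disc_map \<tau> H \<and> (\<forall>z. norm z < 1 \<longrightarrow> H z = \<psi> (h (\<theta> z)))"
    by (rule proper_disc_map_extends)
  then obtain \<tau> H where "reflected_disc_map \<tau> H" "\<forall>z. norm z < 1 \<longrightarrow> H z = \<psi> (h (\<theta> z))" by blast
  moreover from this(2) have "\<forall>z. norm z < 1 \<longrightarrow> norm (H z) < 1" using lt by simp
  ultimately show ?thesis by blast
qed

lemma disc_model:
  obtains \<psi> \<theta> F \<tau> where "\<psi> holomorphic_on D" "\<theta> holomorphic_on ball 0 1"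
    "\<And>z. z \<in> D \<Longrightarrow> norm (\<psi> z) < 1 \<and> \<theta> (\<psi> z) = z"
    "\<And>z. norm z < 1 \<Longrightarrow> \<theta> z \<in> D \<and> \<psi> (\<theta> z) = z" "\<psi> p = 0"
    "expanding_disc_map F \<tau>" "\<And>n z. norm z < 1 \<Longrightarrow> (F ^^ n) z = \<psi> ((f ^^ n) (\<theta> z))"
proof -
  obtain \<psi> \<theta> where m: "\<psi> holomorphic_on D" "\<theta> holomorphic_on ball 0 1"
    "\<And>z. z \<in> D \<Longrightarrow> norm (\<psi> z) < 1 \<and> \<theta> (\<psi> z) = z"
    "\<And>z. norm z < 1 \<Longrightarrow> \<theta> z \<in> D \<and> \<psi> (\<theta> z) = z" "\<psi> p = 0"
    by (rule riemann_map) blast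
  obtain \<tau> F where F: "reflected_disc_map \<tau> F" "\<And>z. norm z < 1 \<Longrightarrow> F z = \<psi> (f (\<theta> z))"
    "\<And>z. norm z < 1 \<Longrightarrow> norm (F z) < 1"
    using transported_map[OF m(1-4) proper_f] by blast
  have \<theta>0: "\<theta> 0 = p" using m(3)[OF p(1)] m(5) by simp
  have d: "(\<theta> has_field_derivative deriv \<theta> 0) (at 0)" "(\<psi> has_field_derivative deriv \<psi> p) (at p)"
    "(f has_field_derivative deriv f p) (at p)"
    using holomorphic_derivI[OF m(2) open_ball, of 0 UNIV] holomorphic_derivI[OF m(1) open_D p(1), of UNIV]
      holomorphic_derivI[OF hol open_UNIV, of p UNIV] by auto
  have d1: "((\<lambda>z. \<psi> (\<theta> z)) has_field_derivative deriv \<psi> p * deriv \<theta> 0) (at 0)"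
    by (rule DERIV_chain2[OF _ d(1)]) (use d(2) \<theta>0 in simp)
  have "((\<lambda>z. z) has_field_derivative deriv \<psi> p * deriv \<theta> 0) (at 0)"
    by (rule has_field_derivative_transform_within_open[OF d1 open_ball, of 0 1]) (use m(4) in auto)
  then have one: "deriv \<psi> p * deriv \<theta> 0 = 1" using DERIV_unique DERIV_ident by blast
  have "((\<lambda>z. f (\<theta> z)) has_field_derivative deriv f p * deriv \<theta> 0) (at 0)"
    by (rule DERIV_chain2[OF _ d(1)]) (use d(3) \<theta>0 in simp)
  then have d2: "((\<lambda>z. \<psi> (f (\<theta> z))) has_field_derivative deriv \<psi> p * (deriv f p * deriv \<theta> 0)) (at 0)"
    by (rule DERIV_chain2[rotated]) (use d(2) \<theta>0 p(2) in simp)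
  have "(F has_field_derivative deriv \<psi> p * (deriv f p * deriv \<theta> 0)) (at 0)"
    by (rule has_field_derivative_transform_within_open[OF d2 open_ball, of 0 1]) (use F(2) in auto)
  then have dF: "deriv F 0 = deriv f p"
    using one DERIV_imp_deriv by (metis mult.assoc mult.commute mult_1)
  have "F 0 = 0" using F(2)[of 0] \<theta>0 p(2) m(5) by simp
  then have ex: "expanding_disc_map F \<tau>"
    using F(1,3) dF p(3,4) by unfold_locales auto
  have "(F ^^ n) z = \<psi> ((f ^^ n) (\<theta> z))" if z: "norm z < 1" for n z
  proof (induction n)
    case (Suc n)
    have fn: "(f ^^ n) (\<theta> z) \<in> D" using funpow_image_subset[OF invariant, of n] m(4)[OF z] by blast
    have "norm ((F ^^ n) z) < 1" using Suc m(3)[OF fn] by simp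
    then have "F ((F ^^ n) z) = \<psi> (f (\<theta> ((F ^^ n) z)))" by (rule F(2))
    also have "\<theta> ((F ^^ n) z) = (f ^^ n) (\<theta> z)" using Suc m(3)[OF fn] by simp
    finally show ?case by simp
  qed (use m(4) z in simp)
  then show ?thesis using that m ex by blast
qed

section \<open>Relations between words\<close>

definition preserves_preperiodic :: "(complex \<Rightarrow> complex) \<Rightarrow> bool" where
  "preserves_preperiodic h \<longleftrightarrow> (\<forall>z. preperiodic f z \<longrightarrow> preperiodic f (h z))"

text \<open>
  Apply \<open>finitely_many_germ_classes\<close> to the powers of \<open>x\<close> and cancel the surplus power of \<open>x\<close> on the right.
  The exponents come out in the stated order: if \<open>f ^^ n = f ^^ (t + n) \<circ> x ^^ l\<close> with \<open>t > 0\<close>, iterating this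
  shows that the surjective powers of \<open>x\<close> map the finite fibre of \<open>f ^^ n\<close> over \<open>p\<close> onto the fibres of
  \<open>f ^^ (t * k + n)\<close>, whose cardinalities are unbounded.
\<close>

lemma iterate_relation:
  assumes x: "proper_self_map D x" "preserves_preperiodic x"
  obtains N m a where "0 < m" "f ^^ N \<circ> x ^^ m = f ^^ (N + a)"
proof -
  obtain \<psi> \<theta> F \<tau> where m: "\<psi> holomorphic_on D" "\<theta> holomorphic_on ball 0 1"
    "\<And>z. z \<in> D \<Longrightarrow> norm (\<psi> z) < 1 \<and> \<theta> (\<psi> z) = z"
    "\<And>z. norm z < 1 \<Longrightarrow> \<theta> z \<in> D \<and> \<psi> (\<theta> z) = z" "\<psi> p = 0"
    and ex: "expanding_disc_map F \<tau>" and Fn: "\<And>n z. norm z < 1 \<Longrightarrow> (F ^^ n) z = \<psi> ((f ^^ n) (\<theta> z))"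
    by (rule disc_model) blast
  interpret F: expanding_disc_map F \<tau> by (rule ex)
  have fD: "(f ^^ n) z \<in> D" if "z \<in> D" for n z
    using funpow_image_subset[OF invariant, of n] that by blast
  have Fzero: "(F ^^ n) z = 0 \<longleftrightarrow> (f ^^ n) (\<theta> z) = p" if z: "norm z < 1" for n z
  proof
    assume "(F ^^ n) z = 0"
    then have "\<psi> ((f ^^ n) (\<theta> z)) = \<psi> p" using Fn[OF z] m(5) by simp
    then show "(f ^^ n) (\<theta> z) = p" using m(3)[OF fD[of "\<theta> z" n]] m(3)[OF p(1)] m(4)[OF z] by metis
  qed (use Fn[OF z] m(5) in simp)
  \<comment> \<open>In the disc a finite orbit has to reach \<open>0\<close>, since the moduli decrease strictly until then.\<close>
  have preper: "z \<in> F.prezeros \<longleftrightarrow> preperiodic f (\<theta> z)" if z: "norm z < 1" for z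
  proof
    assume "z \<in> F.prezeros"
    then obtain n where "(f ^^ n) (\<theta> z) = p" using Fzero[OF z] by (auto simp: F.prezeros_def)
    have "(f ^^ k) p = p" for k by (induction k) (auto simp: p(2))
    then have "(f ^^ k) (\<theta> z) \<in> insert p ((\<lambda>k. (f ^^ k) (\<theta> z)) ` {..n})" for k
    proof (cases "k \<le> n")
      case False
      then have "(f ^^ k) (\<theta> z) = (f ^^ (k - n)) ((f ^^ n) (\<theta> z))"
        by (metis add.commute comp_apply funpow_add le_add_diff_inverse nat_le_linear)
      then show ?thesis using \<open>(f ^^ n) (\<theta> z) = p\<close> \<open>\<And>k. (f ^^ k) p = p\<close> by simp
    qed auto
    then have "range (\<lambda>k. (f ^^ k) (\<theta> z)) \<subseteq> insert p ((\<lambda>k. (f ^^ k) (\<theta> z)) ` {..n})" by blast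
    then show "preperiodic f (\<theta> z)" unfolding preperiodic_def by (rule finite_subset) simp
  next
    assume pp: "preperiodic f (\<theta> z)"
    have fin: "finite (range (\<lambda>n. norm ((F ^^ n) z)))"
    proof (rule finite_subset)
      show "range (\<lambda>n. norm ((F ^^ n) z)) \<subseteq> (\<lambda>w. norm (\<psi> w)) ` range (\<lambda>n. (f ^^ n) (\<theta> z))"
        using Fn[OF z] by auto
      show "finite ((\<lambda>w. norm (\<psi> w)) ` range (\<lambda>n. (f ^^ n) (\<theta> z)))"
        using pp unfolding preperiodic_def by (rule finite_imageI)
    qed
    show "z \<in> F.prezeros"
    proof (rule ccontr)
      assume "z \<notin> F.prezeros"
      then have nz: "(F ^^ n) z \<noteq> 0" for n using z by (auto simp: F.prezeros_def)
      obtain c where c: "0 < c" "\<And>z. norm z < 1 \<Longrightarrow> norm (F z) \<le> norm z * (1 - c * (1 - norm z))"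
        by (rule F.contraction_bound) blast
      have dec: "norm ((F ^^ Suc n) z) < norm ((F ^^ n) z)" for n
      proof -
        let ?w = "(F ^^ n) z"
        have w: "norm ?w < 1" "0 < norm ?w" using F.iterate_disc[OF z] nz by auto
        have "norm (F ?w) \<le> norm ?w * (1 - c * (1 - norm ?w))" by (rule c(2)[OF w(1)])
        also have "\<dots> < norm ?w * 1" using w c(1) by (intro mult_strict_left_mono) auto
        finally show ?thesis by simp
      qed
      have "norm ((F ^^ j) z) < norm ((F ^^ i) z)" if "i < j" for i j
        using lift_Suc_mono_less[of "\<lambda>k. - norm ((F ^^ k) z)" i j] dec that by simp
      then have "inj (\<lambda>n. norm ((F ^^ n) z))" by (metis (mono_tags, lifting) injI less_irrefl linorder_neqE_nat)
      then show False using fin finite_imageD by fastforce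
    qed
  qed
  obtain M :: nat where M: "\<And>e. (\<forall>i\<le>M. (\<exists>\<tau>'. reflected_disc_map \<tau>' (e i)) \<and> (\<forall>z. norm z < 1 \<longrightarrow> norm (e i z) < 1) \<and>
       (\<forall>z\<in>F.prezeros. e i z \<in> F.prezeros)) \<Longrightarrow>
     (\<exists>i j n n'. i < j \<and> j \<le> M \<and> (\<forall>z. norm z < 1 \<longrightarrow> (F ^^ n) (e i z) = (F ^^ n') (e j z)))"
    using F.finitely_many_germ_classes by blast
  have xn: "proper_self_map D (x ^^ i)" for i by (rule proper_self_map_funpow[OF x(1)])
  have xD: "(x ^^ i) z \<in> D" if "z \<in> D" for i z using xn[of i] that unfolding proper_self_map_def by blast
  have xp: "preperiodic f ((x ^^ i) z)" if "preperiodic f z" for i z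
    by (induction i) (use that x(2) in \<open>auto simp: preserves_preperiodic_def\<close>)
  have "\<forall>i. \<exists>\<tau> H. reflected_disc_map \<tau> H \<and>
      (\<forall>z. norm z < 1 \<longrightarrow> H z = \<psi> ((x ^^ i) (\<theta> z)) \<and> norm (H z) < 1)"
    using transported_map[OF m(1-4) xn] by blast
  then obtain \<tau>' e where e: "\<And>i. reflected_disc_map (\<tau>' i) (e i)"
    "\<And>i z. norm z < 1 \<Longrightarrow> e i z = \<psi> ((x ^^ i) (\<theta> z))" "\<And>i z. norm z < 1 \<Longrightarrow> norm (e i z) < 1"
    by metis
  have "e i z \<in> F.prezeros" if z: "z \<in> F.prezeros" for i z
  proof -
    have z1: "norm z < 1" using z by (simp add: F.prezeros_def)
    have "\<theta> (e i z) = (x ^^ i) (\<theta> z)" using e(2)[OF z1] m(3) xD m(4)[OF z1] by simp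
    then show ?thesis using preper[OF z1] z xp preper[OF e(3)[OF z1]] by simp
  qed
  then obtain i j n n' where ij: "i < j" "\<And>z. norm z < 1 \<Longrightarrow> (F ^^ n) (e i z) = (F ^^ n') (e j z)"
    using M[of e] e by blast
  have onD: "(f ^^ n) ((x ^^ i) w) = (f ^^ n') ((x ^^ j) w)" if w: "w \<in> D" for w
  proof -
    have z1: "norm (\<psi> w) < 1" using m(3)[OF w] by blast
    have *: "(F ^^ k) (e l (\<psi> w)) = \<psi> ((f ^^ k) ((x ^^ l) w))" for k l
    proof -
      have "e l (\<psi> w) = \<psi> ((x ^^ l) w)" using e(2)[OF z1] m(3)[OF w] by simp
      then show ?thesis using Fn[of "\<psi> ((x ^^ l) w)" k] m(3)[OF xD[OF w, of l]] by simp
    qed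
    have "\<psi> ((f ^^ n) ((x ^^ i) w)) = \<psi> ((f ^^ n') ((x ^^ j) w))" using ij(2)[OF z1] * by simp
    then show ?thesis using m(3)[OF fD[OF xD[OF w, of i], of n]] m(3)[OF fD[OF xD[OF w, of j], of n']] by metis
  qed
  have holx: "(x ^^ k) holomorphic_on UNIV" for k using xn[of k] unfolding proper_self_map_def by blast
  have holfx: "((f ^^ k) \<circ> (x ^^ l)) holomorphic_on UNIV" for k l
    by (rule holomorphic_on_compose_gen[OF holx holomorphic_funpow[OF hol]]) auto
  have "f ^^ n \<circ> x ^^ i = f ^^ n' \<circ> x ^^ j"
  proof (rule holomorphic_countable_equal_UNIV[OF holfx holfx])
    obtain r where "r > 0" "ball p r \<subseteq> D" using open_D p(1) openE by blast
    then have "ball p r \<subseteq> {z. (f ^^ n \<circ> x ^^ i) z = (f ^^ n' \<circ> x ^^ j) z}" using onD by auto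
    then show "uncountable {z. (f ^^ n \<circ> x ^^ i) z = (f ^^ n' \<circ> x ^^ j) z}"
      using uncountable_ball[OF \<open>r > 0\<close>] countable_subset by blast
  qed
  moreover have "x ^^ j = x ^^ (j - i) \<circ> x ^^ i" using ij(1) by (simp flip: funpow_add)
  ultimately have "(f ^^ n) \<circ> x ^^ i = (f ^^ n' \<circ> x ^^ (j - i)) \<circ> x ^^ i" by (simp add: comp_assoc)
  then have rel: "f ^^ n = f ^^ n' \<circ> x ^^ (j - i)"
    by (rule compose_right_cancel[OF holomorphic_funpow[OF hol] holfx holx, rotated])
       (rule proper_self_map_not_constant[OF xn open_D nonempty_D subset_UNIV])
  define l where "l = j - i"
  have l: "0 < l" using ij(1) by (simp add: l_def)
  have "n' \<le> n"
  proof (rule ccontr)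
    assume "\<not> n' \<le> n"
    then obtain t where t: "n' = t + n" "0 < t" by (metis add.commute less_imp_add_positive not_le)
    have it: "f ^^ n = f ^^ (t * k + n) \<circ> x ^^ (l * k)" for k
    proof (induction k)
      case (Suc k)
      have rel': "f ^^ n = f ^^ (t + n) \<circ> x ^^ l" using rel t by (simp add: l_def)
      have "f ^^ n = f ^^ (t * k) \<circ> f ^^ n \<circ> x ^^ (l * k)" using Suc unfolding funpow_add .
      also have "\<dots> = f ^^ (t * k) \<circ> (f ^^ (t + n) \<circ> x ^^ l) \<circ> x ^^ (l * k)"
        by (rule arg_cong[OF rel', of "\<lambda>g. f ^^ (t * k) \<circ> g \<circ> x ^^ (l * k)"])
      also have "\<dots>
          = (f ^^ (t * k) \<circ> f ^^ (t + n)) \<circ> (x ^^ l \<circ> x ^^ (l * k))" by (simp add: comp_assoc)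
      also have "\<dots> = f ^^ (t * Suc k + n) \<circ> x ^^ (l * Suc k)"
        by (simp add: funpow_add[symmetric] algebra_simps)
      finally show ?case .
    qed simp
    define Z where "Z k = {z \<in> D. (f ^^ k) z = p}" for k
    have finZ: "finite (Z k)" for k unfolding Z_def by (rule finite_fibre[OF p(1)])
    have "card (Z (t * k + n)) \<le> card (Z n)" for k
    proof -
      have "Z (t * k + n) \<subseteq> (x ^^ (l * k)) ` Z n"
      proof
        fix y assume y: "y \<in> Z (t * k + n)"
        then have "y \<in> (x ^^ (l * k)) ` D"
          using proper_self_map_surj[OF xn open_D connected_D nonempty_D] by (simp add: Z_def)
        then obtain z where z: "z \<in> D" "y = (x ^^ (l * k)) z" by blast
        have "(f ^^ n) z = (f ^^ (t * k + n)) y" using fun_cong[OF it[of k], of z] z(2) by simp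
        then show "y \<in> (x ^^ (l * k)) ` Z n" using y z by (auto simp: Z_def)
      qed
      then show ?thesis using surj_card_le[OF finZ] by blast
    qed
    moreover have "k \<le> card (Z k)" for k
    proof -
      obtain b where b: "\<And>k. b k \<in> F.prezeros" "inj b" "\<And>k. (F ^^ Suc k) (b k) = 0"
        by (rule F.backward_orbit) blast
      have b1: "norm (b i) < 1" for i using b(1)[of i] by (simp add: F.prezeros_def)
      have sub: "(\<theta> \<circ> b) ` {..<k} \<subseteq> Z k"
      proof clarify
        fix i assume i: "i < k"
        have "(F ^^ (k - Suc i + Suc i)) (b i) = 0"
          using b(3)[of i] by (simp only: funpow_add o_apply F.iterate_0)
        then have "(F ^^ k) (b i) = 0" using i by simp
        then show "(\<theta> \<circ> b) i \<in> Z k" using Fzero[OF b1] m(4)[OF b1] by (simp add: Z_def)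
      qed
      have "inj (\<theta> \<circ> b)"
      proof (rule injI)
        fix i j assume "(\<theta> \<circ> b) i = (\<theta> \<circ> b) j"
        then have "b i = b j" using m(4)[OF b1[of i]] m(4)[OF b1[of j]] by (metis o_apply)
        then show "i = j" using b(2) by (simp add: inj_eq)
      qed
      then have "card ((\<theta> \<circ> b) ` {..<k}) = k" by (subst card_image) (auto intro: inj_on_subset)
      then show ?thesis using card_mono[OF finZ sub] by simp
    qed
    ultimately have "t * Suc (card (Z n)) + n \<le> card (Z n)" by (meson order_trans)
    then show False using t(2) by (cases t) auto
  qed
  then have "f ^^ n' \<circ> x ^^ l = f ^^ (n' + (n - n'))" using rel by (simp add: l_def)
  then show ?thesis using that l by blast
qed

text \<open>
  A lift \<open>u\<close> of \<open>f ^^ M\<close> through \<open>f ^^ N\<close> is determined by its value at one point \<open>z0\<close>, provided that \<open>f ^^ N\<close>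
  is locally injective at that value.  Choosing \<open>z0\<close> over a fixed regular value \<open>w\<close> of \<open>f ^^ N\<close>, that is
  \<open>(f ^^ M) z0 = w\<close>, confines the values to one finite fibre; so the bound does not depend on \<open>M\<close>.
\<close>

lemma card_lifts_bounded:
  "\<exists>K. \<forall>M U. finite U \<longrightarrow> (\<forall>u\<in>U. u holomorphic_on UNIV \<and> u ` D \<subseteq> D \<and> f ^^ N \<circ> u = f ^^ M) \<longrightarrow>
     card U \<le> K"
proof -
  have pN: "proper_self_map D (f ^^ n)" for n by (rule proper_self_map_funpow[OF proper_f])
  have hN: "(f ^^ N) holomorphic_on UNIV" by (rule holomorphic_funpow[OF hol])
  have hd: "deriv (f ^^ N) holomorphic_on UNIV" by (rule holomorphic_deriv[OF hN open_UNIV])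
  have "countable {c. deriv (f ^^ N) c = 0}"
  proof (cases "deriv (f ^^ N) constant_on UNIV")
    case False
    then show ?thesis using holomorphic_countable_zeros[OF hd open_UNIV connected_UNIV fsigma_UNIV] by simp
  next
    case True
    then obtain c where c: "\<And>z. deriv (f ^^ N) z = c" by (auto simp: constant_on_def)
    have "c \<noteq> 0"
    proof
      assume "c = 0"
      then have "(f ^^ N has_field_derivative 0) (at z within UNIV)" for z
        using holomorphic_derivI[OF hN open_UNIV, of z UNIV] c by simp
      then have "\<exists>k. \<forall>z\<in>UNIV. (f ^^ N) z = k" by (intro has_field_derivative_zero_constant) auto
      then show False
        using proper_self_map_not_constant[OF pN[of N] open_D nonempty_D subset_UNIV]
        by (auto simp: constant_on_def)
    qed
    then show ?thesis using c by simp
  qed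
  then have cnt: "countable ((f ^^ N) ` {c. deriv (f ^^ N) c = 0})" by (rule countable_image)
  obtain r where "r > 0" "ball p r \<subseteq> D" using open_D p(1) openE by blast
  then have "uncountable D" using uncountable_ball countable_subset by blast
  then have "\<not> D \<subseteq> (f ^^ N) ` {c. deriv (f ^^ N) c = 0}" using countable_subset[OF _ cnt] by metis
  then obtain w where w: "w \<in> D" "w \<notin> (f ^^ N) ` {c. deriv (f ^^ N) c = 0}" by blast
  define Z where "Z = {z \<in> D. (f ^^ N) z = w}"
  have finZ: "finite Z" unfolding Z_def by (rule finite_fibre[OF w(1)])
  have bound: "card U \<le> card Z"
    if "finite U" and U: "\<And>u. u \<in> U \<Longrightarrow> u holomorphic_on UNIV \<and> u ` D \<subseteq> D \<and> f ^^ N \<circ> u = f ^^ M" for M U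
  proof -
    have "w \<in> (f ^^ M) ` D"
      using proper_self_map_surj[OF pN[of M] open_D connected_D nonempty_D] w(1) by simp
    then obtain z0 where z0: "z0 \<in> D" "(f ^^ M) z0 = w" by blast
    have "inj_on (\<lambda>u. u z0) U"
    proof (rule inj_onI)
      fix u v assume uv: "u \<in> U" "v \<in> U" "u z0 = v z0"
      have hu: "u holomorphic_on UNIV" "v holomorphic_on UNIV" using U uv by auto
      have fu: "(f ^^ N) (u z) = (f ^^ N) (v z)" for z
        using U[OF uv(1)] U[OF uv(2)] by (metis comp_apply)
      have "(f ^^ N) (u z0) = w" using U[OF uv(1)] z0(2) by (metis comp_apply)
      then have "deriv (f ^^ N) (u z0) \<noteq> 0" using w(2) by auto
      then obtain r where r: "r > 0" "inj_on (f ^^ N) (ball (u z0) r)"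
        using has_complex_derivative_locally_injective[OF hN _ open_UNIV] by (metis UNIV_I)
      define T where "T = u -` ball (u z0) r \<inter> v -` ball (u z0) r"
      have "open T" unfolding T_def
        using hu holomorphic_on_imp_continuous_on by (intro open_Int open_vimage) auto
      moreover have "z0 \<in> T" using r uv(3) by (simp add: T_def)
      ultimately obtain s where s: "s > 0" "ball z0 s \<subseteq> T" by (meson openE)
      have "ball z0 s \<subseteq> {z. u z = v z}"
      proof
        fix z assume "z \<in> ball z0 s"
        then have "u z \<in> ball (u z0) r" "v z \<in> ball (u z0) r" using s(2) by (auto simp: T_def)
        then show "z \<in> {z. u z = v z}" using fu r(2) by (simp add: inj_on_def)
      qed
      then have "uncountable {z. u z = v z}" using uncountable_ball[OF s(1)] countable_subset by blast
      then show "u = v" by (rule holomorphic_countable_equal_UNIV[OF hu])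
    qed
    moreover have "(\<lambda>u. u z0) ` U \<subseteq> Z"
    proof clarify
      fix u assume u: "u \<in> U"
      have "(f ^^ N) (u z0) = w" using U[OF u] z0(2) by (metis comp_apply)
      then show "u z0 \<in> Z" using U[OF u] z0(1) by (auto simp: Z_def)
    qed
    ultimately show ?thesis using finZ card_inj_on_le by blast
  qed
  show ?thesis
  proof (rule exI[of _ "card Z"], intro allI impI)
    fix M U
    assume "finite U" and U: "\<forall>u\<in>U. u holomorphic_on UNIV \<and> u ` D \<subseteq> D \<and> f ^^ N \<circ> u = f ^^ M"
    show "card U \<le> card Z" by (rule bound[OF \<open>finite U\<close> bspec[OF U]])
  qed
qed

text \<open>
  The exponents are balanced such that replacing powers of \<open>y\<close> by powers of \<open>x\<close> does not change the iterate
  of \<open>f\<close> that is lifted.  Then the \<open>K + 1\<close> products \<open>u i\<close> are lifts of the same iterate, but there are at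
  most \<open>K\<close> of those.
\<close>

theorem power_coincidence:
  assumes x: "proper_self_map D x" "preserves_preperiodic x"
    and y: "proper_self_map D y" "preserves_preperiodic y"
  shows "\<exists>i j i' j'. (i, j) \<noteq> (i', j') \<and> x ^^ i \<circ> y ^^ j = x ^^ i' \<circ> y ^^ j'"
proof -
  obtain N1 m a where 1: "0 < m" "f ^^ N1 \<circ> x ^^ m = f ^^ (N1 + a)" by (rule iterate_relation[OF x])
  obtain N2 m' a' where 2: "0 < m'" "f ^^ N2 \<circ> y ^^ m' = f ^^ (N2 + a')" by (rule iterate_relation[OF y])
  define N where "N = N1 + N2"
  have iter: "f ^^ N \<circ> u ^^ (k * j) = f ^^ (N + b * j)" if "f ^^ N' \<circ> u ^^ k = f ^^ (N' + b)" "N' \<le> N"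
    for u :: "complex \<Rightarrow> complex" and N' k b j
  proof -
    have one: "f ^^ N \<circ> u ^^ k = f ^^ b \<circ> f ^^ N"
    proof -
      have "f ^^ N \<circ> u ^^ k = f ^^ (N - N') \<circ> (f ^^ N' \<circ> u ^^ k)"
        using that(2) by (simp add: comp_assoc[symmetric] funpow_add[symmetric])
      also have "\<dots> = f ^^ (N + b)" unfolding that(1) using that(2) by (simp add: funpow_add[symmetric])
      finally show ?thesis by (simp add: funpow_add[symmetric] add.commute)
    qed
    show ?thesis
    proof (induction j)
      case (Suc j)
      have "f ^^ N \<circ> u ^^ (k * Suc j) = (f ^^ N \<circ> u ^^ k) \<circ> u ^^ (k * j)"
        by (simp add: funpow_add comp_assoc)
      also have "\<dots> = f ^^ b \<circ> (f ^^ N \<circ> u ^^ (k * j))" unfolding one by (simp add: comp_assoc)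
      also have "\<dots> = f ^^ (N + b * Suc j)"
        unfolding Suc by (simp add: funpow_add[symmetric] algebra_simps)
      finally show ?case .
    qed simp
  qed
  \<comment> \<open>The weights satisfy \<open>a * A = a' * B\<close> and are not both zero, also if \<open>a\<close> or \<open>a'\<close> vanishes.\<close>
  define A where "A = (if a = 0 \<and> a' = 0 then 1 else a')"
  define B where "B = (if a = 0 \<and> a' = 0 then 1 else a)"
  have AB: "a * A = a' * B" "0 < A \<or> 0 < B" by (auto simp: A_def B_def)
  obtain K where K: "\<forall>M U. finite U \<longrightarrow>
      (\<forall>u\<in>U. u holomorphic_on UNIV \<and> u ` D \<subseteq> D \<and> f ^^ N \<circ> u = f ^^ M) \<longrightarrow> card U \<le> K"
    by (rule exE[OF card_lifts_bounded[of N]])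
  define u where "u i = x ^^ (m * (A * i)) \<circ> y ^^ (m' * (B * (K - i)))" for i
  have pu: "proper_self_map D (u i)" for i
    unfolding u_def by (intro proper_self_map_comp proper_self_map_funpow x y)
  have fu: "f ^^ N \<circ> u i = f ^^ (N + a * A * K)" if "i \<le> K" for i
  proof -
    have "f ^^ N \<circ> u i = (f ^^ N \<circ> x ^^ (m * (A * i))) \<circ> y ^^ (m' * (B * (K - i)))"
      by (simp add: u_def comp_assoc)
    also have "f ^^ N \<circ> x ^^ (m * (A * i)) = f ^^ (a * (A * i)) \<circ> f ^^ N"
      using iter[OF 1(2), of "A * i"] by (simp add: N_def funpow_add[symmetric] add.commute)
    also have "f ^^ (a * (A * i)) \<circ> f ^^ N \<circ> y ^^ (m' * (B * (K - i)))
        = f ^^ (a * (A * i)) \<circ> f ^^ (N + a' * (B * (K - i)))"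
      using iter[OF 2(2), of "B * (K - i)"] by (simp add: N_def comp_assoc)
    also have "\<dots> = f ^^ (N + a * A * K)"
    proof -
      have "a * (A * i) + a' * (B * (K - i)) = a * A * i + a * A * (K - i)" by (simp add: AB(1) mult.assoc[symmetric])
      also have "\<dots> = a * A * K" using that by (simp flip: add_mult_distrib2)
      finally show ?thesis by (simp add: funpow_add[symmetric] add.left_commute)
    qed
    finally show ?thesis .
  qed
  have "card (u ` {..K}) \<le> K"
  proof (rule K[rule_format, of "u ` {..K}" "N + a * A * K"])
    fix v assume "v \<in> u ` {..K}"
    then obtain i where "i \<le> K" "v = u i" by auto
    then show "v holomorphic_on UNIV \<and> v ` D \<subseteq> D \<and> f ^^ N \<circ> v = f ^^ (N + a * A * K)"
      using fu pu unfolding proper_self_map_def by simp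
  qed simp
  then have "\<not> inj_on u {..K}" using pigeonhole[of u "{..K}"] by (simp add: inj_on_iff_eq_card)
  then obtain i j where ij: "i \<le> K" "j \<le> K" "i \<noteq> j" "u i = u j" by (auto simp: inj_on_def)
  have "(m * (A * i), m' * (B * (K - i))) \<noteq> (m * (A * j), m' * (B * (K - j)))"
    using AB(2) 1(1) 2(1) ij(1-3) by auto
  then show ?thesis using ij(4) unfolding u_def by blast
qed

end

section \<open>Free generators satisfy no coincidence\<close>

text \<open>
  Makes all exponents positive, so that both sides come from nonempty words.
\<close>

lemma funpow_Suc_Suc_coincidence:
  fixes x y :: "'a \<Rightarrow> 'a"
  assumes "x ^^ i \<circ> y ^^ j = x ^^ i' \<circ> y ^^ j'"
  shows "x ^^ Suc i \<circ> y ^^ Suc j = x ^^ Suc i' \<circ> y ^^ Suc j'"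
proof -
  have *: "x ^^ Suc i \<circ> y ^^ Suc j = x \<circ> (x ^^ i \<circ> y ^^ j) \<circ> y" for i j
    by (simp only: funpow_Suc_right[of j y] funpow.simps(2)[of i x] comp_assoc)
  show ?thesis unfolding * assms ..
qed

lemma free_semigroup_isomorphism:
  assumes free: "free_semigroup_on X S"
  obtains \<phi> where "inj_on \<phi> {w. w \<noteq> [] \<and> set w \<subseteq> X}" "\<And>x. x \<in> X \<Longrightarrow> \<phi> [x] = x"
    "\<And>u v. u \<noteq> [] \<Longrightarrow> set u \<subseteq> X \<Longrightarrow> v \<noteq> [] \<Longrightarrow> set v \<subseteq> X \<Longrightarrow> \<phi> (u @ v) = \<phi> u \<circ> \<phi> v"
    "X \<subseteq> S"
proof -
  obtain \<phi> where \<phi>': "bij_betw \<phi> {w. w \<noteq> [] \<and> set w \<subseteq> X} S \<and> (\<forall>x\<in>X. \<phi> [x] = x) \<and>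
      (\<forall>u v. u \<noteq> [] \<and> set u \<subseteq> X \<and> v \<noteq> [] \<and> set v \<subseteq> X \<longrightarrow> \<phi> (u @ v) = \<phi> u \<circ> \<phi> v)"
    using free unfolding free_semigroup_on_def by (rule exE)
  then have \<phi>: "bij_betw \<phi> {w. w \<noteq> [] \<and> set w \<subseteq> X} S" "\<And>x. x \<in> X \<Longrightarrow> \<phi> [x] = x"
    "\<And>u v. u \<noteq> [] \<Longrightarrow> set u \<subseteq> X \<Longrightarrow> v \<noteq> [] \<Longrightarrow> set v \<subseteq> X \<Longrightarrow> \<phi> (u @ v) = \<phi> u \<circ> \<phi> v"
    by simp_all
  have "x \<in> S" if x: "x \<in> X" for x
  proof -
    have "\<phi> [x] \<in> S" using x by (intro bij_betw_apply[OF \<phi>(1)]) simp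
    then show ?thesis using \<phi>(2)[OF x] by simp
  qed
  then have "X \<subseteq> S" by (rule subsetI)
  show ?thesis by (rule that[of \<phi>]) (fact bij_betw_imp_inj_on[OF \<phi>(1)] \<phi>(2,3) \<open>X \<subseteq> S\<close>)+
qed

lemma free_semigroup_no_coincidence:
  fixes x y :: "'a \<Rightarrow> 'a"
  assumes free: "free_semigroup_on X S" and X: "x \<in> X" "y \<in> X" "x \<noteq> y"
    and eq: "x ^^ i \<circ> y ^^ j = x ^^ i' \<circ> y ^^ j'"
  shows "(i, j) = (i', j')"
proof -
  obtain \<phi> where \<phi>: "inj_on \<phi> {w. w \<noteq> [] \<and> set w \<subseteq> X}" "\<And>x. x \<in> X \<Longrightarrow> \<phi> [x] = x"
    "\<And>u v. u \<noteq> [] \<Longrightarrow> set u \<subseteq> X \<Longrightarrow> v \<noteq> [] \<Longrightarrow> set v \<subseteq> X \<Longrightarrow> \<phi> (u @ v) = \<phi> u \<circ> \<phi> v" "X \<subseteq> S"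
    by (rule free_semigroup_isomorphism[OF free]) iprover
  have pow: "\<phi> (replicate (Suc n) z) = z ^^ Suc n" if z: "z \<in> X" for z n
  proof (induction n)
    case (Suc n)
    have "\<phi> ([z] @ replicate (Suc n) z) = \<phi> [z] \<circ> \<phi> (replicate (Suc n) z)"
      using z by (intro \<phi>(3)) auto
    then show ?case using Suc \<phi>(2)[OF z] by simp
  qed (use \<phi>(2) z in simp)
  have word: "\<phi> (replicate (Suc i) x @ replicate (Suc j) y) = x ^^ Suc i \<circ> y ^^ Suc j" for i j
    using X by (subst \<phi>(3)) (auto simp only: pow set_replicate, auto)
  have "replicate (Suc i) x @ replicate (Suc j) y = replicate (Suc i') x @ replicate (Suc j') y"
  proof (rule inj_onD[OF \<phi>(1)])
    show "\<phi> (replicate (Suc i) x @ replicate (Suc j) y) = \<phi> (replicate (Suc i') x @ replicate (Suc j') y)"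
      unfolding word by (rule funpow_Suc_Suc_coincidence[OF eq])
  qed (use X in auto)
  then have "mset (replicate (Suc i) x @ replicate (Suc j) y) = mset (replicate (Suc i') x @ replicate (Suc j') y)"
    by simp
  then have "count (replicate_mset (Suc i) x + replicate_mset (Suc j) y) z
      = count (replicate_mset (Suc i') x + replicate_mset (Suc j') y) z" for z
    by (simp only: mset_append mset_replicate)
  from this[of x] this[of y] show ?thesis using X(3) by simp
qed

lemma free_abelian_semigroup_isomorphism:
  assumes free: "free_abelian_semigroup_on X S"
  obtains \<phi> where "inj_on \<phi> {M. M \<noteq> {#} \<and> set_mset M \<subseteq> X}" "\<And>x. x \<in> X \<Longrightarrow> \<phi> {#x#} = x"
    "\<And>M N. M \<noteq> {#} \<Longrightarrow> set_mset M \<subseteq> X \<Longrightarrow> N \<noteq> {#} \<Longrightarrow> set_mset N \<subseteq> X \<Longrightarrow> \<phi> (M + N) = \<phi> M \<circ> \<phi> N"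
    "X \<subseteq> S"
proof -
  obtain \<phi> where \<phi>': "bij_betw \<phi> {M. M \<noteq> {#} \<and> set_mset M \<subseteq> X} S \<and> (\<forall>x\<in>X. \<phi> {#x#} = x) \<and>
      (\<forall>M N. M \<noteq> {#} \<and> set_mset M \<subseteq> X \<and> N \<noteq> {#} \<and> set_mset N \<subseteq> X \<longrightarrow> \<phi> (M + N) = \<phi> M \<circ> \<phi> N)"
    using free unfolding free_abelian_semigroup_on_def by (rule exE)
  then have \<phi>: "bij_betw \<phi> {M. M \<noteq> {#} \<and> set_mset M \<subseteq> X} S" "\<And>x. x \<in> X \<Longrightarrow> \<phi> {#x#} = x"
    "\<And>M N. M \<noteq> {#} \<Longrightarrow> set_mset M \<subseteq> X \<Longrightarrow> N \<noteq> {#} \<Longrightarrow> set_mset N \<subseteq> X \<Longrightarrow> \<phi> (M + N) = \<phi> M \<circ> \<phi> N"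
    by simp_all
  have "x \<in> S" if x: "x \<in> X" for x
  proof -
    have "\<phi> {#x#} \<in> S" using x by (intro bij_betw_apply[OF \<phi>(1)]) simp
    then show ?thesis using \<phi>(2)[OF x] by simp
  qed
  then have "X \<subseteq> S" by (rule subsetI)
  show ?thesis by (rule that[of \<phi>]) (fact bij_betw_imp_inj_on[OF \<phi>(1)] \<phi>(2,3) \<open>X \<subseteq> S\<close>)+
qed

lemma free_abelian_semigroup_no_coincidence:
  fixes x y :: "'a \<Rightarrow> 'a"
  assumes free: "free_abelian_semigroup_on X S" and X: "x \<in> X" "y \<in> X" "x \<noteq> y"
    and eq: "x ^^ i \<circ> y ^^ j = x ^^ i' \<circ> y ^^ j'"
  shows "(i, j) = (i', j')"
proof -
  obtain \<phi> where \<phi>: "inj_on \<phi> {M. M \<noteq> {#} \<and> set_mset M \<subseteq> X}" "\<And>x. x \<in> X \<Longrightarrow> \<phi> {#x#} = x"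
    "\<And>M N. M \<noteq> {#} \<Longrightarrow> set_mset M \<subseteq> X \<Longrightarrow> N \<noteq> {#} \<Longrightarrow> set_mset N \<subseteq> X \<Longrightarrow> \<phi> (M + N) = \<phi> M \<circ> \<phi> N" "X \<subseteq> S"
    by (rule free_abelian_semigroup_isomorphism[OF free]) iprover
  have pow: "\<phi> (replicate_mset (Suc n) z) = z ^^ Suc n" if z: "z \<in> X" for z n
  proof (induction n)
    case (Suc n)
    have "\<phi> ({#z#} + replicate_mset (Suc n) z) = \<phi> {#z#} \<circ> \<phi> (replicate_mset (Suc n) z)"
      using z by (intro \<phi>(3)) (auto simp: set_mset_replicate_mset_subset)
    then show ?case using Suc \<phi>(2)[OF z] by simp
  qed (use \<phi>(2) z in simp)
  have word: "\<phi> (replicate_mset (Suc i) x + replicate_mset (Suc j) y) = x ^^ Suc i \<circ> y ^^ Suc j" for i j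
    unfolding pow[OF X(1), symmetric] pow[OF X(2), symmetric]
    using X by (intro \<phi>(3)) (auto simp: set_mset_replicate_mset_subset)
  have "replicate_mset (Suc i) x + replicate_mset (Suc j) y = replicate_mset (Suc i') x + replicate_mset (Suc j') y"
  proof (rule inj_onD[OF \<phi>(1)])
    show "\<phi> (replicate_mset (Suc i) x + replicate_mset (Suc j) y) = \<phi> (replicate_mset (Suc i') x + replicate_mset (Suc j') y)"
      unfolding word by (rule funpow_Suc_Suc_coincidence[OF eq])
  qed (use X in \<open>auto simp: set_mset_replicate_mset_subset\<close>)
  then have "count (replicate_mset (Suc i) x + replicate_mset (Suc j) y) z
      = count (replicate_mset (Suc i') x + replicate_mset (Suc j') y) z" for z
    by simp
  from this[of x] this[of y] show ?thesis using X(3) by simp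
qed

theorem theorem14:
  fixes f g :: "complex \<Rightarrow> complex" and D :: "complex set"
  assumes "f holomorphic_on UNIV" and "g holomorphic_on UNIV"
    and "invariant_fatou_component f D" and "invariant_fatou_component g D"
    and "bounded D"
    and "attracting_component f D"
    and "{z. preperiodic f z} = {z. preperiodic g z}"
  shows "\<not> (\<exists>S. subsemigroup S (comp_semigroup {f, g}) \<and> free_noncyclic S) \<and>
         \<not> (\<exists>S. subsemigroup S (comp_semigroup {f, g}) \<and> free_abelian_noncyclic S)"
proof -
  obtain p where p: "p \<in> D" "f p = p" "deriv f p \<noteq> 0" "norm (deriv f p) < 1"
    using assms(6) unfolding attracting_component_def by auto
  have fD: "D \<in> components (fatou_set f)" "f ` D \<subseteq> D" and gD: "D \<in> components (fatou_set g)" "g ` D \<subseteq> D"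
    using assms(3,4) unfolding invariant_fatou_component_def by auto
  interpret bounded_attracting_component f D p
    using assms(1,5) fD p by unfold_locales
  have word: "proper_self_map D h \<and> preserves_preperiodic h" if "h \<in> comp_semigroup {f, g}" for h
    using that
  proof (induction rule: comp_semigroup.induct)
    case (gen h)
    have "preserves_preperiodic f"
      unfolding preserves_preperiodic_def using preperiodic_funpow[of f _ 1] by simp
    moreover have "preserves_preperiodic g"
      unfolding preserves_preperiodic_def using preperiodic_funpow[of g _ 1] assms(7) by auto
    moreover have "proper_self_map D g"
      by (rule invariant_component_proper[OF assms(2) gD assms(5)])
    ultimately show ?case using gen proper_f by auto
  next
    case (comp h k)
    have "proper_self_map D (h \<circ> k)" using proper_self_map_comp comp.IH by blast
    moreover have "preserves_preperiodic (h \<circ> k)" using comp.IH by (simp add: preserves_preperiodic_def)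
    ultimately show ?case by blast
  qed
  have coincide: "\<exists>i j i' j'. (i, j) \<noteq> (i', j') \<and> x ^^ i \<circ> y ^^ j = x ^^ i' \<circ> y ^^ j'"
    if "subsemigroup S (comp_semigroup {f, g})" "x \<in> S" "y \<in> S" for S x y
  proof -
    have "x \<in> comp_semigroup {f, g}" "y \<in> comp_semigroup {f, g}"
      using that unfolding subsemigroup_def by auto
    then show ?thesis using word[of x] word[of y] by (intro power_coincidence) simp_all
  qed
  show ?thesis
  proof (intro conjI notI; elim exE conjE)
    fix S assume S: "subsemigroup S (comp_semigroup {f, g})" "free_noncyclic S"
    then obtain X x y where X: "free_semigroup_on X S" "x \<in> X" "y \<in> X" "x \<noteq> y"
      unfolding free_noncyclic_def by blast
    have "X \<subseteq> S" by (rule free_semigroup_isomorphism[OF X(1)])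
    then have "x \<in> S" "y \<in> S" using X(2,3) by auto
    then obtain i j i' j' where "(i, j) \<noteq> (i', j')" "x ^^ i \<circ> y ^^ j = x ^^ i' \<circ> y ^^ j'"
      using coincide[OF S(1)] by blast
    then show False using free_semigroup_no_coincidence[OF X] by metis
  next
    fix S assume S: "subsemigroup S (comp_semigroup {f, g})" "free_abelian_noncyclic S"
    then obtain X x y where X: "free_abelian_semigroup_on X S" "x \<in> X" "y \<in> X" "x \<noteq> y"
      unfolding free_abelian_noncyclic_def by blast
    have "X \<subseteq> S" by (rule free_abelian_semigroup_isomorphism[OF X(1)])
    then have "x \<in> S" "y \<in> S" using X(2,3) by auto
    then obtain i j i' j' where "(i, j) \<noteq> (i', j')" "x ^^ i \<circ> y ^^ j = x ^^ i' \<circ> y ^^ j'"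
      using coincide[OF S(1)] by blast
    then show False using free_abelian_semigroup_no_coincidence[OF X] by metis
  qed
qed

end
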